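(* Let $x\in X$ and assume (A1)–(A3) as listed in the context with $h(\xi)=(\xi,\bar h)$ for a fixed $\bar h\in\mathbb{R}^{r-d}$. For an orthogonal $d\times d$ matrix $Q$ let $\hat Q=\begin{pmatrix}Q&0\\0&I\end{pmatrix}$, where $I$ is the $(r-d)\times(r-d)$ identity matrix. (a) The geometric condition that all components of all adjacent vertices of $\hat Q\mathcal D$ are distinct is a generic property in the space of all $d\times d$ orthogonal matrices $Q$; i.e. the set of orthogonal $Q$ for which it holds is residual. (b) Let $\xi$ be normally distributed with mean $m\in\mathbb{R}^d$ and nonsingular covariance matrix $\Sigma$, and let the orthogonal matrix $Q$ be chosen such that $Q\Sigma Q^\top={\rm diag}(\sigma_1^2,\ldots,\sigma_d^2)$. Let $\rho$ be the normal density with mean $m$ and covariance matrix ${\rm diag}(\sigma_1^2,\ldots,\sigma_d^2)$. If $Q$ belongs to the residual set of orthogonal matrices satisfying the generic property in (a), then the second order ANOVA approximation $$f^{(2)}=\sum_{u\subseteq D,\ 1\le|u|\le2}f_u$$ of the integrand $f$, written as a function of the transformed variable $\eta=Q\xi$, i.e. $f(\eta)=\max_{j=1,\ldots,\ell}\langle\hat Qv^j,(\eta,\bar h)-\hat QTx\rangle$, belongs to the tensor product Sobolev space $\mathcal W_{2,\rm mix}^{(1,\ldots,1)}(\mathbb{R}^d)$.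
   Context: Setting. $X\subseteq\mathbb{R}^m$ is a convex polyhedral set (here $m$ is the first-stage dimension), $T$ is a real matrix with $r$ rows acting on $X$, $W$ a real $r\times\bar m$ matrix, $q\in\mathbb{R}^{\bar m}$, $d\le r$. $P$ is the probability distribution of the random vector $\xi$ on $\mathbb{R}^d$. The dual feasible set is $\mathcal D=\{z\in\mathbb{R}^r:W^\top z\le q\}$; $v^1,\ldots,v^\ell$ denote its vertices, and $\mathcal D={\rm conv}\{v^1,\ldots,v^\ell\}+\{z\in\mathbb{R}^r:W^\top z\le 0\}$. The original two-stage integrand is $\xi\mapsto\max_{j}\langle v^j,(\xi,\bar h)-Tx\rangle$, which equals $\max_j\langle\hat Qv^j,(Q\xi,\bar h)-\hat QTx\rangle$. Two vertices of a polyhedron are adjacent if they are joined by an edge. The condition "all components of adjacent vertices are distinct" means: if $a,b$ are adjacent vertices then $a_k\neq b_k$ for every component $k$. Assumptions. (A1) $h(\xi)-Tx\in W(\mathbb{R}_+^{\bar m})$ for all $\xi\in\mathbb{R}^d$, $x\in X$ (relatively complete recourse). (A2) $\mathcal D\neq\emptyset$ (dual feasibility). (A3) $\int_{\mathbb{R}^d}\|\xi\|P(d\xi)<\infty$. Genericity. The orthogonal $d\times d$ matrices form a metric space with the standard norm topology. A subset of a metric space is residual if it can be represented as a countable intersection of open dense subsets; a property is generic if it holds on a residual set. ANOVA decomposition. Let $D=\{1,\ldots,d\}$ and let $\rho=\prod_i\rho_i$ be a product density with marginals $\rho_i$. For $k\in D$, $(P_kf)(\eta)=\int_{-\infty}^{\infty}f(\eta_1,\ldots,\eta_{k-1},s,\eta_{k+1},\ldots,\eta_d)\rho_k(s)\,ds$;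 for $u\subseteq D$, $P_u$ is the composition of the $P_k$, $k\in u$, and $-u=D\setminus u$. The ANOVA terms are $f_u=\sum_{v\subseteq u}(-1)^{|u|-|v|}P_{-v}f$. Function spaces. $L_{2,\rho}(\mathbb{R}^d)$ is the space of measurable $g$ with $\int_{\mathbb{R}^d}|g|^2\rho\,d\eta<\infty$. $\mathcal W_{2,\rm mix}^{(1,\ldots,1)}(\mathbb{R}^d)$ is the space of $g\in L_{2,\rho}(\mathbb{R}^d)$ all of whose mixed first derivatives $\big(\prod_{i\in w}\frac{\partial}{\partial\eta_i}\big)g$, $w\subseteq D$, exist in the weak (Sobolev) sense and belong to $L_{2,\rho}(\mathbb{R}^d)$.
   Formalization: Part (a) is proved assuming adjacent vertices of D differ in at least one of the first d components and in all of the last r−d (necessary: otherwise no Q satisfies the condition); part (b) assumes d ≠ 2, since for d = 2 the claim fails, e.g. for D=[0,1]^2, T=0, Σ=I and a generic rotation Q. *)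

theory Defs
  imports "HOL-Probability.Probability"
begin

section \<open>The two-stage problem and the transformed integrand\<close>

text \<open>
  The coordinates of $\mathbb{R}^r$ are indexed by a finite type \<open>'r\<close>, those of $\mathbb{R}^d$ by a
  finite linearly ordered type \<open>'d\<close>. An injection \<open>\<iota> :: 'd \<Rightarrow> 'r\<close> names the \<open>d\<close> coordinates of
  $\mathbb{R}^r$ that carry the random vector; the other \<open>r - d\<close> coordinates are those outside
  \<open>range \<iota>\<close>, and there may be none (a product or sum of index types would force \<open>d < r\<close>). Of the
  vector \<open>hbar\<close> only the entries outside \<open>range \<iota>\<close> are ever used.
\<close>

definition pad :: "('d \<Rightarrow> 'r) \<Rightarrow> real^'r \<Rightarrow> real^'d \<Rightarrow> real^'r" where
  "pad \<iota> hbar \<xi> = (\<chi> i. if i \<in> range \<iota> then \<xi> $ inv \<iota> i else hbar $ i)"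

definition hat :: "('d \<Rightarrow> 'r) \<Rightarrow> real^'d^'d \<Rightarrow> real^'r^'r" where
  "hat \<iota> Q = (\<chi> i j. if i \<in> range \<iota> \<and> j \<in> range \<iota> then Q $ inv \<iota> i $ inv \<iota> j
                     else if i = j then 1 else 0)"

definition dual_feasible :: "real^'n^'r \<Rightarrow> real^'n \<Rightarrow> (real^'r) set" where
  "dual_feasible W q = {z. \<forall>j. (transpose W *v z) $ j \<le> q $ j}"

definition vertices :: "'a::real_vector set \<Rightarrow> 'a set" where
  "vertices S = {v. v extreme_point_of S}"

definition adjacent_vertices :: "'a::euclidean_space set \<Rightarrow> 'a \<Rightarrow> 'a \<Rightarrow> bool" where
  "adjacent_vertices S a b \<longleftrightarrow>
     a \<in> vertices S \<and> b \<in> vertices S \<and> a \<noteq> b \<and> closed_segment a b edge_of S"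

definition adjacent_components_distinct :: "(real^'r) set \<Rightarrow> bool" where
  "adjacent_components_distinct S \<longleftrightarrow> (\<forall>a b. adjacent_vertices S a b \<longrightarrow> (\<forall>k. a $ k \<noteq> b $ k))"

text \<open>
  Since \<open>hat \<iota> Q\<close> fixes all coordinates outside \<open>range \<iota>\<close>, the image of \<open>S\<close> under it can satisfy
  \<open>adjacent_components_distinct\<close> for some orthogonal \<open>Q\<close> only if adjacent vertices of \<open>S\<close> already
  differ in every coordinate outside \<open>range \<iota>\<close> and in at least one coordinate of \<open>range \<iota>\<close>. The
  unit square with \<open>d = 1\<close>, \<open>r = 2\<close> violates this. For \<open>d = r\<close> it always holds.
\<close>

definition transformed_integrand ::
  "('d \<Rightarrow> 'r) \<Rightarrow> real^'r \<Rightarrow> real^'n^'r \<Rightarrow> real^'n \<Rightarrow> real^'m^'r \<Rightarrow> real^'m \<Rightarrow> real^'d^'d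
     \<Rightarrow> real^'d \<Rightarrow> real" where
  "transformed_integrand \<iota> hbar W q T x Q \<eta> =
     Max ((\<lambda>v. (hat \<iota> Q *v v) \<bullet> (pad \<iota> hbar \<eta> - hat \<iota> Q *v (T *v x))) ` vertices (dual_feasible W q))"

lemma pad_orthogonal_transform:
  fixes Q :: "real^'d^'d" and \<iota> :: "'d::finite \<Rightarrow> 'r::finite"
  assumes "inj \<iota>"
  shows "pad \<iota> hbar (Q *v \<xi>) = hat \<iota> Q *v pad \<iota> hbar \<xi>"
proof -
  have "(\<Sum>j\<in>UNIV. hat \<iota> Q $ i $ j * pad \<iota> hbar \<xi> $ j) = pad \<iota> hbar (Q *v \<xi>) $ i" for i
  proof (cases "i \<in> range \<iota>")
    case True
    have "(\<Sum>j\<in>UNIV. hat \<iota> Q $ i $ j * pad \<iota> hbar \<xi> $ j)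
        = (\<Sum>j\<in>range \<iota>. Q $ inv \<iota> i $ inv \<iota> j * \<xi> $ inv \<iota> j)"
      using True by (intro sum.mono_neutral_cong_right) (auto simp: hat_def pad_def)
    also have "\<dots> = (\<Sum>j\<in>UNIV. Q $ inv \<iota> i $ j * \<xi> $ j)"
      by (subst sum.reindex) (use assms in \<open>auto simp: inv_f_f\<close>)
    finally show ?thesis
      using True by (simp add: pad_def matrix_vector_mult_def)
  next
    case False
    have "(\<Sum>j\<in>UNIV. hat \<iota> Q $ i $ j * pad \<iota> hbar \<xi> $ j)
        = (\<Sum>j\<in>UNIV. if i = j then hbar $ j else 0)"
      using False by (intro sum.cong) (auto simp: hat_def pad_def)
    then show ?thesis
      using False by (simp add: pad_def)
  qed
  then show ?thesis
    by (simp add: vec_eq_iff matrix_vector_mult_def)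
qed


section \<open>Genericity\<close>

definition residual_in :: "'a::metric_space set \<Rightarrow> 'a set \<Rightarrow> bool" where
  "residual_in S A \<longleftrightarrow>
     (\<exists>U :: nat \<Rightarrow> 'a set.
        (\<forall>n. openin (top_of_set S) (U n) \<and> S \<subseteq> closure (U n)) \<and> A = (\<Inter>n. U n))"


section \<open>Multivariate normal densities\<close>

definition diag_mat :: "real^'d \<Rightarrow> real^'d^'d" where
  "diag_mat c = (\<chi> i j. if i = j then c $ i else 0)"

definition mv_normal_density :: "real^'d \<Rightarrow> real^'d^'d \<Rightarrow> real^'d \<Rightarrow> real" where
  "mv_normal_density \<mu> \<Sigma> y =
     exp (- ((y - \<mu>) \<bullet> (matrix_inv \<Sigma> *v (y - \<mu>))) / 2) / sqrt ((2 * pi) ^ CARD('d) * det \<Sigma>)"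

lemma mv_normal_density_diag:
  fixes \<mu> \<sigma> y :: "real^'d"
  assumes "\<And>i. \<sigma> $ i \<noteq> 0"
  shows "mv_normal_density \<mu> (diag_mat (\<chi> i. (\<sigma> $ i)\<^sup>2)) y
           = (\<Prod>i\<in>UNIV. normal_density (\<mu> $ i) (\<sigma> $ i) (y $ i))"
proof -
  let ?A = "diag_mat (\<chi> i. (\<sigma> $ i)\<^sup>2)" and ?B = "diag_mat (\<chi> i. 1 / (\<sigma> $ i)\<^sup>2)"
  have inv: "?A ** ?B = mat 1" "?B ** ?A = mat 1"
    using assms
    by (auto simp: vec_eq_iff matrix_matrix_mult_def diag_mat_def mat_def if_distrib
        [where f = "\<lambda>x. x * _"] if_distrib[where f = "\<lambda>x. _ * x"] cong: if_cong)
  have "matrix_inv ?A = ?B"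
    unfolding matrix_inv_def
    by (rule some_equality) (use inv in \<open>auto, metis matrix_mul_assoc matrix_mul_lid matrix_mul_rid\<close>)
  then have "(y - \<mu>) \<bullet> (matrix_inv ?A *v (y - \<mu>)) = (\<Sum>i\<in>UNIV. (y $ i - \<mu> $ i)\<^sup>2 / (\<sigma> $ i)\<^sup>2)"
    by (simp add: inner_vec_def matrix_vector_mult_def diag_mat_def power2_eq_square
        if_distrib[where f = "\<lambda>x. x * _"] cong: if_cong)
  moreover have "det ?A = (\<Prod>i\<in>UNIV. (\<sigma> $ i)\<^sup>2)"
    by (subst det_diagonal) (auto simp: diag_mat_def)
  moreover have "sqrt ((2 * pi) ^ CARD('d) * (\<Prod>i\<in>UNIV. (\<sigma> $ i)\<^sup>2))
      = (\<Prod>i\<in>UNIV. sqrt (2 * pi * (\<sigma> $ i)\<^sup>2))"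
  proof -
    have sqrt_prod: "sqrt (\<Prod>i\<in>UNIV. c i) = (\<Prod>i\<in>UNIV. sqrt (c i))" for c :: "'d \<Rightarrow> real"
      by (induction rule: infinite_finite_induct) (auto simp: real_sqrt_mult)
    have "(2 * pi) ^ CARD('d) * (\<Prod>i\<in>UNIV. (\<sigma> $ i)\<^sup>2) = (\<Prod>i\<in>UNIV. 2 * pi * (\<sigma> $ i)\<^sup>2)"
      unfolding prod.distrib prod_constant by simp
    then show ?thesis
      by (simp only: sqrt_prod)
  qed
  moreover have "exp (- (\<Sum>i\<in>UNIV. (y $ i - \<mu> $ i)\<^sup>2 / (\<sigma> $ i)\<^sup>2) / 2)
      = (\<Prod>i\<in>UNIV. exp (- (y $ i - \<mu> $ i)\<^sup>2 / (2 * (\<sigma> $ i)\<^sup>2)))"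
    by (simp flip: exp_sum add: sum_negf sum_divide_distrib mult.commute)
  ultimately show ?thesis
    unfolding mv_normal_density_def normal_density_def
    by (simp only: prod.distrib prod_dividef) simp
qed


section \<open>ANOVA decomposition\<close>

text \<open>The argument \<open>\<rho>\<close> is the family of marginal densities. The projections are composed in
  the order of the index type, because they commute only on sufficiently integrable functions.\<close>

definition anova_proj ::
  "('d \<Rightarrow> real \<Rightarrow> real) \<Rightarrow> 'd \<Rightarrow> (real^'d \<Rightarrow> real) \<Rightarrow> real^'d \<Rightarrow> real" where
  "anova_proj \<rho> k f \<eta> = (\<integral>s. f (\<chi> i. if i = k then s else \<eta> $ i) * \<rho> k s \<partial>lborel)"

definition anova_Proj ::
  "('d::{finite,linorder} \<Rightarrow> real \<Rightarrow> real) \<Rightarrow> 'd set \<Rightarrow> (real^'d::_ \<Rightarrow> real) \<Rightarrow> real^'d::_ \<Rightarrow> real" where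
  "anova_Proj \<rho> u f = foldr (anova_proj \<rho>) (sorted_list_of_set u) f"

definition anova_term ::
  "('d::{finite,linorder} \<Rightarrow> real \<Rightarrow> real) \<Rightarrow> (real^'d::_ \<Rightarrow> real) \<Rightarrow> 'd set \<Rightarrow> real^'d::_ \<Rightarrow> real" where
  "anova_term \<rho> f u \<eta> = (\<Sum>v\<in>Pow u. (-1) ^ (card u - card v) * anova_Proj \<rho> (- v) f \<eta>)"

definition second_order_anova ::
  "('d::{finite,linorder} \<Rightarrow> real \<Rightarrow> real) \<Rightarrow> (real^'d::_ \<Rightarrow> real) \<Rightarrow> real^'d::_ \<Rightarrow> real" where
  "second_order_anova \<rho> f \<eta> = (\<Sum>u | 1 \<le> card u \<and> card u \<le> 2. anova_term \<rho> f u \<eta>)"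


section \<open>Weighted Sobolev spaces of dominating mixed smoothness\<close>

definition partial :: "'d \<Rightarrow> (real^'d \<Rightarrow> real) \<Rightarrow> real^'d \<Rightarrow> real" where
  "partial k g x = frechet_derivative g (at x) (axis k 1)"

text \<open>
  All iterated partial derivatives being (Frechet) differentiable, hence continuous, everywhere is
  the same as being of class $C^\infty$.
\<close>

definition test_function :: "(real^'d \<Rightarrow> real) \<Rightarrow> bool" where
  "test_function \<phi> \<longleftrightarrow>
     (\<forall>ks x. foldr partial ks \<phi> differentiable (at x)) \<and> compact (closure {x. \<phi> x \<noteq> 0})"

definition mixed_partial :: "'d::{finite,linorder} set \<Rightarrow> (real^'d::_ \<Rightarrow> real) \<Rightarrow> real^'d::_ \<Rightarrow> real" where
  "mixed_partial w g = foldr partial (sorted_list_of_set w) g"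

definition locally_integrable :: "('a::euclidean_space \<Rightarrow> real) \<Rightarrow> bool" where
  "locally_integrable g \<longleftrightarrow> (\<forall>K. compact K \<longrightarrow> set_integrable lborel K g)"

definition weak_mixed_partial ::
  "'d::{finite,linorder} set \<Rightarrow> (real^'d::_ \<Rightarrow> real) \<Rightarrow> (real^'d::_ \<Rightarrow> real) \<Rightarrow> bool" where
  "weak_mixed_partial w g h \<longleftrightarrow>
     locally_integrable g \<and> locally_integrable h \<and>
     (\<forall>\<phi>. test_function \<phi> \<longrightarrow>
        (\<integral>x. g x * mixed_partial w \<phi> x \<partial>lborel) = (-1) ^ card w * (\<integral>x. h x * \<phi> x \<partial>lborel))"

definition L2_weighted :: "(real^'d \<Rightarrow> real) \<Rightarrow> (real^'d \<Rightarrow> real) set" where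
  "L2_weighted \<rho> = {g. g \<in> borel_measurable borel \<and> integrable lborel (\<lambda>x. \<bar>g x\<bar>\<^sup>2 * \<rho> x)}"

definition W2_mix :: "(real^'d::{finite,linorder} \<Rightarrow> real) \<Rightarrow> (real^'d::_ \<Rightarrow> real) set" where
  "W2_mix \<rho> = {g \<in> L2_weighted \<rho>. \<forall>w. \<exists>h \<in> L2_weighted \<rho>. weak_mixed_partial w g h}"

end

theory Submission
  imports Defs
begin

text \<open>
  For (a), each condition that a given component of the image of an edge direction is nonzero is
  open, and a small rotation in a coordinate plane makes it true, so it is dense; there are finitely
  many edges.

  For (b), the integrand is a maximum of affine functions indexed by the vertices of the dual
  polyhedron. If two vertices are maximal at a point, the maximal face there has an edge, and its
  endpoints differ in every component; so on each line in direction \<open>k\<close> one vertex is the only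
  maximiser outside finitely many points. Hence the one-sided derivative of \<open>P\<^sub>k f\<close> in direction \<open>i\<close>
  is the sum over the vertices of the slope times the Gaussian probability of being the maximiser,
  and these probabilities are differences of distribution functions at maxima and minima of affine
  functions. They are Lipschitz and have one-sided derivatives, so \<open>P\<^sub>k f\<close> has bounded mixed second
  differences that converge everywhere, and the limits are weak derivatives by dominated
  convergence. If \<open>d \<noteq> 2\<close>, every second order term has at least one variable integrated out.
\<close>


section \<open>Edges of polyhedra\<close>

text \<open>A maximum of affine functions has no two-sided derivative at its kinks, and the
  probabilities that appear after one integration are again built from maxima and minima. The proof
  of (b) therefore works with right difference quotients that are uniformly bounded and converge at
  every point. This class is stable under sums, maxima and minima; the limit is a Borel function
  without exceptional set, so it can be differentiated again; and the uniform bound lets limits pass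
  under the projections.

  The hard case is a pair of pieces with the same slope in direction \<open>k\<close>. Which of the
  two is larger does not depend on the integrated variable, so the comparison survives the
  integration as an indicator that could jump. The edge argument excludes the jump: a tie among
  pieces of equal slope only would be a maximal face without an edge whose endpoints differ in
  component \<open>k\<close>.

  If there are exactly two random components, the approximation equals \<open>f\<close> minus its
  mean: the kinks of \<open>f\<close> itself remain, because no variable has been integrated out.
  Hence the premise on the cardinality in (b).\<close>

lemma polytope_edge_exists:
  fixes S :: "'a::euclidean_space set"
  assumes "polytope S" "1 \<le> aff_dim S"
  shows "\<exists>e. e edge_of S"
  using assms
proof (induction "nat (aff_dim S)" arbitrary: S rule: less_induct)
  case less
  show ?case
  proof (cases "aff_dim S = 1")
    case True
    then show ?thesis
      using less.prems polytope_imp_convex face_of_refl unfolding edge_of_def by blast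
  next
    case False
    obtain F where F: "F facet_of S"
      using polytope_facet_exists less.prems by (metis zero_less_one order_less_le_trans)
    then have "aff_dim F = aff_dim S - 1" "F face_of S"
      by (auto simp: facet_of_def)
    moreover have "polytope F"
      using \<open>F face_of S\<close> less.prems(1) face_of_polytope_polytope by blast
    ultimately obtain e where "e edge_of F"
      using less.hyps[of F] less.prems False by fastforce
    then show ?thesis
      using \<open>F face_of S\<close> by (auto simp: edge_of_def intro: face_of_trans)
  qed
qed

text \<open>A compact convex collinear set is a segment. Its endpoints are extreme in the edge, and
  extreme points of a face are extreme in the whole set.\<close>

lemma bounded_edge_adjacent_vertices:
  fixes S :: "'a::euclidean_space set"
  assumes "e edge_of S" "polytope e"
  obtains a b where "adjacent_vertices S a b" "e = closed_segment a b"
proof -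
  have e: "e face_of S" "aff_dim e = 1"
    using assms(1) by (auto simp: edge_of_def)
  then obtain a b where ab: "e = closed_segment a b"
    using assms(2) compact_convex_collinear_segment[of e] collinear_aff_dim[of e]
    by (metis aff_dim_empty polytope_imp_compact polytope_imp_convex order_refl zero_neq_one
        neg_equal_zero equal_neg_zero one_neq_neg_one)
  have "a \<noteq> b"
    using e(2) ab by auto
  moreover have "a extreme_point_of S" "b extreme_point_of S"
    using extreme_point_of_face[OF e(1)] ab by (auto simp: extreme_point_of_segment)
  ultimately show thesis
    using that ab assms(1) by (auto simp: adjacent_vertices_def vertices_def)
qed

text \<open>Complementary slackness: if a convex combination attains the bound \<open>M\<close>,
  every point of positive weight attains it. So \<open>z\<close> is a combination of maximisers of
  \<open>p\<close>, and only on these does \<open>c\<close> have to be controlled.\<close>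

lemma convex_hull_argmax:
  fixes V :: "'a::euclidean_space set"
  assumes "finite V" "z \<in> convex hull V"
    and le: "\<And>w. w \<in> V \<Longrightarrow> p \<bullet> w \<le> M" and eq: "p \<bullet> z = M"
    and c: "\<And>w. w \<in> V \<Longrightarrow> p \<bullet> w = M \<Longrightarrow> c \<bullet> w \<le> N"
  shows "c \<bullet> z \<le> N"
proof -
  obtain u where u: "\<And>w. w \<in> V \<Longrightarrow> 0 \<le> u w" "sum u V = 1" "(\<Sum>w\<in>V. u w *\<^sub>R w) = z"
    using assms(2) unfolding convex_hull_finite[OF assms(1)] by auto
  have dist: "(\<Sum>w\<in>V. u w * (K - r \<bullet> w)) = K - r \<bullet> z" for K r
    using u(2) by (simp add: u(3)[symmetric] inner_sum_right right_diff_distrib sum_subtractf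
        flip: sum_distrib_right)
  have "(\<Sum>w\<in>V. u w * (M - p \<bullet> w)) = 0"
    using dist[of M p] eq by simp
  then have zero: "u w * (M - p \<bullet> w) = 0" if "w \<in> V" for w
    using that assms(1) le u(1)
    by (subst (asm) sum_nonneg_eq_0_iff) auto
  have "0 \<le> (\<Sum>w\<in>V. u w * (N - c \<bullet> w))"
  proof (rule sum_nonneg)
    fix w assume "w \<in> V"
    with zero[of w] u(1)[of w] c[of w] show "0 \<le> u w * (N - c \<bullet> w)"
      by (cases "u w = 0") auto
  qed
  then show ?thesis
    using dist[of N c] by simp
qed

text \<open>Faces of polyhedra are exposed; \<open>a\<close> is the normal of a supporting
  hyperplane that meets \<open>S\<close> in \<open>v\<close> alone.\<close>

lemma vertex_exposed:
  fixes S :: "'a::euclidean_space set"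
  assumes "polyhedron S" "v \<in> vertices S"
  obtains a where "\<And>z. z \<in> S \<Longrightarrow> z \<noteq> v \<Longrightarrow> a \<bullet> z < a \<bullet> v"
proof -
  have "{v} exposed_face_of S"
    using assms by (simp add: exposed_face_of_polyhedron face_of_singleton vertices_def)
  then obtain a b where ab: "S \<subseteq> {x. a \<bullet> x \<le> b}" "{v} = S \<inter> {x. a \<bullet> x = b}"
    by (auto simp: exposed_face_of_def)
  have "a \<bullet> z < a \<bullet> v" if "z \<in> S" "z \<noteq> v" for z
  proof -
    have "a \<bullet> v = b" "a \<bullet> z \<le> b" "a \<bullet> z \<noteq> b"
      using ab that by blast+
    then show ?thesis by simp
  qed
  then show thesis
    using that by blast
qed

text \<open>Moving from a functional that exposes \<open>v\<close> to one that exposes \<open>v'\<close>, the first functional at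
  which \<open>v\<close> is not the only maximiser has a bounded maximal face, since both functionals are negative
  on the recession cone.\<close>

lemma adjacent_maximisers_exist:
  fixes S :: "'a::euclidean_space set"
  assumes poly: "polyhedron S"
    and dec: "\<And>z. z \<in> S \<Longrightarrow> \<exists>a\<in>convex hull (vertices S). \<exists>b\<in>C. z = a + b"
    and rec: "\<And>z b. z \<in> S \<Longrightarrow> b \<in> C \<Longrightarrow> z + b \<in> S"
    and pC: "\<And>b. b \<in> C \<Longrightarrow> p \<bullet> b \<le> 0"
    and v: "v \<in> vertices S" "v' \<in> vertices S" "v \<noteq> v'"
    and vmax: "\<And>w. w \<in> vertices S \<Longrightarrow> p \<bullet> w \<le> p \<bullet> v" and v'max: "p \<bullet> v' = p \<bullet> v"
  shows "\<exists>a b. adjacent_vertices S a b \<and> p \<bullet> a = p \<bullet> v \<and> p \<bullet> b = p \<bullet> v"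
proof -
  have finV: "finite (vertices S)"
    using finite_polyhedron_extreme_points[OF poly] by (simp add: vertices_def)
  have VS: "vertices S \<subseteq> S"
    by (auto simp: vertices_def extreme_point_of_def)
  obtain a where a: "\<And>z. z \<in> S \<Longrightarrow> z \<noteq> v \<Longrightarrow> a \<bullet> z < a \<bullet> v"
    using vertex_exposed[OF poly v(1)] by blast
  obtain a' where a': "\<And>z. z \<in> S \<Longrightarrow> z \<noteq> v' \<Longrightarrow> a' \<bullet> z < a' \<bullet> v'"
    using vertex_exposed[OF poly v(2)] by blast
  define \<alpha> where "\<alpha> w = a \<bullet> (v - w)" for w
  define \<beta> where "\<beta> w = a' \<bullet> (v - w)" for w
  \<comment> \<open>The vertices that tie with \<open>v\<close> under \<open>p\<close> and overtake
    it on the way from \<open>a\<close> to \<open>a'\<close>; \<open>v'\<close> is one of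
    them.\<close>
  define B where "B = {w \<in> vertices S. p \<bullet> w = p \<bullet> v \<and> w \<noteq> v \<and> \<beta> w < 0}"
  have \<alpha>pos: "0 < \<alpha> w" if "w \<in> vertices S" "w \<noteq> v" for w
    using a[of w] that VS by (auto simp: \<alpha>_def inner_diff_right)
  have finB: "finite B"
    using finV by (simp add: B_def)
  have "v' \<in> B"
    using a'[of v] v VS v'max by (auto simp: B_def \<beta>_def inner_diff_right)
  then have neB: "B \<noteq> {}" by auto
  \<comment> \<open>Along \<open>(1 - s) a + s a'\<close> the lead of \<open>v\<close> over
    \<open>w\<close> is \<open>\<alpha> w - s (\<alpha> w - \<beta> w)\<close>, which vanishes at
    \<open>s = \<alpha> w / (\<alpha> w - \<beta> w)\<close>. The least of these values is the first
    tie, and \<open>w0\<close> attains it.\<close>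
  define t where "t = Min ((\<lambda>w. \<alpha> w / (\<alpha> w - \<beta> w)) ` B)"
  obtain w0 where w0: "w0 \<in> B" "t = \<alpha> w0 / (\<alpha> w0 - \<beta> w0)"
    using Min_in[of "(\<lambda>w. \<alpha> w / (\<alpha> w - \<beta> w)) ` B"] finB neB unfolding t_def by blast
  have tle: "t \<le> \<alpha> w / (\<alpha> w - \<beta> w)" if "w \<in> B" for w
    using finB that by (simp add: t_def)
  have w0B: "w0 \<in> vertices S" "p \<bullet> w0 = p \<bullet> v" "w0 \<noteq> v" "\<beta> w0 < 0"
    using w0(1) by (auto simp: B_def)
  have t01: "0 < t" "t < 1"
    using \<alpha>pos[of w0] w0B unfolding w0(2) by (simp_all add: divide_less_eq_1_pos)
  define c where "c = (1 - t) *\<^sub>R a + t *\<^sub>R a'"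
  have cdiff: "c \<bullet> (v - w) = (1 - t) * \<alpha> w + t * \<beta> w" for w
    by (simp add: c_def \<alpha>_def \<beta>_def inner_add_left)
  have cV: "c \<bullet> w \<le> c \<bullet> v" if "w \<in> vertices S" "p \<bullet> w = p \<bullet> v" for w
  proof -
    have "0 \<le> (1 - t) * \<alpha> w + t * \<beta> w"
    proof (cases "w = v")
      case True
      then show ?thesis by (simp add: \<alpha>_def \<beta>_def)
    next
      case False
      note ap = \<alpha>pos[OF that(1) False]
      show ?thesis
      proof (cases "\<beta> w < 0")
        case True
        then have "t * (\<alpha> w - \<beta> w) \<le> \<alpha> w"
          using tle[of w] that False ap by (simp add: B_def field_simps)
        then show ?thesis by (simp add: algebra_simps)
      next
        case False
        then show ?thesis using ap t01 by simp
      qed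
    qed
    then show ?thesis
      using cdiff[of w] by (simp add: inner_diff_right)
  qed
  have cw0: "c \<bullet> w0 = c \<bullet> v"
  proof -
    have "t * (\<alpha> w0 - \<beta> w0) = \<alpha> w0"
      using w0(2) \<alpha>pos[of w0] w0B by simp
    then have "c \<bullet> (v - w0) = 0"
      unfolding cdiff by (simp add: algebra_simps)
    then show ?thesis by (simp add: inner_diff_right)
  qed
  \<comment> \<open>The ray from \<open>v\<close> in direction \<open>b\<close> stays in
    \<open>S\<close>, so a functional that exposes \<open>v\<close> decreases strictly along it; the
    same holds for \<open>v'\<close> and \<open>a'\<close>, and \<open>c\<close> mixes the two with
    positive weights.\<close>
  have cC: "c \<bullet> b < 0" if "b \<in> C" "b \<noteq> 0" for b
  proof -
    have "a \<bullet> b < 0"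
      using a[of "v + b"] rec[of v b] that v VS by (auto simp: inner_add_right)
    moreover have "a' \<bullet> b < 0"
      using a'[of "v' + b"] rec[of v' b] that v VS by (auto simp: inner_add_right)
    ultimately show ?thesis
      using t01 by (simp add: c_def inner_add_left mult_pos_neg add_neg_neg)
  qed
  have conv_le: "p \<bullet> y \<le> p \<bullet> v" if "y \<in> convex hull vertices S" for y
  proof -
    have "vertices S \<subseteq> {y. p \<bullet> y \<le> p \<bullet> v}"
      using vmax by auto
    then show ?thesis
      using that hull_minimal[of "vertices S" "{y. p \<bullet> y \<le> p \<bullet> v}" convex]
      by (auto simp: convex_halfspace_le)
  qed
  have pS: "p \<bullet> z \<le> p \<bullet> v" if z: "z \<in> S" for z
  proof -
    obtain y b where "y \<in> convex hull vertices S" "b \<in> C" "z = y + b"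
      using dec[OF z] by blast
    then show ?thesis
      using conv_le[of y] pC[of b] by (simp add: inner_add_right)
  qed
  \<comment> \<open>The maximisation is lexicographic, \<open>p\<close> first and then
    \<open>c\<close>: against \<open>v\<close>, the functional \<open>c\<close> has been compared
    only with vertices that tie under \<open>p\<close>.\<close>
  define F where "F = S \<inter> {z. p \<bullet> z = p \<bullet> v}"
  define G where "G = F \<inter> {z. c \<bullet> z = c \<bullet> v}"
  have F_dec: "\<exists>y b. y \<in> convex hull vertices S \<and> b \<in> C \<and> z = y + b \<and> c \<bullet> y \<le> c \<bullet> v"
    if z: "z \<in> F" for z
  proof -
    obtain y b where yb: "y \<in> convex hull vertices S" "b \<in> C" "z = y + b"
      using dec[of z] z by (auto simp: F_def)
    then have "p \<bullet> y = p \<bullet> v"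
      using conv_le[of y] pC[of b] z by (auto simp: F_def inner_add_right)
    then have "c \<bullet> y \<le> c \<bullet> v"
      using convex_hull_argmax[OF finV yb(1), of p "p \<bullet> v" c "c \<bullet> v"] vmax cV by auto
    with yb show ?thesis by blast
  qed
  have cF: "c \<bullet> z \<le> c \<bullet> v" if z: "z \<in> F" for z
  proof -
    obtain y b where "b \<in> C" "z = y + b" "c \<bullet> y \<le> c \<bullet> v"
      using F_dec[OF z] by blast
    then show ?thesis
      using cC[of b] by (cases "b = 0") (auto simp: inner_add_right)
  qed
  have "F face_of S"
    unfolding F_def using poly pS
    by (intro face_of_Int_supporting_hyperplane_le) (auto simp: polyhedron_imp_convex)
  moreover then have "convex F"
    using face_of_imp_convex by blast
  then have "G face_of F"
    unfolding G_def using cF by (intro face_of_Int_supporting_hyperplane_le) auto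
  ultimately have GS: "G face_of S"
    using face_of_trans by blast
  have "G \<subseteq> convex hull vertices S"
  proof
    fix z assume z: "z \<in> G"
    then obtain y b where yb: "y \<in> convex hull vertices S" "b \<in> C" "z = y + b" "c \<bullet> y \<le> c \<bullet> v"
      using F_dec[of z] by (auto simp: G_def)
    then have "b = 0"
      using cC[of b] z by (cases "b = 0") (auto simp: G_def inner_add_right)
    with yb show "z \<in> convex hull vertices S" by simp
  qed
  then have "bounded G"
    using finV by (meson bounded_subset compact_convex_hull compact_imp_bounded finite_imp_compact)
  moreover have "polyhedron G"
    using GS poly face_of_polyhedron_polyhedron by blast
  ultimately have Gpoly: "polytope G"
    by (simp add: polytope_eq_bounded_polyhedron)
  have vG: "v \<in> G" "w0 \<in> G"
    using v w0B VS cw0 by (auto simp: G_def F_def)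
  \<comment> \<open>\<open>G\<close> contains the two distinct points \<open>v\<close> and
    \<open>w0\<close>.\<close>
  have "1 \<le> aff_dim G"
  proof (rule ccontr)
    assume "\<not> 1 \<le> aff_dim G"
    moreover have "aff_dim G \<noteq> -1"
      using vG aff_dim_empty[of G] by blast
    ultimately have "aff_dim G = 0"
      using aff_dim_geq[of G] by linarith
    then obtain g where "G = {g}"
      by (auto simp: aff_dim_eq_0)
    then show False
      using vG w0B by auto
  qed
  then obtain e where e: "e edge_of G"
    using polytope_edge_exists[OF Gpoly] by blast
  then have "polytope e" "e edge_of S"
    using Gpoly GS by (auto simp: edge_of_def intro: face_of_polytope_polytope face_of_trans)
  then obtain a1 b1 where ab: "adjacent_vertices S a1 b1" "e = closed_segment a1 b1"
    using bounded_edge_adjacent_vertices by blast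
  moreover have "a1 \<in> G" "b1 \<in> G"
    using ab(2) e edge_of_imp_subset by fastforce+
  ultimately show ?thesis
    by (auto simp: G_def F_def)
qed

lemma adjacent_vertices_injective_linear_image:
  assumes "linear h" "inj h"
  shows "adjacent_vertices (h ` S) (h a) (h b) \<longleftrightarrow> adjacent_vertices S a b"
proof -
  have "h v \<in> vertices (h ` S) \<longleftrightarrow> v \<in> vertices S" for v
    using face_of_linear_image[OF assms, of "{v}" S]
    by (simp add: vertices_def flip: face_of_singleton)
  moreover have "closed_segment (h a) (h b) edge_of h ` S \<longleftrightarrow> closed_segment a b edge_of S"
    using assms
    by (simp add: edge_of_def face_of_linear_image closed_segment_linear_image aff_dim_injective_linear_image)
  ultimately show ?thesis
    using assms(2) by (auto simp: adjacent_vertices_def inj_eq)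
qed

section \<open>Genericity\<close>

lemma inner_pad:
  fixes \<iota> :: "'d::finite \<Rightarrow> 'r::finite" and a b :: "real^'d"
  assumes "inj \<iota>"
  shows "pad \<iota> z a \<bullet> pad \<iota> w b = a \<bullet> b + (\<Sum>i\<in>- range \<iota>. z $ i * w $ i)"
proof -
  have "pad \<iota> z a \<bullet> pad \<iota> w b
      = (\<Sum>i\<in>range \<iota>. pad \<iota> z a $ i * pad \<iota> w b $ i) + (\<Sum>i\<in>- range \<iota>. pad \<iota> z a $ i * pad \<iota> w b $ i)"
    unfolding inner_vec_def
    by (subst sum.union_disjoint[symmetric]) (auto simp: Compl_partition)
  also have "(\<Sum>i\<in>range \<iota>. pad \<iota> z a $ i * pad \<iota> w b $ i) = a \<bullet> b"
    using assms by (subst sum.reindex) (auto simp: pad_def inner_vec_def)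
  also have "(\<Sum>i\<in>- range \<iota>. pad \<iota> z a $ i * pad \<iota> w b $ i) = (\<Sum>i\<in>- range \<iota>. z $ i * w $ i)"
    by (intro sum.cong) (auto simp: pad_def)
  finally show ?thesis .
qed

lemma pad_self: "inj \<iota> \<Longrightarrow> pad \<iota> z (\<chi> k. z $ \<iota> k) = z"
  by (auto simp: pad_def vec_eq_iff)

lemma pad_nth_range [simp]: "inj \<iota> \<Longrightarrow> pad \<iota> z a $ \<iota> k = a $ k"
  by (simp add: pad_def)

lemma pad_nth_outside [simp]: "i \<notin> range \<iota> \<Longrightarrow> pad \<iota> z a $ i = z $ i"
  by (simp add: pad_def)

lemma hat_mult_eq_pad:
  fixes \<iota> :: "'d::finite \<Rightarrow> 'r::finite"
  assumes "inj \<iota>"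
  shows "hat \<iota> Q *v z = pad \<iota> z (Q *v (\<chi> k. z $ \<iota> k))"
  using pad_orthogonal_transform[OF assms, of z Q "\<chi> k. z $ \<iota> k"] by (simp add: pad_self assms)

lemma orthogonal_matrix_inner:
  fixes Q :: "real^'n^'n"
  assumes "orthogonal_matrix Q"
  shows "(Q *v a) \<bullet> (Q *v b) = a \<bullet> b"
proof -
  have "(Q *v a) \<bullet> (Q *v b) = a \<bullet> (transpose Q *v (Q *v b))"
    by (metis dot_lmul_matrix transpose_matrix_vector transpose_transpose)
  also have "\<dots> = a \<bullet> b"
    using assms by (simp add: matrix_vector_mul_assoc orthogonal_matrix)
  finally show ?thesis .
qed

lemma hat_inner:
  fixes \<iota> :: "'d::finite \<Rightarrow> 'r::finite"
  assumes "inj \<iota>" "orthogonal_matrix Q"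
  shows "(hat \<iota> Q *v z) \<bullet> (hat \<iota> Q *v w) = z \<bullet> w"
proof -
  have "z \<bullet> w = pad \<iota> z (\<chi> k. z $ \<iota> k) \<bullet> pad \<iota> w (\<chi> k. w $ \<iota> k)"
    by (simp only: pad_self[OF assms(1)])
  then show ?thesis
    by (simp only: hat_mult_eq_pad[OF assms(1)] inner_pad[OF assms(1)] orthogonal_matrix_inner[OF assms(2)])
qed

lemma inj_hat:
  fixes \<iota> :: "'d::finite \<Rightarrow> 'r::finite"
  assumes "inj \<iota>" "orthogonal_matrix Q"
  shows "inj ((*v) (hat \<iota> Q))"
proof (rule injI)
  fix z w assume "hat \<iota> Q *v z = hat \<iota> Q *v w"
  then have "hat \<iota> Q *v (z - w) = 0"
    by (simp add: matrix_vector_mult_diff_distrib)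
  then have "(z - w) \<bullet> (z - w) = 0"
    using hat_inner[OF assms, of "z - w" "z - w"] by simp
  then show "z = w" by simp
qed

lemma adjacent_vertices_hat_image:
  fixes \<iota> :: "'d::finite \<Rightarrow> 'r::finite"
  assumes "inj \<iota>" "orthogonal_matrix Q"
  shows "adjacent_vertices ((*v) (hat \<iota> Q) ` S) (hat \<iota> Q *v a) (hat \<iota> Q *v b) \<longleftrightarrow> adjacent_vertices S a b"
  using adjacent_vertices_injective_linear_image[OF _ inj_hat[OF assms]]
  by (simp add: matrix_vector_mul_linear)

text \<open>The witness is \<open>Q\<close> followed by a small rotation in a coordinate plane.\<close>

lemma orthogonal_matrix_perturb_component:
  fixes Q :: "real^'d^'d" and n :: "real^'d"
  assumes Q: "orthogonal_matrix Q" and "n \<noteq> 0" "0 < e"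
  obtains Q' where "orthogonal_matrix Q'" "dist Q' Q < e" "(Q' *v n) $ k \<noteq> 0"
proof (cases "(Q *v n) $ k = 0")
  case False
  then show ?thesis using that[of Q] assms by simp
next
  case True
  have "(Q *v n) \<bullet> (Q *v n) \<noteq> 0"
    using \<open>n \<noteq> 0\<close> by (simp add: orthogonal_matrix_inner[OF Q])
  then obtain l where l: "(Q *v n) $ l \<noteq> 0"
    by (auto simp: vec_eq_iff)
  then have "l \<noteq> k" using True by auto
  \<comment> \<open>Rows \<open>k\<close> and \<open>l\<close> of \<open>Q\<close> are rotated into
    each other. As component \<open>k\<close> of \<open>Q *v n\<close> vanishes and component
    \<open>l\<close> does not, component \<open>k\<close> of the rotated image is
    \<open>sin \<theta>\<close> times a nonzero number.\<close>
  define R where "R \<theta> = (\<chi> i j. if i = k then cos \<theta> * Q $ k $ j + sin \<theta> * Q $ l $ j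
       else if i = l then cos \<theta> * Q $ l $ j - sin \<theta> * Q $ k $ j else Q $ i $ j)" for \<theta>
  have split: "(\<Sum>i\<in>UNIV. g i) = g k + g l + sum g (UNIV - {k} - {l})" for g :: "'d \<Rightarrow> real"
    using \<open>l \<noteq> k\<close> by (simp add: sum.remove[of UNIV k] sum.remove[of "UNIV - {k}" l])
  have cs: "cos \<theta> * cos \<theta> + sin \<theta> * sin \<theta> = 1" for \<theta> :: real
    using sin_cos_squared_add[of \<theta>] by (simp add: power2_eq_square add.commute)
  have R_orth: "orthogonal_matrix (R \<theta>)" for \<theta>
  proof -
    have "(\<Sum>i\<in>UNIV. R \<theta> $ i $ a * R \<theta> $ i $ b) = (\<Sum>i\<in>UNIV. Q $ i $ a * Q $ i $ b)" for a b
    proof -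
      have "R \<theta> $ k $ a * R \<theta> $ k $ b + R \<theta> $ l $ a * R \<theta> $ l $ b
          = Q $ k $ a * Q $ k $ b + Q $ l $ a * Q $ l $ b"
      proof -
        have "(c * A + s * B) * (c * A' + s * B') + (c * B - s * A) * (c * B' - s * A') = A * A' + B * B'"
          if "c * c + s * s = 1" for c s A B A' B' :: real
        proof -
          have "(c * A + s * B) * (c * A' + s * B') + (c * B - s * A) * (c * B' - s * A')
              = (c * c + s * s) * (A * A' + B * B')"
            by (simp add: algebra_simps)
          then show ?thesis using that by simp
        qed
        from this[OF cs[of \<theta>]] show ?thesis
          using \<open>l \<noteq> k\<close> by (simp add: R_def)
      qed
      moreover have "sum (\<lambda>i. R \<theta> $ i $ a * R \<theta> $ i $ b) (UNIV - {k} - {l})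
          = sum (\<lambda>i. Q $ i $ a * Q $ i $ b) (UNIV - {k} - {l})"
        by (rule sum.cong) (auto simp: R_def)
      ultimately show ?thesis
        unfolding split[of "\<lambda>i. R \<theta> $ i $ a * R \<theta> $ i $ b"] split[of "\<lambda>i. Q $ i $ a * Q $ i $ b"]
        by simp
    qed
    moreover have "transpose Q ** Q = mat 1"
      using Q by (simp add: orthogonal_matrix)
    ultimately have "transpose (R \<theta>) ** R \<theta> = mat 1"
      by (simp add: vec_eq_iff matrix_matrix_mult_def transpose_def)
    then show ?thesis
      by (simp add: orthogonal_matrix)
  qed
  have Rn: "(R \<theta> *v n) $ k = sin \<theta> * (Q *v n) $ l" for \<theta>
  proof -
    have "(R \<theta> *v n) $ k = cos \<theta> * (Q *v n) $ k + sin \<theta> * (Q *v n) $ l"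
      by (simp add: R_def matrix_vector_mult_def sum_distrib_left algebra_simps sum.distrib)
    then show ?thesis using True by simp
  qed
  have "(R \<longlongrightarrow> (\<chi> i j. Q $ i $ j)) (at_right 0)"
    unfolding R_def
  proof (intro vec_tendstoI)
    fix i j
    have "((\<lambda>\<theta>. cos \<theta> * a + sin \<theta> * b) \<longlongrightarrow> a) (at_right 0)"
      "((\<lambda>\<theta>. cos \<theta> * a - sin \<theta> * b) \<longlongrightarrow> a) (at_right 0)" for a b :: real
      by (auto intro!: tendsto_eq_intros)
    then show "((\<lambda>\<theta>. (\<chi> i j. if i = k then cos \<theta> * Q $ k $ j + sin \<theta> * Q $ l $ j
         else if i = l then cos \<theta> * Q $ l $ j - sin \<theta> * Q $ k $ j else Q $ i $ j) $ i $ j)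
         \<longlongrightarrow> (\<chi> i j. Q $ i $ j) $ i $ j) (at_right 0)"
      by (cases "i = k"; cases "i = l"; simp)
  qed
  then have "eventually (\<lambda>\<theta>. dist (R \<theta>) Q < e) (at_right 0)"
    using \<open>0 < e\<close> by (simp add: tendsto_iff)
  moreover have "eventually (\<lambda>\<theta>::real. \<theta> \<in> {0<..<pi}) (at_right 0)"
    by (rule eventually_at_right_real) simp
  ultimately obtain \<theta> where "dist (R \<theta>) Q < e" "\<theta> \<in> {0<..<pi}"
    using eventually_happens'[OF trivial_limit_at_right_real eventually_conj] by blast
  moreover then have "sin \<theta> \<noteq> 0"
    using sin_gt_zero[of \<theta>] by auto
  ultimately show ?thesis
    using that[of "R \<theta>"] R_orth Rn l by simp
qed

section \<open>Finitely many open dense conditions\<close>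

lemma residual_inI:
  assumes "finite P"
    and "\<And>p. p \<in> P \<Longrightarrow> openin (top_of_set S) (S \<inter> G p)"
    and "\<And>p. p \<in> P \<Longrightarrow> S \<subseteq> closure (S \<inter> G p)"
  shows "residual_in S {x \<in> S. \<forall>p\<in>P. x \<in> G p}"
proof -
  \<comment> \<open>\<open>residual_in\<close> asks for a sequence, so the finite family is
    enumerated with repetitions. An empty family has no enumeration, and \<open>S\<close> itself
    takes its place.\<close>
  define U where "U n = (if P = {} then S else S \<inter> G (from_nat_into P n))" for n
  have "openin (top_of_set S) (U n) \<and> S \<subseteq> closure (U n)" for n
    using assms(2,3)[OF from_nat_into, of n] by (auto simp: U_def closure_subset)
  moreover have "{x \<in> S. \<forall>p\<in>P. x \<in> G p} = (\<Inter>n. U n)"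
  proof (cases "P = {}")
    case True
    then show ?thesis by (auto simp: U_def)
  next
    case False
    then have "range (from_nat_into P) = P"
      using assms(1) by (simp add: range_from_nat_into countable_finite)
    then have "(\<forall>p\<in>P. x \<in> G p) \<longleftrightarrow> (\<forall>n. x \<in> G (from_nat_into P n))" for x
      by (metis rangeE rangeI)
    then show ?thesis
      using False by (auto simp: U_def)
  qed
  ultimately show ?thesis
    unfolding residual_in_def by blast
qed

lemma residual_orthogonal_nonzero_components:
  fixes N :: "(real^'d) set"
  assumes "finite N" "0 \<notin> N"
  shows "residual_in {Q :: real^'d^'d. orthogonal_matrix Q}
      {Q. orthogonal_matrix Q \<and> (\<forall>n\<in>N. \<forall>k. (Q *v n) $ k \<noteq> 0)}"
proof -
  let ?S = "{Q :: real^'d^'d. orthogonal_matrix Q}"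
  let ?G = "\<lambda>(n, k). {Q :: real^'d^'d. (Q *v n) $ k \<noteq> 0}"
  have "residual_in ?S {Q \<in> ?S. \<forall>p\<in>N \<times> UNIV. Q \<in> ?G p}"
  proof (rule residual_inI)
    show "finite (N \<times> (UNIV :: 'd set))"
      using assms(1) by simp
  next
    fix p :: "(real^'d) \<times> 'd" assume "p \<in> N \<times> UNIV"
    then obtain n k where p: "p = (n, k)" "n \<in> N" by auto
    have "open {Q :: real^'d^'d. (Q *v n) $ k \<noteq> 0}"
      unfolding matrix_vector_mult_def
      by (auto intro!: open_Collect_neq continuous_intros)
    then show "openin (top_of_set ?S) (?S \<inter> ?G p)"
      unfolding p by (simp add: openin_open_Int)
    show "?S \<subseteq> closure (?S \<inter> ?G p)"
    proof
      fix Q :: "real^'d^'d" assume "Q \<in> ?S"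
      moreover have "n \<noteq> 0" using p assms(2) by auto
      ultimately show "Q \<in> closure (?S \<inter> ?G p)"
        unfolding closure_approachable p
        by (auto elim!: orthogonal_matrix_perturb_component[of Q n _ k])
    qed
  qed
  moreover have "{Q \<in> ?S. \<forall>p\<in>N \<times> UNIV. Q \<in> ?G p}
      = {Q. orthogonal_matrix Q \<and> (\<forall>n\<in>N. \<forall>k. (Q *v n) $ k \<noteq> 0)}"
    by auto
  ultimately show ?thesis by simp
qed

text \<open>The matrix \<open>hat \<iota> Q\<close> leaves the coordinates outside
  \<open>range \<iota>\<close> alone, so there \<open>differ\<close> settles the matter for every
  \<open>Q\<close>. The remaining coordinates see only the differences of the rotated parts of
  adjacent vertices. These form a finite set \<open>N\<close>, and \<open>differ\<close> keeps zero
  out of it.\<close>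

lemma residual_adjacent_components_distinct:
  fixes \<iota> :: "'d::finite \<Rightarrow> 'r::finite" and S :: "(real^'r) set"
  assumes \<iota>: "inj \<iota>" and fin: "finite (vertices S)"
    and differ: "\<And>a b. adjacent_vertices S a b \<Longrightarrow>
      (\<exists>k. a $ \<iota> k \<noteq> b $ \<iota> k) \<and> (\<forall>i. i \<notin> range \<iota> \<longrightarrow> a $ i \<noteq> b $ i)"
  shows "residual_in {Q :: real^'d^'d. orthogonal_matrix Q}
            {Q. orthogonal_matrix Q \<and> adjacent_components_distinct ((*v) (hat \<iota> Q) ` S)}"
proof -
  let ?r = "\<lambda>z :: real^'r. (\<chi> k. z $ \<iota> k) :: real^'d"
  define N where "N = (\<lambda>(a, b). ?r a - ?r b) ` {(a, b). adjacent_vertices S a b}"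
  have "{(a, b). adjacent_vertices S a b} \<subseteq> vertices S \<times> vertices S"
    by (auto simp: adjacent_vertices_def)
  then have "finite N"
    unfolding N_def using fin by (meson finite_SigmaI finite_imageI finite_subset)
  moreover have "0 \<notin> N"
    using differ by (fastforce simp: N_def vec_eq_iff)
  moreover have "adjacent_components_distinct ((*v) (hat \<iota> Q) ` S) \<longleftrightarrow> (\<forall>n\<in>N. \<forall>k. (Q *v n) $ k \<noteq> 0)"
    if Q: "orthogonal_matrix Q" for Q
  proof -
    have "adjacent_components_distinct ((*v) (hat \<iota> Q) ` S) \<longleftrightarrow>
        (\<forall>a b. adjacent_vertices S a b \<longrightarrow> (\<forall>i. (hat \<iota> Q *v a) $ i \<noteq> (hat \<iota> Q *v b) $ i))"
    proof -
      have "vertices ((*v) (hat \<iota> Q) ` S) \<subseteq> (*v) (hat \<iota> Q) ` S"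
        by (auto simp: vertices_def extreme_point_of_def)
      then have "\<exists>a' b'. a = hat \<iota> Q *v a' \<and> b = hat \<iota> Q *v b'"
        if "adjacent_vertices ((*v) (hat \<iota> Q) ` S) a b" for a b
        using that by (auto simp: adjacent_vertices_def)
      then show ?thesis
        unfolding adjacent_components_distinct_def
        using adjacent_vertices_hat_image[OF \<iota> Q] by (metis (no_types, lifting))
    qed
    also have "\<dots> \<longleftrightarrow> (\<forall>a b. adjacent_vertices S a b \<longrightarrow> (\<forall>k. (Q *v (?r a - ?r b)) $ k \<noteq> 0))"
    proof -
      have "(\<forall>i. (hat \<iota> Q *v a) $ i \<noteq> (hat \<iota> Q *v b) $ i) \<longleftrightarrow> (\<forall>k. (Q *v (?r a - ?r b)) $ k \<noteq> 0)"
        if "adjacent_vertices S a b" for a b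
      proof -
        have "(hat \<iota> Q *v a) $ i \<noteq> (hat \<iota> Q *v b) $ i" if "i \<notin> range \<iota>" for i
          using that differ[OF \<open>adjacent_vertices S a b\<close>] by (simp add: hat_mult_eq_pad \<iota>)
        then have "(\<forall>i. (hat \<iota> Q *v a) $ i \<noteq> (hat \<iota> Q *v b) $ i) \<longleftrightarrow>
            (\<forall>k. (hat \<iota> Q *v a) $ \<iota> k \<noteq> (hat \<iota> Q *v b) $ \<iota> k)"
          by (metis rangeE)
        then show ?thesis
          by (simp add: hat_mult_eq_pad \<iota> matrix_vector_mult_diff_distrib)
      qed
      then show ?thesis by blast
    qed
    also have "\<dots> \<longleftrightarrow> (\<forall>n\<in>N. \<forall>k. (Q *v n) $ k \<noteq> 0)"
      by (auto simp: N_def)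
    finally show ?thesis .
  qed
  ultimately show ?thesis
    using residual_orthogonal_nonzero_components[of N] by (simp cong: conj_cong)
qed

section \<open>Weak derivatives from one-sided difference quotients\<close>

text \<open>The integrand is unbounded, so boundedness is too much to ask. Linear growth covers
  maxima of affine functions, is inherited by projections, and gives both local integrability and
  square integrability against normal weights.\<close>

definition lin_growth :: "(real^'d \<Rightarrow> real) \<Rightarrow> bool" where
  "lin_growth g \<longleftrightarrow> g \<in> borel_measurable borel \<and> (\<exists>B. \<forall>x. \<bar>g x\<bar> \<le> B * (1 + norm x))"

definition diff_quot :: "'d \<Rightarrow> (real^'d \<Rightarrow> real) \<Rightarrow> real^'d \<Rightarrow> nat \<Rightarrow> real" where
  "diff_quot k g x n = (g (x + inverse (real (Suc n)) *\<^sub>R axis k 1) - g x) * real (Suc n)"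

text \<open>The limit is taken along a sequence, so that \<open>g'\<close> is a pointwise limit of
  Borel functions, and at every point, so that no null sets accumulate under iteration. The bound
  \<open>L\<close> serves for dominated convergence; it also makes \<open>g'\<close> bounded and
  hence of linear growth.\<close>

definition forward_partial :: "'d \<Rightarrow> (real^'d \<Rightarrow> real) \<Rightarrow> (real^'d \<Rightarrow> real) \<Rightarrow> bool" where
  "forward_partial k g g' \<longleftrightarrow>
     lin_growth g \<and> (\<exists>L. \<forall>x n. \<bar>diff_quot k g x n\<bar> \<le> L) \<and> (\<forall>x. diff_quot k g x \<longlonglongrightarrow> g' x)"

text \<open>The head of the list is the first derivative taken of \<open>g\<close>, whereas in
  \<open>foldr partial\<close> it is the last one taken of the test function. Integration by parts
  removes both at once, which is why the same list serves on both sides.\<close>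

inductive forward_partials :: "'d list \<Rightarrow> (real^'d \<Rightarrow> real) \<Rightarrow> (real^'d \<Rightarrow> real) \<Rightarrow> bool" where
  Nil: "lin_growth g \<Longrightarrow> forward_partials [] g g"
| Cons: "forward_partial k g g' \<Longrightarrow> forward_partials ks g' h \<Longrightarrow> forward_partials (k # ks) g h"

lemma lin_growth_borel [measurable_dest]: "lin_growth g \<Longrightarrow> g \<in> borel_measurable borel"
  by (simp add: lin_growth_def)

lemma lin_growthE:
  assumes "lin_growth g"
  obtains B where "0 \<le> B" "\<And>x. \<bar>g x\<bar> \<le> B * (1 + norm x)"
proof -
  obtain B where B: "\<And>x. \<bar>g x\<bar> \<le> B * (1 + norm x)"
    using assms by (auto simp: lin_growth_def)
  moreover have "0 \<le> B"
    using B[of 0] by auto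
  ultimately show thesis
    using that by blast
qed

lemma lin_growth_bounded:
  assumes "g \<in> borel_measurable borel" "\<And>x. \<bar>g x\<bar> \<le> B"
  shows "lin_growth g"
proof -
  have "0 \<le> B" using assms(2)[of 0] by simp
  then have "B \<le> B * (1 + norm x)" for x :: "real^'d"
    by (simp add: algebra_simps)
  with assms show ?thesis
    unfolding lin_growth_def by (meson order_trans)
qed

lemma lin_growth_add: "lin_growth f \<Longrightarrow> lin_growth g \<Longrightarrow> lin_growth (\<lambda>x. f x + g x)"
proof -
  assume fg: "lin_growth f" "lin_growth g"
  obtain A B where "\<And>x. \<bar>f x\<bar> \<le> A * (1 + norm x)" "\<And>x. \<bar>g x\<bar> \<le> B * (1 + norm x)"
    using fg by (metis lin_growthE)
  then have "\<bar>f x\<bar> + \<bar>g x\<bar> \<le> (A + B) * (1 + norm x)" for x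
    unfolding distrib_right by (rule add_mono)
  then have "\<bar>f x + g x\<bar> \<le> (A + B) * (1 + norm x)" for x
    using abs_triangle_ineq order_trans by blast
  then show ?thesis
    using fg unfolding lin_growth_def by auto
qed

lemma lin_growth_scale: "lin_growth f \<Longrightarrow> lin_growth (\<lambda>x. c * f x)"
proof -
  assume f: "lin_growth f"
  obtain A where "\<And>x. \<bar>f x\<bar> \<le> A * (1 + norm x)"
    using f by (metis lin_growthE)
  then have "\<bar>c * f x\<bar> \<le> (\<bar>c\<bar> * A) * (1 + norm x)" for x
    by (simp add: abs_mult mult.assoc mult_left_mono)
  then show ?thesis
    using f unfolding lin_growth_def by auto
qed

lemma borel_measurable_diff_quot:
  assumes [measurable]: "g \<in> borel_measurable borel"
  shows "(\<lambda>x. diff_quot k g x n) \<in> borel_measurable borel"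
  unfolding diff_quot_def by measurable

lemma forward_partialD:
  assumes "forward_partial k g g'"
  shows "lin_growth g" "g' \<in> borel_measurable borel" "\<exists>L. \<forall>x. \<bar>g' x\<bar> \<le> L" "lin_growth g'"
proof -
  show g: "lin_growth g"
    using assms by (simp add: forward_partial_def)
  have lim: "diff_quot k g x \<longlonglongrightarrow> g' x" for x
    using assms by (simp add: forward_partial_def)
  obtain L where L: "\<And>x n. \<bar>diff_quot k g x n\<bar> \<le> L"
    using assms by (auto simp: forward_partial_def)
  show 1: "g' \<in> borel_measurable borel"
    using borel_measurable_diff_quot[OF lin_growth_borel[OF g]]
    by (rule borel_measurable_LIMSEQ_real[rotated]) (rule lim)
  have 2: "\<bar>g' x\<bar> \<le> L" for x
    using L by (intro LIMSEQ_le_const2[OF tendsto_rabs[OF lim[of x]]]) auto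
  then show "\<exists>L. \<forall>x. \<bar>g' x\<bar> \<le> L" by blast
  show "lin_growth g'"
    using 1 2 by (rule lin_growth_bounded)
qed

lemma diff_quot_add: "diff_quot k (\<lambda>x. f x + g x) x = (\<lambda>n. diff_quot k f x n + diff_quot k g x n)"
  by (simp add: fun_eq_iff diff_quot_def algebra_simps)

lemma diff_quot_scale: "diff_quot k (\<lambda>x. c * g x) x = (\<lambda>n. c * diff_quot k g x n)"
  by (simp add: fun_eq_iff diff_quot_def algebra_simps)

lemma forward_partial_add:
  assumes "forward_partial k f f'" "forward_partial k g g'"
  shows "forward_partial k (\<lambda>x. f x + g x) (\<lambda>x. f' x + g' x)"
proof -
  obtain A B where "\<And>x n. \<bar>diff_quot k f x n\<bar> \<le> A" "\<And>x n. \<bar>diff_quot k g x n\<bar> \<le> B"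
    using assms unfolding forward_partial_def by blast
  then have "\<bar>diff_quot k (\<lambda>x. f x + g x) x n\<bar> \<le> A + B" for x n
    unfolding diff_quot_add by (intro order_trans[OF abs_triangle_ineq] add_mono)
  then show ?thesis
    using assms unfolding forward_partial_def
    by (auto simp: diff_quot_add intro!: lin_growth_add tendsto_add)
qed

lemma forward_partial_scale:
  assumes "forward_partial k f f'"
  shows "forward_partial k (\<lambda>x. c * f x) (\<lambda>x. c * f' x)"
proof -
  obtain A where "\<And>x n. \<bar>diff_quot k f x n\<bar> \<le> A"
    using assms unfolding forward_partial_def by blast
  then have "\<bar>diff_quot k (\<lambda>x. c * f x) x n\<bar> \<le> \<bar>c\<bar> * A" for x n
    by (simp add: diff_quot_scale abs_mult mult_left_mono)
  then show ?thesis
    using assms unfolding forward_partial_def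
    by (auto simp: diff_quot_scale intro!: lin_growth_scale tendsto_mult)
qed

lemma forward_partials_add:
  assumes "forward_partials ks f f'" "forward_partials ks g g'"
  shows "forward_partials ks (\<lambda>x. f x + g x) (\<lambda>x. f' x + g' x)"
  using assms
proof (induction ks f f' arbitrary: g rule: forward_partials.induct)
  case (Nil f)
  then have "g = g'" "lin_growth g"
    by (auto elim: forward_partials.cases)
  then show ?case
    using Nil by (auto intro: forward_partials.Nil lin_growth_add)
next
  case (Cons k f f1 ks f')
  from Cons.prems obtain g1 where "forward_partial k g g1" "forward_partials ks g1 g'"
    by (auto elim: forward_partials.cases)
  then show ?case
    using Cons by (blast intro: forward_partials.Cons forward_partial_add)
qed

lemma forward_partials_scale:
  "forward_partials ks f f' \<Longrightarrow> forward_partials ks (\<lambda>x. c * f x) (\<lambda>x. c * f' x)"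
  by (induction ks f f' rule: forward_partials.induct)
    (auto intro: forward_partials.intros lin_growth_scale forward_partial_scale)

lemma forward_partial_zero: "forward_partial k (\<lambda>x. 0) (\<lambda>x. 0)"
  by (auto simp: forward_partial_def diff_quot_def[abs_def] intro!: lin_growth_bounded[of _ 0])

lemma forward_partials_zero: "forward_partials ks (\<lambda>x. 0) (\<lambda>x. 0)"
  by (induction ks)
    (auto intro!: forward_partials.intros forward_partial_zero lin_growth_bounded[of _ 0])

lemma forward_partials_sum:
  assumes "finite A" "\<And>a. a \<in> A \<Longrightarrow> \<exists>h. forward_partials ks (F a) h"
  shows "\<exists>h. forward_partials ks (\<lambda>x. \<Sum>a\<in>A. F a x) h"
  using assms
proof (induction A rule: finite_induct)
  case empty
  then show ?case by (auto intro: forward_partials_zero)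
next
  case (insert a A)
  then obtain h1 h2 where "forward_partials ks (F a) h1" "forward_partials ks (\<lambda>x. \<Sum>a\<in>A. F a x) h2"
    by blast
  then show ?case
    using insert(1,2) forward_partials_add by fastforce
qed

lemma forward_partials_lin_growth:
  "forward_partials ks g h \<Longrightarrow> lin_growth g \<and> lin_growth h"
  by (induction rule: forward_partials.induct) (auto dest: forward_partialD)


section \<open>Test functions and integration by parts\<close>

lemma test_function_partial:
  assumes "test_function \<phi>"
  shows "test_function (partial k \<phi>)"
  unfolding test_function_def
proof (intro conjI allI)
  fix ks x
  have "foldr partial (ks @ [k]) \<phi> differentiable (at x)"
    using assms unfolding test_function_def by blast
  then show "foldr partial ks (partial k \<phi>) differentiable (at x)"
    by simp
next
  let ?K = "closure {x. \<phi> x \<noteq> 0}"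
  have "partial k \<phi> x = 0" if "x \<notin> ?K" for x
  proof -
    have "(\<phi> has_derivative (\<lambda>_. 0)) (at x)"
    proof (rule has_derivative_transform_within_open)
      show "((\<lambda>_. 0) has_derivative (\<lambda>_. 0)) (at x)" by simp
      show "open (- ?K)" by (rule open_Compl) (rule closed_closure)
      show "x \<in> - ?K" using that by simp
      show "0 = \<phi> y" if "y \<in> - ?K" for y
        using that closure_subset[of "{x. \<phi> x \<noteq> 0}"] by auto
    qed
    then show ?thesis
      by (simp add: partial_def frechet_derivative_at[symmetric])
  qed
  then have "{x. partial k \<phi> x \<noteq> 0} \<subseteq> ?K" by blast
  then have "closure {x. partial k \<phi> x \<noteq> 0} \<subseteq> ?K"
    by (simp add: closure_minimal)
  then show "compact (closure {x. partial k \<phi> x \<noteq> 0})"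
    using assms compact_Int_closed[OF _ closed_closure, of ?K "{x. partial k \<phi> x \<noteq> 0}"]
    by (simp add: test_function_def inf.absorb2)
qed

lemma test_function_foldr_partial:
  "test_function \<phi> \<Longrightarrow> test_function (foldr partial ks \<phi>)"
  by (induction ks) (auto intro: test_function_partial)

lemma test_function_continuous:
  assumes "test_function \<phi>"
  shows "continuous_on UNIV \<phi>"
proof -
  have "\<phi> differentiable (at x)" for x
    using assms unfolding test_function_def by (metis foldr.simps(1) id_apply)
  then show ?thesis
    by (simp add: continuous_at_imp_continuous_on differentiable_imp_continuous_within)
qed

text \<open>A multiple of the indicator of a ball is a bound that survives small shifts of the
  argument: it suffices to enlarge the radius.\<close>

lemma test_function_bound:
  assumes "test_function \<phi>"
  obtains C R where "0 \<le> C" "0 \<le> R" "\<And>x. \<bar>\<phi> x\<bar> \<le> C * indicator (cball 0 R) x"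
proof -
  let ?K = "closure {x. \<phi> x \<noteq> 0}"
  have K: "compact ?K" using assms by (simp add: test_function_def)
  then obtain R where "0 < R" "\<forall>x\<in>?K. norm x \<le> R"
    using compact_imp_bounded[of ?K] unfolding bounded_pos by blast
  then have R: "0 \<le> R" "?K \<subseteq> cball 0 R"
    by auto
  have "compact (\<phi> ` cball 0 R)"
    using test_function_continuous[OF assms]
    by (intro compact_continuous_image) (auto intro: continuous_on_subset)
  then obtain C where C: "\<And>x. x \<in> cball 0 R \<Longrightarrow> \<bar>\<phi> x\<bar> \<le> C"
    by (metis bounded_iff compact_imp_bounded image_eqI real_norm_def)
  have "\<bar>\<phi> x\<bar> \<le> C * indicator (cball 0 R) x" for x
  proof (cases "x \<in> cball 0 R")
    case False
    then have "\<phi> x = 0"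
      using R(2) closure_subset[of "{x. \<phi> x \<noteq> 0}"] by blast
    then show ?thesis using False by (simp add: indicator_def)
  qed (simp add: C)
  moreover have "0 \<le> C"
    using C[of 0] R(1) by auto
  ultimately show thesis
    using that R(1) by blast
qed

lemma test_function_has_derivative_line:
  assumes "test_function \<phi>"
  shows "((\<lambda>s. \<phi> (x + s *\<^sub>R axis k 1)) has_real_derivative partial k \<phi> (x + s *\<^sub>R axis k 1)) (at s)"
proof -
  have "\<phi> differentiable (at y)" for y
    using assms unfolding test_function_def by (metis foldr.simps(1) id_apply)
  then have der: "(\<phi> has_derivative frechet_derivative \<phi> (at y)) (at y)" for y
    by (simp add: frechet_derivative_works)
  have "((\<lambda>s. \<phi> (x + s *\<^sub>R axis k 1)) has_derivative
      (\<lambda>h. frechet_derivative \<phi> (at (x + s *\<^sub>R axis k 1)) (h *\<^sub>R axis k 1))) (at s)"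
    by (rule has_derivative_compose[where g = \<phi>, OF _ der]) (auto intro!: derivative_eq_intros)
  moreover have "frechet_derivative \<phi> (at y) (h *\<^sub>R axis k 1) = partial k \<phi> y * h" for y h
    using linear_scale[OF has_derivative_linear[OF der[of y]]] by (simp add: partial_def)
  ultimately show ?thesis
    by (simp add: has_field_derivative_def)
qed

lemma integrable_lin_growth_mult:
  fixes \<psi> :: "real^'d \<Rightarrow> real"
  assumes g: "lin_growth g" and [measurable]: "\<psi> \<in> borel_measurable borel"
    and \<psi>: "\<And>x. \<bar>\<psi> x\<bar> \<le> C * indicator (cball 0 R) x"
  shows "integrable lborel (\<lambda>x. g x * \<psi> x)"
proof -
  note [measurable] = lin_growth_borel[OF g]
  obtain B where B: "0 \<le> B" "\<And>x. \<bar>g x\<bar> \<le> B * (1 + norm x)"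
    using lin_growthE[OF g] by blast
  have "integrable lborel (\<lambda>x :: real^'d. B * (1 + R) * C * indicator (cball 0 R) x :: real)"
    by (intro integrable_mult_right integrable_real_indicator)
      (use emeasure_lborel_cball_finite[of "0 :: real^'d" R] in auto)
  then show ?thesis
  proof (rule Bochner_Integration.integrable_bound)
    show "AE x in lborel. norm (g x * \<psi> x) \<le> norm (B * (1 + R) * C * indicator (cball 0 R) x :: real)"
    proof (intro AE_I2)
      fix x :: "real^'d"
      show "norm (g x * \<psi> x) \<le> norm (B * (1 + R) * C * indicator (cball 0 R) x :: real)"
      proof (cases "x \<in> cball 0 R")
        case True
        then have "norm x \<le> R" "\<bar>\<psi> x\<bar> \<le> C"
          using \<psi>[of x] by auto
        moreover have "B * (1 + norm x) \<le> B * (1 + R)"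
          using B(1) \<open>norm x \<le> R\<close> by (simp add: mult_left_mono)
        then have "\<bar>g x\<bar> \<le> B * (1 + R)"
          using B(2)[of x] by linarith
        ultimately have "\<bar>g x * \<psi> x\<bar> \<le> B * (1 + R) * C"
          unfolding abs_mult by (intro mult_mono) auto
        then show ?thesis
          using True by simp
      next
        case False
        then show ?thesis using \<psi>[of x] by simp
      qed
    qed
  qed simp
qed

lemma integral_lborel_translate:
  fixes f :: "real^'d \<Rightarrow> real"
  assumes [measurable]: "f \<in> borel_measurable borel"
  shows "(\<integral>x. f (x + c) \<partial>lborel) = (\<integral>x. f x \<partial>lborel)"
proof -
  have "(\<integral>x. f x \<partial>lborel) = (\<integral>x. f x \<partial>distr lborel borel ((+) c))"
    by (simp add: lborel_distr_plus)
  also have "\<dots> = (\<integral>x. f (c + x) \<partial>lborel)"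
    by (rule integral_distr) auto
  finally show ?thesis by (simp add: add.commute)
qed

lemma integrable_lborel_translate:
  fixes f :: "real^'d \<Rightarrow> real"
  assumes "integrable lborel f"
  shows "integrable lborel (\<lambda>x. f (x + c))"
proof -
  have "integrable (distr lborel borel ((+) c)) f"
    using assms by (simp add: lborel_distr_plus)
  then show ?thesis
    by (subst (asm) integrable_distr_eq) (use assms in \<open>auto simp: add.commute\<close>)
qed

text \<open>Translation invariance moves the difference quotient from \<open>g\<close> to the test function.\<close>

lemma forward_partial_weak:
  fixes g :: "real^'d \<Rightarrow> real"
  assumes g: "forward_partial k g g'" and \<phi>: "test_function \<phi>"
  shows "(\<integral>x. g x * partial k \<phi> x \<partial>lborel) = - (\<integral>x. g' x * \<phi> x \<partial>lborel)"
proof -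
  note lg = forward_partialD(1)[OF g]
  have [measurable]: "g \<in> borel_measurable borel"
    by (rule lin_growth_borel[OF lg])
  have [measurable]: "g' \<in> borel_measurable borel"
    by (rule forward_partialD(2)[OF g])
  have [measurable]: "\<phi> \<in> borel_measurable borel" "partial k \<phi> \<in> borel_measurable borel"
    by (auto intro!: borel_measurable_continuous_onI test_function_continuous \<phi> test_function_partial)
  obtain C R where CR: "0 \<le> C" "0 \<le> R" "\<And>x. \<bar>\<phi> x\<bar> \<le> C * indicator (cball 0 R) x"
    using test_function_bound[OF \<phi>] by blast
  obtain C' R' where CR': "0 \<le> C'" "0 \<le> R'" "\<And>x. \<bar>partial k \<phi> x\<bar> \<le> C' * indicator (cball 0 R') x"
    using test_function_bound[OF test_function_partial[OF \<phi>, of k]] by blast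
  obtain L where L: "\<And>x n. \<bar>diff_quot k g x n\<bar> \<le> L"
    using g by (auto simp: forward_partial_def)
  define t where "t n = inverse (real (Suc n))" for n
  define e :: "real^'d" where "e = axis k 1"
  have t: "0 < t n" "t n \<le> 1" for n
    by (auto simp: t_def field_simps)
  have tn: "real (Suc n) * t n = 1" for n
    by (simp add: t_def del: of_nat_Suc)
  \<comment> \<open>The backward quotient of the test function with reversed sign, which is what the
    translation produces; hence its limit is \<open>- partial k \<phi>\<close>.\<close>
  define q where "q x n = (\<phi> (x - t n *\<^sub>R e) - \<phi> x) * real (Suc n)" for x n
  \<comment> \<open>The mean value theorem gives the constant \<open>C'\<close>. The radius grows by
    1 because the shift \<open>t n\<close> is at most 1, so outside the larger ball both values of
    \<open>\<phi>\<close> vanish.\<close>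
  have q_bound: "\<bar>q x n\<bar> \<le> C' * indicator (cball 0 (max R R' + 1)) x" for x n
  proof (cases "x \<in> cball 0 (max R R' + 1)")
    case True
    have "\<exists>z. - t n < z \<and> z < 0 \<and> \<phi> (x + 0 *\<^sub>R e) - \<phi> (x + (- t n) *\<^sub>R e)
        = (0 - - t n) * partial k \<phi> (x + z *\<^sub>R e)"
      using t[of n] test_function_has_derivative_line[OF \<phi>, of x k] unfolding e_def
      by (intro MVT2) auto
    then obtain z where "\<phi> x - \<phi> (x - t n *\<^sub>R e) = t n * partial k \<phi> (x + z *\<^sub>R e)"
      by auto
    then have "q x n = - partial k \<phi> (x + z *\<^sub>R e)"
      by (simp add: q_def t_def field_simps)
    moreover have "C' * indicator (cball 0 R') y \<le> C'" for y :: "real^'d"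
      using CR'(1) by (simp add: indicator_def)
    then have "\<bar>partial k \<phi> (x + z *\<^sub>R e)\<bar> \<le> C'"
      using CR'(3)[of "x + z *\<^sub>R e"] by (meson order_trans)
    ultimately show ?thesis
      using True by simp
  next
    case False
    then have "norm x > R + 1"
      by auto
    moreover have "norm (t n *\<^sub>R e) \<le> 1"
      using t[of n] by (simp add: e_def norm_axis_1)
    moreover have "norm x \<le> norm (x - t n *\<^sub>R e) + norm (t n *\<^sub>R e)"
      by (metis diff_add_cancel norm_triangle_ineq)
    ultimately have "norm (x - t n *\<^sub>R e) > R" "norm x > R"
      by linarith+
    then have "\<phi> (x - t n *\<^sub>R e) = 0" "\<phi> x = 0"
      using CR(3)[of x] CR(3)[of "x - t n *\<^sub>R e"] by auto
    then show ?thesis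
      using CR'(1) by (simp add: q_def indicator_def)
  qed
  have q_lim: "q x \<longlonglongrightarrow> - partial k \<phi> x" for x
  proof -
    have "((\<lambda>h. (\<phi> (x + (0 + h) *\<^sub>R e) - \<phi> (x + 0 *\<^sub>R e)) / h) \<longlongrightarrow> partial k \<phi> (x + 0 *\<^sub>R e)) (at 0)"
      using test_function_has_derivative_line[OF \<phi>, of x k 0] unfolding e_def DERIV_def by simp
    moreover have "filterlim (\<lambda>n. - t n) (at 0) sequentially"
    proof (rule filterlim_atI)
      show "(\<lambda>n. - t n) \<longlonglongrightarrow> 0"
        unfolding t_def using LIMSEQ_inverse_real_of_nat tendsto_minus by fastforce
      show "\<forall>\<^sub>F n in sequentially. - t n \<noteq> 0"
        using t by (intro always_eventually) (metis less_irrefl neg_equal_0_iff_equal)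
    qed
    ultimately have "(\<lambda>n. (\<phi> (x + (0 + - t n) *\<^sub>R e) - \<phi> (x + 0 *\<^sub>R e)) / (- t n)) \<longlonglongrightarrow> partial k \<phi> (x + 0 *\<^sub>R e)"
      by (rule filterlim_compose)
    then have "(\<lambda>n. - ((\<phi> (x + (0 + - t n) *\<^sub>R e) - \<phi> (x + 0 *\<^sub>R e)) / (- t n))) \<longlonglongrightarrow> - partial k \<phi> (x + 0 *\<^sub>R e)"
      by (rule tendsto_minus)
    moreover have "- ((\<phi> (x + (0 + - t n) *\<^sub>R e) - \<phi> (x + 0 *\<^sub>R e)) / (- t n)) = q x n" for n
      by (simp add: q_def t_def field_simps)
    ultimately show ?thesis by simp
  qed
  have [measurable]: "(\<lambda>x. q x n) \<in> borel_measurable borel" for n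
    unfolding q_def by measurable
  have int_g\<phi>: "integrable lborel (\<lambda>x. g x * \<phi> x)"
    by (rule integrable_lin_growth_mult[OF lg _ CR(3)]) simp
  \<comment> \<open>The shifted test function is \<open>\<phi>\<close> plus \<open>t n\<close> times
    \<open>q\<close>, and \<open>q\<close> already has a bound with bounded support.\<close>
  have int_g\<phi>t: "integrable lborel (\<lambda>x. g x * \<phi> (x - t n *\<^sub>R e))" for n
  proof -
    have "g x * \<phi> (x - t n *\<^sub>R e) = g x * (q x n * t n) + g x * \<phi> x" for x
      by (simp add: q_def mult.assoc tn right_diff_distrib del: of_nat_Suc)
    moreover have "integrable lborel (\<lambda>x. g x * q x n * t n)"
      by (intro integrable_mult_left integrable_lin_growth_mult[OF lg _ q_bound]) simp
    ultimately show ?thesis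
      using int_g\<phi> by (simp add: mult.assoc)
  qed
  have shift: "(\<integral>x. diff_quot k g x n * \<phi> x \<partial>lborel) = (\<integral>x. g x * q x n \<partial>lborel)" for n
  proof -
    have eq: "(\<integral>x. g (x + t n *\<^sub>R e) * \<phi> x \<partial>lborel) = (\<integral>x. g x * \<phi> (x - t n *\<^sub>R e) \<partial>lborel)"
      using integral_lborel_translate[of "\<lambda>x. g x * \<phi> (x - t n *\<^sub>R e)" "t n *\<^sub>R e"] by simp
    have int: "integrable lborel (\<lambda>x. g (x + t n *\<^sub>R e) * \<phi> x)"
      using integrable_lborel_translate[OF int_g\<phi>t[of n], of "t n *\<^sub>R e"] by simp
    have "(\<integral>x. diff_quot k g x n * \<phi> x \<partial>lborel)
        = (\<integral>x. (g (x + t n *\<^sub>R e) * \<phi> x - g x * \<phi> x) * real (Suc n) \<partial>lborel)"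
      by (intro Bochner_Integration.integral_cong) (auto simp: diff_quot_def t_def e_def algebra_simps)
    also have "\<dots> = ((\<integral>x. g (x + t n *\<^sub>R e) * \<phi> x \<partial>lborel) - (\<integral>x. g x * \<phi> x \<partial>lborel)) * real (Suc n)"
      by (simp only: integral_mult_left_zero Bochner_Integration.integral_diff[OF int int_g\<phi>])
    also have "\<dots> = (\<integral>x. (g x * \<phi> (x - t n *\<^sub>R e) - g x * \<phi> x) * real (Suc n) \<partial>lborel)"
      by (simp only: integral_mult_left_zero Bochner_Integration.integral_diff[OF int_g\<phi>t int_g\<phi>] eq)
    also have "\<dots> = (\<integral>x. g x * q x n \<partial>lborel)"
      by (intro Bochner_Integration.integral_cong) (auto simp: q_def algebra_simps)
    finally show ?thesis .
  qed
  have "(\<lambda>n. \<integral>x. diff_quot k g x n * \<phi> x \<partial>lborel) \<longlonglongrightarrow> (\<integral>x. g' x * \<phi> x \<partial>lborel)"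
  proof (rule integral_dominated_convergence[where w = "\<lambda>x. L * \<bar>\<phi> x\<bar>"])
    show "(\<lambda>x. diff_quot k g x n * \<phi> x) \<in> borel_measurable lborel" for n
      unfolding diff_quot_def by measurable
    have "integrable lborel (\<lambda>x. 1 * \<phi> x)"
      by (rule integrable_lin_growth_mult[OF _ _ CR(3)]) (auto intro!: lin_growth_bounded[of _ 1])
    then show "integrable lborel (\<lambda>x. L * \<bar>\<phi> x\<bar>)" by simp
    show "AE x in lborel. (\<lambda>n. diff_quot k g x n * \<phi> x) \<longlonglongrightarrow> g' x * \<phi> x"
      using g by (intro AE_I2 tendsto_mult) (auto simp: forward_partial_def)
    show "AE x in lborel. norm (diff_quot k g x n * \<phi> x) \<le> L * \<bar>\<phi> x\<bar>" for n
      using L by (intro AE_I2) (simp add: abs_mult mult_right_mono)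
  qed simp
  moreover have "(\<lambda>n. \<integral>x. g x * q x n \<partial>lborel) \<longlonglongrightarrow> (\<integral>x. g x * (- partial k \<phi> x) \<partial>lborel)"
  proof (rule integral_dominated_convergence[where w = "\<lambda>x. \<bar>g x * (C' * indicator (cball 0 (max R R' + 1)) x)\<bar>"])
    show "integrable lborel (\<lambda>x. \<bar>g x * (C' * indicator (cball 0 (max R R' + 1)) x)\<bar>)"
      using CR'(1) by (intro integrable_abs integrable_lin_growth_mult[OF lg, where C = C' and R = "max R R' + 1"])
        (auto intro!: borel_measurable_times borel_measurable_indicator)
    show "AE x in lborel. (\<lambda>n. g x * q x n) \<longlonglongrightarrow> g x * (- partial k \<phi> x)"
      by (intro AE_I2 tendsto_mult tendsto_const q_lim)
    show "AE x in lborel. norm (g x * q x n) \<le> \<bar>g x * (C' * indicator (cball 0 (max R R' + 1)) x)\<bar>" for n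
      using q_bound[of _ n] by (intro AE_I2) (simp add: abs_mult mult_left_mono abs_of_nonneg[OF CR'(1)])
  qed simp_all
  ultimately have "(\<integral>x. g' x * \<phi> x \<partial>lborel) = (\<integral>x. g x * (- partial k \<phi> x) \<partial>lborel)"
    unfolding shift by (rule LIMSEQ_unique)
  then show ?thesis by simp
qed

lemma forward_partials_weak:
  assumes "forward_partials ks g h" "test_function \<phi>"
  shows "(\<integral>x. g x * foldr partial ks \<phi> x \<partial>lborel) = (-1) ^ length ks * (\<integral>x. h x * \<phi> x \<partial>lborel)"
  using assms
proof (induction rule: forward_partials.induct)
  case (Cons k g g' ks h)
  then show ?case
    using forward_partial_weak[OF Cons(1) test_function_foldr_partial[of \<phi> ks]] by simp
qed simp

lemma locally_integrable_lin_growth: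
  fixes g :: "real^'d \<Rightarrow> real"
  assumes "lin_growth g"
  shows "locally_integrable g"
  unfolding locally_integrable_def
proof (intro allI impI)
  fix K :: "(real^'d) set" assume K: "compact K"
  then obtain R where "\<forall>x\<in>K. norm x \<le> R"
    using compact_imp_bounded[of K] unfolding bounded_iff by blast
  then have "K \<subseteq> cball 0 R"
    by auto
  then have "\<bar>indicator K x\<bar> \<le> 1 * (indicator (cball 0 R) x :: real)" for x
    by (auto simp: indicator_def)
  moreover have "(indicator K :: _ \<Rightarrow> real) \<in> borel_measurable borel"
    by (rule borel_measurable_indicator) (rule borel_compact[OF K])
  ultimately have "integrable lborel (\<lambda>x. g x * indicator K x)"
    using integrable_lin_growth_mult[OF assms, of "indicator K" 1 R] by simp
  then show "set_integrable lborel K g"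
    by (simp add: set_integrable_def mult.commute)
qed

lemma weak_mixed_partialI:
  assumes "forward_partials (sorted_list_of_set w) g h"
  shows "weak_mixed_partial w g h"
proof -
  have "length (sorted_list_of_set w) = card w"
    by simp
  then show ?thesis
    using forward_partials_lin_growth[OF assms] forward_partials_weak[OF assms]
    by (simp add: weak_mixed_partial_def locally_integrable_lin_growth mixed_partial_def)
qed

section \<open>Square integrability against normal weights\<close>

text \<open>Replaces the growth bound \<open>1 + norm x\<close>, via the sum of the absolute
  coordinates, by a product over the coordinates. Its integral against a product density then
  factors into one-dimensional moments.\<close>

lemma sum_le_prod_one_plus:
  fixes a :: "'i \<Rightarrow> real"
  assumes "\<And>i. i \<in> A \<Longrightarrow> 0 \<le> a i"
  shows "1 + sum a A \<le> (\<Prod>i\<in>A. 1 + a i)"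
  using assms
proof (induction A rule: infinite_finite_induct)
  case (insert i A)
  have "1 + (a i + sum a A) \<le> (1 + a i) * (1 + sum a A)"
    using insert.prems by (simp add: algebra_simps sum_nonneg)
  also have "\<dots> \<le> (1 + a i) * (\<Prod>i\<in>A. 1 + a i)"
    using insert by (intro mult_left_mono) (auto simp: add_nonneg_nonneg)
  finally show ?case
    using insert by simp
qed auto

lemma normal_second_moment_finite:
  assumes "0 < \<sigma>"
  shows "(\<integral>\<^sup>+s. ennreal ((1 + \<bar>s\<bar>)\<^sup>2 * normal_density \<mu> \<sigma> s) \<partial>lborel) < \<infinity>"
proof -
  \<comment> \<open>The moments are centred at \<open>\<mu>\<close>. Since \<open>1 + |s|\<close> is
    at most \<open>(1 + |\<mu>|) + |s - \<mu>|\<close>, its square is at most twice the sum of the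
    two squares.\<close>
  have "integrable lborel (\<lambda>s. normal_density \<mu> \<sigma> s * (2 * (1 + \<bar>\<mu>\<bar>)\<^sup>2) + 2 * (normal_density \<mu> \<sigma> s * (s - \<mu>)^2))"
    using integrable_normal_moment[OF assms, of \<mu> 2] integrable_normal_moment[OF assms, of \<mu> 0]
    by (intro Bochner_Integration.integrable_add integrable_mult_left integrable_mult_right) auto
  then have "integrable lborel (\<lambda>s. (1 + \<bar>s\<bar>)\<^sup>2 * normal_density \<mu> \<sigma> s)"
  proof (rule Bochner_Integration.integrable_bound)
    show "AE s in lborel. norm ((1 + \<bar>s\<bar>)\<^sup>2 * normal_density \<mu> \<sigma> s)
        \<le> norm (normal_density \<mu> \<sigma> s * (2 * (1 + \<bar>\<mu>\<bar>)\<^sup>2) + 2 * (normal_density \<mu> \<sigma> s * (s - \<mu>)^2))"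
    proof (intro AE_I2)
      fix s :: real
      have "(1 + \<bar>s\<bar>)\<^sup>2 \<le> (1 + \<bar>\<mu>\<bar> + \<bar>s - \<mu>\<bar>)\<^sup>2"
        by (intro power_mono) auto
      also have "\<dots> \<le> 2 * (1 + \<bar>\<mu>\<bar>)\<^sup>2 + 2 * (s - \<mu>)\<^sup>2"
        using sum_squares_bound[of "1 + \<bar>\<mu>\<bar>" "\<bar>s - \<mu>\<bar>"] by (simp add: power2_sum)
      finally have "(1 + \<bar>s\<bar>)\<^sup>2 * normal_density \<mu> \<sigma> s
          \<le> (2 * (1 + \<bar>\<mu>\<bar>)\<^sup>2 + 2 * (s - \<mu>)\<^sup>2) * normal_density \<mu> \<sigma> s"
        by (intro mult_right_mono) auto
      then show "norm ((1 + \<bar>s\<bar>)\<^sup>2 * normal_density \<mu> \<sigma> s)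
        \<le> norm (normal_density \<mu> \<sigma> s * (2 * (1 + \<bar>\<mu>\<bar>)\<^sup>2) + 2 * (normal_density \<mu> \<sigma> s * (s - \<mu>)^2))"
        by (simp add: algebra_simps abs_mult)
    qed
  qed simp
  then show ?thesis
    by (simp add: integrable_iff_bounded ennreal_mult'')
qed

lemma norm_le_sum_abs: "norm (x :: real^'d) \<le> (\<Sum>i\<in>UNIV. \<bar>x $ i\<bar>)"
  using norm_le_l1_cart by blast

lemma lin_growth_L2_normal:
  fixes g :: "real^'d \<Rightarrow> real"
  assumes g: "lin_growth g" and \<sigma>: "\<And>i. 0 < \<sigma> i"
  shows "g \<in> L2_weighted (\<lambda>x. \<Prod>i\<in>UNIV. normal_density (\<mu> i) (\<sigma> i) (x $ i))"
proof -
  note [measurable] = lin_growth_borel[OF g]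
  let ?\<rho> = "\<lambda>x :: real^'d. \<Prod>i\<in>UNIV. normal_density (\<mu> i) (\<sigma> i) (x $ i)"
  obtain B where B: "0 \<le> B" "\<And>x. \<bar>g x\<bar> \<le> B * (1 + norm x)"
    using lin_growthE[OF g] by blast
  let ?f = "\<lambda>i s. (1 + \<bar>s\<bar>)\<^sup>2 * normal_density (\<mu> i) (\<sigma> i) s"
  have bound: "\<bar>g x\<bar>\<^sup>2 * ?\<rho> x \<le> B\<^sup>2 * (\<Prod>i\<in>UNIV. ?f i (x $ i))" for x
  proof -
    have "1 + norm x \<le> 1 + (\<Sum>i\<in>UNIV. \<bar>x $ i\<bar>)"
      using norm_le_sum_abs[of x] by simp
    also have "\<dots> \<le> (\<Prod>i\<in>UNIV. 1 + \<bar>x $ i\<bar>)"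
      by (rule sum_le_prod_one_plus) simp
    finally have "B * (1 + norm x) \<le> B * (\<Prod>i\<in>UNIV. 1 + \<bar>x $ i\<bar>)"
      using B(1) by (rule mult_left_mono)
    then have "\<bar>g x\<bar> \<le> B * (\<Prod>i\<in>UNIV. 1 + \<bar>x $ i\<bar>)"
      using B(2)[of x] by linarith
    then have "\<bar>g x\<bar>\<^sup>2 \<le> (B * (\<Prod>i\<in>UNIV. 1 + \<bar>x $ i\<bar>))\<^sup>2"
      by (intro power_mono) auto
    then have "\<bar>g x\<bar>\<^sup>2 * ?\<rho> x \<le> (B * (\<Prod>i\<in>UNIV. 1 + \<bar>x $ i\<bar>))\<^sup>2 * ?\<rho> x"
      by (intro mult_right_mono prod_nonneg) auto
    also have "\<dots> = B\<^sup>2 * (\<Prod>i\<in>UNIV. ?f i (x $ i))"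
      by (simp add: power_mult_distrib prod.distrib prod_power_distrib)
    finally show ?thesis .
  qed
  have Basis: "(Basis :: (real^'d) set) = (\<lambda>i. axis i 1) ` UNIV"
    by (auto simp: Basis_vec_def)
  have inj: "inj (\<lambda>i. axis i (1 :: real) :: real^'d)"
    by (auto simp: inj_on_def axis_eq_axis)
  have "(\<integral>\<^sup>+x. (\<Prod>b\<in>Basis. ennreal (?f (axis_index b) (x \<bullet> b))) \<partial>(lborel :: (real^'d) measure))
      = (\<Prod>b\<in>(Basis :: (real^'d) set). \<integral>\<^sup>+s. ennreal (?f (axis_index b) s) \<partial>lborel)"
    by (rule nn_integral_lborel_prod) auto
  also have "\<dots> < \<infinity>"
  proof -
    have "(\<Prod>b\<in>A. \<integral>\<^sup>+s. ennreal (?f (axis_index b) s) \<partial>lborel) < \<infinity>" for A :: "(real^'d) set"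
      using normal_second_moment_finite[OF \<sigma>]
      by (induction A rule: infinite_finite_induct) (auto simp: ennreal_mult_less_top)
    then show ?thesis .
  qed
  also have "(\<lambda>x :: real^'d. \<Prod>b\<in>Basis. ennreal (?f (axis_index b) (x \<bullet> b))) = (\<lambda>x. ennreal (\<Prod>i\<in>UNIV. ?f i (x $ i)))"
    unfolding Basis by (subst prod.reindex[OF inj]) (simp add: prod_ennreal cart_eq_inner_axis)
  finally have "integrable lborel (\<lambda>x :: real^'d. \<Prod>i\<in>UNIV. ?f i (x $ i))"
    by (auto simp: integrable_iff_bounded abs_prod abs_mult prod_ennreal)
  then have "integrable lborel (\<lambda>x :: real^'d. B\<^sup>2 * (\<Prod>i\<in>UNIV. ?f i (x $ i)))"
    by (rule integrable_mult_right)
  then have "integrable lborel (\<lambda>x. \<bar>g x\<bar>\<^sup>2 * ?\<rho> x)"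
  proof (rule Bochner_Integration.integrable_bound)
    show "AE x in lborel. norm (\<bar>g x\<bar>\<^sup>2 * ?\<rho> x) \<le> norm (B\<^sup>2 * (\<Prod>i\<in>UNIV. ?f i (x $ i)))"
      using bound by (intro AE_I2) (auto simp: abs_mult prod_nonneg abs_of_nonneg intro: order_trans[OF _ abs_ge_self])
  qed simp
  then show ?thesis
    by (simp add: L2_weighted_def)
qed

lemma W2_mix_normalI:
  assumes "\<And>i. 0 < \<sigma> i"
    and "\<And>w. \<exists>h. forward_partials (sorted_list_of_set w) g h"
  shows "g \<in> W2_mix (\<lambda>x. \<Prod>i\<in>UNIV. normal_density (\<mu> i) (\<sigma> i) (x $ i))"
proof -
  have "\<exists>h\<in>L2_weighted (\<lambda>x. \<Prod>i\<in>UNIV. normal_density (\<mu> i) (\<sigma> i) (x $ i)). weak_mixed_partial w g h" for w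
  proof -
    obtain h where h: "forward_partials (sorted_list_of_set w) g h"
      using assms(2) by blast
    show ?thesis
    proof
      show "weak_mixed_partial w g h"
        using h by (rule weak_mixed_partialI)
      show "h \<in> L2_weighted (\<lambda>x. \<Prod>i\<in>UNIV. normal_density (\<mu> i) (\<sigma> i) (x $ i))"
        using forward_partials_lin_growth[OF h] by (intro lin_growth_L2_normal assms(1)) simp
    qed
  qed
  moreover have "lin_growth g"
    using assms(2)[of "{}"] forward_partials_lin_growth by blast
  ultimately show ?thesis
    using lin_growth_L2_normal[of g \<sigma> \<mu>, OF _ assms(1)] by (simp add: W2_mix_def)
qed

section \<open>One-sided derivatives and ANOVA projections\<close>

text \<open>The condition under which a function of linear growth can be integrated along a
  coordinate line.\<close>

definition finite_first_moment :: "(real \<Rightarrow> real) \<Rightarrow> bool" where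
  "finite_first_moment r \<longleftrightarrow> (\<forall>s. 0 \<le> r s) \<and> integrable lborel r \<and> integrable lborel (\<lambda>s. \<bar>s\<bar> * r s)"

definition upd :: "'d \<Rightarrow> real \<Rightarrow> real^'d \<Rightarrow> real^'d" where
  "upd k s x = (\<chi> i. if i = k then s else x $ i)"

lemma anova_proj_upd: "anova_proj \<rho> k f \<eta> = (\<integral>s. f (upd k s \<eta>) * \<rho> k s \<partial>lborel)"
  by (simp add: anova_proj_def upd_def)

lemma upd_eq: "upd k s x = x + (s - x $ k) *\<^sub>R axis k 1"
  by (auto simp: upd_def vec_eq_iff axis_def)

lemma upd_add_axis: "i \<noteq> k \<Longrightarrow> upd k s (x + t *\<^sub>R axis i 1) = upd k s x + t *\<^sub>R axis i 1"
  by (auto simp: upd_def vec_eq_iff axis_def)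

lemma upd_add_axis_same: "upd k s (x + t *\<^sub>R axis k 1) = upd k s x"
  by (auto simp: upd_def vec_eq_iff axis_def)

lemma norm_upd_le: "norm (upd k s x) \<le> 2 * norm x + \<bar>s\<bar>"
proof -
  have "norm (upd k s x) \<le> norm x + \<bar>s - x $ k\<bar>"
    unfolding upd_eq by (rule order_trans[OF norm_triangle_ineq]) (simp add: norm_axis_1)
  also have "\<dots> \<le> norm x + (\<bar>s\<bar> + norm x)"
    using component_le_norm_cart[of x k] by linarith
  finally show ?thesis by simp
qed

lemma measurable_upd [measurable]: "(\<lambda>(x, s). upd k s x) \<in> borel \<Otimes>\<^sub>M borel \<rightarrow>\<^sub>M (borel :: (real^'d) measure)"
  unfolding borel_prod upd_eq split_beta
  by (intro borel_measurable_continuous_onI continuous_intros)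

lemma measurable_upd_section [measurable]: "(\<lambda>s. upd k s x) \<in> borel \<rightarrow>\<^sub>M (borel :: (real^'d) measure)"
  unfolding upd_eq by (intro borel_measurable_continuous_onI continuous_intros)

lemma finite_first_moment_borel: "finite_first_moment r \<Longrightarrow> r \<in> borel_measurable borel"
  by (auto simp: finite_first_moment_def dest: borel_measurable_integrable)

lemma integrable_lin_growth_upd:
  assumes g: "lin_growth g" and r: "finite_first_moment r"
  shows "integrable lborel (\<lambda>s. g (upd k s x) * r s)"
proof -
  note [measurable] = lin_growth_borel[OF g] finite_first_moment_borel[OF r]
  obtain B where B: "0 \<le> B" "\<And>x. \<bar>g x\<bar> \<le> B * (1 + norm x)"
    using lin_growthE[OF g] by blast
  have "integrable lborel (\<lambda>s. B * ((1 + 2 * norm x) * r s + \<bar>s\<bar> * r s))"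
    using r by (intro integrable_mult_right Bochner_Integration.integrable_add)
      (auto simp: finite_first_moment_def)
  then show ?thesis
  proof (rule Bochner_Integration.integrable_bound)
    show "AE s in lborel. norm (g (upd k s x) * r s) \<le> norm (B * ((1 + 2 * norm x) * r s + \<bar>s\<bar> * r s))"
    proof (intro AE_I2)
      fix s
      have r0: "0 \<le> r s" using r by (simp add: finite_first_moment_def)
      have "\<bar>g (upd k s x)\<bar> \<le> B * (1 + (2 * norm x + \<bar>s\<bar>))"
        using B(2)[of "upd k s x"] norm_upd_le[of k s x] B(1)
        by (meson add_left_mono mult_left_mono order_trans)
      then have "\<bar>g (upd k s x)\<bar> * r s \<le> B * (1 + (2 * norm x + \<bar>s\<bar>)) * r s"
        using r0 by (rule mult_right_mono)
      then show "norm (g (upd k s x) * r s) \<le> norm (B * ((1 + 2 * norm x) * r s + \<bar>s\<bar> * r s))"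
        using r0 B(1) by (simp add: abs_mult algebra_simps)
    qed
  qed measurable
qed

lemma lin_growth_anova_proj:
  assumes g: "lin_growth g" and r: "finite_first_moment (\<rho> k)"
  shows "lin_growth (anova_proj \<rho> k g)"
proof -
  note [measurable] = lin_growth_borel[OF g] finite_first_moment_borel[OF r]
  obtain B where B: "0 \<le> B" "\<And>x. \<bar>g x\<bar> \<le> B * (1 + norm x)"
    using lin_growthE[OF g] by blast
  have int: "integrable lborel (\<rho> k)" "integrable lborel (\<lambda>s. \<bar>s\<bar> * \<rho> k s)" and r0: "\<And>s. 0 \<le> \<rho> k s"
    using r by (auto simp: finite_first_moment_def)
  let ?I = "\<integral>s. \<rho> k s \<partial>lborel" and ?J = "\<integral>s. \<bar>s\<bar> * \<rho> k s \<partial>lborel"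
  have IJ: "0 \<le> ?I" "0 \<le> ?J"
    using r0 by (auto intro!: Bochner_Integration.integral_nonneg)
  have "anova_proj \<rho> k g \<in> borel_measurable borel"
    unfolding anova_proj_upd[abs_def] by measurable
  moreover have "\<bar>anova_proj \<rho> k g x\<bar> \<le> (B * (2 * ?I + ?J)) * (1 + norm x)" for x
  proof -
    have "\<bar>anova_proj \<rho> k g x\<bar> \<le> (\<integral>s. \<bar>g (upd k s x) * \<rho> k s\<bar> \<partial>lborel)"
      unfolding anova_proj_upd by (rule integral_abs_bound)
    also have "\<dots> \<le> (\<integral>s. B * ((1 + 2 * norm x) * \<rho> k s + \<bar>s\<bar> * \<rho> k s) \<partial>lborel)"
    proof (rule integral_mono)
      show "integrable lborel (\<lambda>s. \<bar>g (upd k s x) * \<rho> k s\<bar>)"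
        using integrable_lin_growth_upd[OF g r] by (rule integrable_abs)
      show "integrable lborel (\<lambda>s. B * ((1 + 2 * norm x) * \<rho> k s + \<bar>s\<bar> * \<rho> k s))"
        using int by (intro integrable_mult_right Bochner_Integration.integrable_add) auto
      fix s
      have "\<bar>g (upd k s x)\<bar> \<le> B * (1 + (2 * norm x + \<bar>s\<bar>))"
        using B(2)[of "upd k s x"] norm_upd_le[of k s x] B(1)
        by (meson add_left_mono mult_left_mono order_trans)
      then have "\<bar>g (upd k s x)\<bar> * \<rho> k s \<le> B * (1 + (2 * norm x + \<bar>s\<bar>)) * \<rho> k s"
        using r0 by (rule mult_right_mono)
      then show "\<bar>g (upd k s x) * \<rho> k s\<bar> \<le> B * ((1 + 2 * norm x) * \<rho> k s + \<bar>s\<bar> * \<rho> k s)"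
        using r0[of s] by (simp add: abs_mult algebra_simps)
    qed
    also have "\<dots> = B * ((1 + 2 * norm x) * ?I + ?J)"
      using int by simp
    also have "\<dots> \<le> B * ((2 * ?I + ?J) * (1 + norm x))"
    proof (rule mult_left_mono[OF _ B(1)])
      have "0 \<le> ?I + ?J * norm x"
        using IJ by simp
      then show "(1 + 2 * norm x) * ?I + ?J \<le> (2 * ?I + ?J) * (1 + norm x)"
        by (simp add: algebra_simps)
    qed
    finally show ?thesis by (simp add: mult.assoc)
  qed
  ultimately show ?thesis
    unfolding lin_growth_def by blast
qed

text \<open>A shift in direction \<open>i\<close> commutes with overwriting coordinate
  \<open>k\<close>, so difference quotients pass under the integral. There
  \<open>L * \<rho> k\<close> dominates them, and dominated convergence carries the limit
  over.\<close>

lemma forward_partial_anova_proj: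
  assumes g: "forward_partial i g g'" and r: "finite_first_moment (\<rho> k)" and "i \<noteq> k"
  shows "forward_partial i (anova_proj \<rho> k g) (anova_proj \<rho> k g')"
proof -
  have lg: "lin_growth g" and lg': "lin_growth g'"
    using forward_partialD[OF g] by auto
  note [measurable] = lin_growth_borel[OF lg] lin_growth_borel[OF lg'] finite_first_moment_borel[OF r]
  obtain L where L: "\<And>x n. \<bar>diff_quot i g x n\<bar> \<le> L"
    using g by (auto simp: forward_partial_def)
  have r0: "\<And>s. 0 \<le> \<rho> k s" and ir: "integrable lborel (\<rho> k)"
    using r by (auto simp: finite_first_moment_def)
  have dq: "diff_quot i (anova_proj \<rho> k g) x n = (\<integral>s. diff_quot i g (upd k s x) n * \<rho> k s \<partial>lborel)" for x n
  proof -
    define c where "c = real (Suc n)"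
    have "diff_quot i (anova_proj \<rho> k g) x n
        = ((\<integral>s. g (upd k s x + inverse c *\<^sub>R axis i 1) * \<rho> k s \<partial>lborel) - (\<integral>s. g (upd k s x) * \<rho> k s \<partial>lborel)) * c"
      unfolding diff_quot_def anova_proj_upd c_def by (simp only: upd_add_axis[OF \<open>i \<noteq> k\<close>])
    also have "\<dots> = (\<integral>s. (g (upd k s x + inverse c *\<^sub>R axis i 1) * \<rho> k s - g (upd k s x) * \<rho> k s) * c \<partial>lborel)"
    proof -
      have "integrable lborel (\<lambda>s. g (upd k s x + inverse c *\<^sub>R axis i 1) * \<rho> k s)"
        using integrable_lin_growth_upd[OF lg r, of k "x + inverse c *\<^sub>R axis i 1"]
        by (simp only: upd_add_axis[OF \<open>i \<noteq> k\<close>])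
      from Bochner_Integration.integral_diff[OF this integrable_lin_growth_upd[OF lg r, of k x]]
      show ?thesis by (simp only: integral_mult_left_zero)
    qed
    also have "\<dots> = (\<integral>s. diff_quot i g (upd k s x) n * \<rho> k s \<partial>lborel)"
      unfolding diff_quot_def c_def
      by (intro Bochner_Integration.integral_cong) (auto simp: algebra_simps)
    finally show ?thesis .
  qed
  have "\<bar>diff_quot i (anova_proj \<rho> k g) x n\<bar> \<le> (\<integral>s. L * \<rho> k s \<partial>lborel)" for x n
  proof -
    have le: "\<bar>diff_quot i g y n * \<rho> k s\<bar> \<le> L * \<rho> k s" for y s
      using L[of y n] r0[of s] by (simp add: abs_mult mult_right_mono)
    have "\<bar>diff_quot i (anova_proj \<rho> k g) x n\<bar> \<le> (\<integral>s. \<bar>diff_quot i g (upd k s x) n * \<rho> k s\<bar> \<partial>lborel)"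
      unfolding dq by (rule integral_abs_bound)
    also have "\<dots> \<le> (\<integral>s. L * \<rho> k s \<partial>lborel)"
    proof (rule integral_mono)
      show "integrable lborel (\<lambda>s. L * \<rho> k s)"
        using ir by simp
      then show "integrable lborel (\<lambda>s. \<bar>diff_quot i g (upd k s x) n * \<rho> k s\<bar>)"
      proof (rule Bochner_Integration.integrable_bound)
        show "(\<lambda>s. \<bar>diff_quot i g (upd k s x) n * \<rho> k s\<bar>) \<in> borel_measurable lborel"
          unfolding diff_quot_def by measurable
        show "AE s in lborel. norm \<bar>diff_quot i g (upd k s x) n * \<rho> k s\<bar> \<le> norm (L * \<rho> k s)"
          using le by (intro AE_I2) (auto intro: order_trans[OF _ abs_ge_self])
      qed
    qed (rule le)
    finally show ?thesis .
  qed
  moreover have "diff_quot i (anova_proj \<rho> k g) x \<longlonglongrightarrow> anova_proj \<rho> k g' x" for x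
    unfolding dq[abs_def] anova_proj_upd
  proof (rule integral_dominated_convergence[where w = "\<lambda>s. L * \<rho> k s"])
    show "(\<lambda>s. diff_quot i g (upd k s x) n * \<rho> k s) \<in> borel_measurable lborel" for n
      unfolding diff_quot_def by measurable
    show "AE s in lborel. (\<lambda>n. diff_quot i g (upd k s x) n * \<rho> k s) \<longlonglongrightarrow> g' (upd k s x) * \<rho> k s"
      using g by (intro AE_I2 tendsto_mult) (auto simp: forward_partial_def)
    show "AE s in lborel. norm (diff_quot i g (upd k s x) n * \<rho> k s) \<le> L * \<rho> k s" for n
      using L r0 by (intro AE_I2) (simp add: abs_mult mult_right_mono)
  qed (use ir in auto)
  ultimately show ?thesis
    using lin_growth_anova_proj[of g \<rho> k, OF lg r] unfolding forward_partial_def by blast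
qed

text \<open>Independence of coordinate \<open>k\<close> is phrased by translations because
  difference quotients are built from them.\<close>

definition indep :: "'d \<Rightarrow> (real^'d \<Rightarrow> real) \<Rightarrow> bool" where
  "indep k g \<longleftrightarrow> (\<forall>x t. g (x + t *\<^sub>R axis k 1) = g x)"

lemma indep_anova_proj_same: "indep k (anova_proj \<rho> k g)"
  by (simp add: indep_def anova_proj_upd upd_add_axis_same)

lemma indep_anova_proj: "indep i g \<Longrightarrow> indep i (anova_proj \<rho> k g)"
  by (cases "i = k") (simp_all add: indep_anova_proj_same, simp add: indep_def anova_proj_upd upd_add_axis)

lemma forward_partial_indep:
  assumes "lin_growth g" "indep k g"
  shows "forward_partial k g (\<lambda>x. 0)"
proof -
  have "diff_quot k g x n = 0" for x n
    using assms(2) by (simp add: diff_quot_def indep_def)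
  then show ?thesis
    using assms(1) by (auto simp: forward_partial_def intro!: tendsto_eventually)
qed

lemma indep_forward_partial:
  assumes g: "forward_partial i g g'" and "indep k g"
  shows "indep k g'"
  unfolding indep_def
proof (intro allI)
  fix x t
  have "diff_quot i g (x + t *\<^sub>R axis k 1) n = diff_quot i g x n" for n
  proof -
    have eq: "x + t *\<^sub>R axis k 1 + c = (x + c) + t *\<^sub>R axis k 1" for c
      by simp
    have "g (y + t *\<^sub>R axis k 1) = g y" for y
      using assms(2) by (simp add: indep_def)
    then show ?thesis
      unfolding diff_quot_def eq[of "inverse (real (Suc n)) *\<^sub>R axis i 1"] by (simp only:)
  qed
  then have "diff_quot i g (x + t *\<^sub>R axis k 1) = diff_quot i g x"
    by blast
  moreover have "diff_quot i g y \<longlonglongrightarrow> g' y" for y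
    using g by (simp add: forward_partial_def)
  ultimately show "g' (x + t *\<^sub>R axis k 1) = g' x"
    using LIMSEQ_unique[of "diff_quot i g x"] by metis
qed

lemma forward_partials_indep:
  assumes "lin_growth g" "indep k g"
  shows "forward_partials (k # ks) g (\<lambda>x. 0)"
  using forward_partial_indep[OF assms] forward_partials_zero by (rule forward_partials.Cons)

lemma lin_growth_foldr_anova_proj:
  "lin_growth g \<Longrightarrow> (\<And>k. finite_first_moment (\<rho> k)) \<Longrightarrow> lin_growth (foldr (anova_proj \<rho>) ks g)"
  by (induction ks) (auto intro: lin_growth_anova_proj)

lemma forward_partial_foldr_anova_proj:
  "forward_partial i g g' \<Longrightarrow> (\<And>k. finite_first_moment (\<rho> k)) \<Longrightarrow> i \<notin> set ks \<Longrightarrow>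
    forward_partial i (foldr (anova_proj \<rho>) ks g) (foldr (anova_proj \<rho>) ks g')"
  by (induction ks) (auto intro: forward_partial_anova_proj)

lemma indep_foldr_anova_proj:
  "k \<in> set ks \<Longrightarrow> indep k (foldr (anova_proj \<rho>) ks g)"
  by (induction ks) (auto intro: indep_anova_proj indep_anova_proj_same)

text \<open>A projection onto at most two variables that integrates out at least one variable inherits its
  mixed derivative from the innermost projection.\<close>

lemma forward_partials_anova_Proj:
  fixes f :: "real^'d::{finite,linorder} \<Rightarrow> real"
  assumes \<rho>: "\<And>k. finite_first_moment (\<rho> k)"
    and first: "\<And>i. \<exists>f'. forward_partial i f f'"
    and second: "\<And>i j k. i \<noteq> j \<Longrightarrow> i \<noteq> k \<Longrightarrow> j \<noteq> k \<Longrightarrow>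
      \<exists>g' g''. forward_partial i (anova_proj \<rho> k f) g' \<and> forward_partial j g' g''"
    and v: "card v \<le> 2" "card v = 2 \<Longrightarrow> - v \<noteq> {}" and ks: "distinct ks"
  shows "\<exists>h. forward_partials ks (anova_Proj \<rho> (- v) f) h"
proof -
  define l where "l = sorted_list_of_set (- v)"
  define G where "G = foldr (anova_proj \<rho>) l f"
  have setl: "set l = - v"
    by (simp add: l_def)
  have "lin_growth f"
    using first forward_partialD(1) by blast
  then have G: "lin_growth G"
    unfolding G_def using \<rho> by (rule lin_growth_foldr_anova_proj)
  have indepG: "indep k G" if "k \<notin> v" for k
    using that setl unfolding G_def by (intro indep_foldr_anova_proj) auto
  have "\<exists>h. forward_partials ks G h"
  proof (cases ks)
    case Nil
    then show ?thesis using G by (auto intro: forward_partials.Nil)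
  next
    case (Cons k1 ks1)
    show ?thesis
    proof (cases "k1 \<in> v")
      \<comment> \<open>The first direction has been integrated out, so the derivative is zero and
        all later ones are zero too.\<close>
      case False
      then show ?thesis
        using forward_partials_indep[OF G indepG] Cons by blast
    next
      case k1: True
      obtain f' where "forward_partial k1 f f'"
        using first by blast
      then have G': "\<exists>G'. forward_partial k1 G G'"
        using forward_partial_foldr_anova_proj[of k1 f f' \<rho> l] \<rho> k1 setl unfolding G_def by blast
      show ?thesis
      proof (cases ks1)
        case Nil
        then show ?thesis
          using G' Cons by (auto intro: forward_partials.intros dest: forward_partialD(4))
      next
        case Cons2: (Cons k2 ks2)
        show ?thesis
        proof (cases "k2 \<in> v")
          case False
          obtain G' where G': "forward_partial k1 G G'"
            using G' by blast
          have "forward_partials ks1 G' (\<lambda>x. 0)"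
            unfolding Cons2 using forward_partialD(4)[OF G'] indep_forward_partial[OF G' indepG[OF False]]
            by (rule forward_partials_indep)
          with G' show ?thesis
            unfolding Cons by (blast intro: forward_partials.Cons)
        next
          case k2: True
          have "k1 \<noteq> k2" using ks Cons Cons2 by auto
          moreover have "finite v" by simp
          ultimately have v2: "v = {k1, k2}"
            using k1 k2 v(1) by (intro card_seteq[symmetric]) auto
          then have "card v = 2"
            using \<open>k1 \<noteq> k2\<close> by simp
          then have "set l \<noteq> {}"
            using v(2) setl by simp
          then have "l \<noteq> []"
            by auto
          \<comment> \<open>\<open>foldr\<close> applies the last element first. So \<open>k\<close>
            is the innermost projection, the one that \<open>second\<close> speaks about, and the
            projections in \<open>l'\<close> commute with both derivatives.\<close>
          then obtain l' k where l: "l = l' @ [k]"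
            by (metis rev_exhaust)
          then have "k \<notin> v" using setl by auto
          then obtain g' g'' where g: "forward_partial k1 (anova_proj \<rho> k f) g'" "forward_partial k2 g' g''"
            using second[of k1 k2 k] \<open>k1 \<noteq> k2\<close> v2 by auto
          have nl: "k1 \<notin> set l'" "k2 \<notin> set l'"
            using setl l k1 k2 by auto
          let ?F = "foldr (anova_proj \<rho>) l'"
          have Gl: "G = ?F (anova_proj \<rho> k f)"
            by (simp add: G_def l)
          have G1: "forward_partial k1 G (?F g')"
            unfolding Gl using g(1) \<rho> nl(1) by (rule forward_partial_foldr_anova_proj)
          have G2: "forward_partial k2 (?F g') (?F g'')"
            using g(2) \<rho> nl(2) by (rule forward_partial_foldr_anova_proj)
          have "\<exists>h. forward_partials ks2 (?F g'') h"
          proof (cases ks2)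
            case Nil
            then show ?thesis
              using forward_partialD(4)[OF G2] by (auto intro: forward_partials.Nil)
          next
            case (Cons k3 ks3)
            \<comment> \<open>The directions are distinct and \<open>v\<close> is used up, so a
              third direction is one that has been integrated out.\<close>
            then have "k3 \<notin> v"
              using ks \<open>ks = k1 # ks1\<close> Cons2 v2 by auto
            then have "indep k3 (?F g'')"
              using indepG G1 G2 indep_forward_partial by blast
            then show ?thesis
              unfolding Cons using forward_partials_indep[OF forward_partialD(4)[OF G2]] by blast
          qed
          then show ?thesis
            unfolding Cons Cons2 using G1 G2 by (blast intro: forward_partials.Cons)
        qed
      qed
    qed
  qed
  then show ?thesis
    by (simp add: G_def l_def anova_Proj_def)
qed

lemma second_order_anova_W2_mix:
  fixes f :: "real^'d::{finite,linorder} \<Rightarrow> real"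
  assumes \<sigma>: "\<And>i. 0 < \<sigma> i"
    and \<rho>: "\<And>k. finite_first_moment (\<rho> k)"
    and first: "\<And>i. \<exists>f'. forward_partial i f f'"
    and second: "\<And>i j k. i \<noteq> j \<Longrightarrow> i \<noteq> k \<Longrightarrow> j \<noteq> k \<Longrightarrow>
      \<exists>g' g''. forward_partial i (anova_proj \<rho> k f) g' \<and> forward_partial j g' g''"
    and card: "CARD('d) \<noteq> 2"
  shows "second_order_anova \<rho> f \<in> W2_mix (\<lambda>x. \<Prod>i\<in>UNIV. normal_density (\<mu> i) (\<sigma> i) (x $ i))"
proof (rule W2_mix_normalI[OF \<sigma>])
  fix w :: "'d set"
  have "\<exists>h. forward_partials (sorted_list_of_set w)
      (\<lambda>\<eta>. (-1) ^ (card u - card v) * anova_Proj \<rho> (- v) f \<eta>) h"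
    if "v \<subseteq> u" "card u \<le> 2" for u v
  proof -
    have "card v \<le> 2"
      using that card_mono[of u v] by simp
    \<comment> \<open>A two-element \<open>v\<close> without complement would be the whole index
      set, and its projection would be \<open>f\<close> itself.\<close>
    moreover have "- v \<noteq> {}" if "card v = 2"
      using that card by (metis Compl_UNIV_eq double_complement)
    ultimately have "\<exists>h. forward_partials (sorted_list_of_set w) (anova_Proj \<rho> (- v) f) h"
      using \<rho> first second by (intro forward_partials_anova_Proj) auto
    then obtain h where "forward_partials (sorted_list_of_set w) (anova_Proj \<rho> (- v) f) h" ..
    from forward_partials_scale[OF this] show ?thesis
      by blast
  qed
  then show "\<exists>h. forward_partials (sorted_list_of_set w) (second_order_anova \<rho> f) h"
    unfolding second_order_anova_def[abs_def] anova_term_def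
    by (intro forward_partials_sum) auto
qed

section \<open>Lipschitz functions with one-sided derivatives\<close>

text \<open>Right derivatives survive maxima and minima, two-sided ones do not. The Lipschitz bound
  is demanded for all base points and all \<open>t \<ge> 0\<close>, because
  \<open>lip_rdiff_gate\<close> applies it from and to intermediate points of a segment.\<close>

definition lip_rdiff :: "'a::real_normed_vector \<Rightarrow> ('a \<Rightarrow> real) \<Rightarrow> bool" where
  "lip_rdiff e F \<longleftrightarrow> (\<exists>K. \<forall>x t. 0 \<le> t \<longrightarrow> \<bar>F (x + t *\<^sub>R e) - F x\<bar> \<le> K * t) \<and>
     (\<forall>x. \<exists>l. ((\<lambda>t. (F (x + t *\<^sub>R e) - F x) / t) \<longlongrightarrow> l) (at_right 0))"

lemma lip_rdiffI:
  assumes "\<And>x t. 0 \<le> t \<Longrightarrow> \<bar>F (x + t *\<^sub>R e) - F x\<bar> \<le> K * t"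
    and "\<And>x. \<exists>l. ((\<lambda>t. (F (x + t *\<^sub>R e) - F x) / t) \<longlongrightarrow> l) (at_right 0)"
  shows "lip_rdiff e F"
  unfolding lip_rdiff_def
proof
  show "\<exists>K. \<forall>x t. 0 \<le> t \<longrightarrow> \<bar>F (x + t *\<^sub>R e) - F x\<bar> \<le> K * t"
    using assms(1) by (intro exI[of _ K]) simp
  show "\<forall>x. \<exists>l. ((\<lambda>t. (F (x + t *\<^sub>R e) - F x) / t) \<longlongrightarrow> l) (at_right 0)"
    using assms(2) by (rule allI)
qed

lemma lip_rdiff_ex:
  "lip_rdiff e F \<Longrightarrow> \<exists>l. ((\<lambda>t. (F (x + t *\<^sub>R e) - F x) / t) \<longlongrightarrow> l) (at_right 0)"
  by (simp add: lip_rdiff_def)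

lemma lip_rdiff_lip:
  assumes "lip_rdiff e F"
  shows "\<exists>K\<ge>0. \<forall>x t. 0 \<le> t \<longrightarrow> \<bar>F (x + t *\<^sub>R e) - F x\<bar> \<le> K * t"
proof -
  obtain K where K: "\<forall>x t. 0 \<le> t \<longrightarrow> \<bar>F (x + t *\<^sub>R e) - F x\<bar> \<le> K * t"
    using assms by (auto simp: lip_rdiff_def)
  from K[rule_format, of 1 0] have "0 \<le> K"
    by (simp add: order_trans[OF abs_ge_zero])
  with K show ?thesis by blast
qed

lemma lip_tendsto_at_right:
  assumes "\<And>t. 0 \<le> t \<Longrightarrow> \<bar>F (x + t *\<^sub>R e) - F x\<bar> \<le> K * t"
  shows "((\<lambda>t. F (x + t *\<^sub>R e)) \<longlongrightarrow> F x) (at_right 0)"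
proof -
  have "((\<lambda>t. F (x + t *\<^sub>R e) - F x) \<longlongrightarrow> 0) (at_right 0)"
  proof (rule Lim_null_comparison)
    show "\<forall>\<^sub>F t in at_right 0. norm (F (x + t *\<^sub>R e) - F x) \<le> K * t"
      using eventually_at_right_less[of 0] by eventually_elim (use assms in auto)
    show "((\<lambda>t. K * t) \<longlongrightarrow> 0) (at_right 0)"
      by (auto intro!: tendsto_eq_intros)
  qed
  then show ?thesis
    by (rule LIM_zero_cancel)
qed

lemma tendsto_cong_ex:
  assumes "(f \<longlongrightarrow> l) F" "\<forall>\<^sub>F t in F. f t = g t"
  shows "\<exists>l. (g \<longlongrightarrow> l) F"
proof
  show "(g \<longlongrightarrow> l) F"
    using tendsto_cong[OF assms(2), of l] assms(1) by simp
qed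

lemma lip_rdiff_tendsto:
  assumes "lip_rdiff e F"
  shows "((\<lambda>t. F (x + t *\<^sub>R e)) \<longlongrightarrow> F x) (at_right 0)"
proof -
  obtain K where "0 \<le> K" and K: "\<And>x t. 0 \<le> t \<Longrightarrow> \<bar>F (x + t *\<^sub>R e) - F x\<bar> \<le> K * t"
    using lip_rdiff_lip[OF assms] by auto
  from K show ?thesis by (rule lip_tendsto_at_right)
qed

lemma lip_rdiff_const: "lip_rdiff e (\<lambda>x. c)"
  by (rule lip_rdiffI[where K = 0]) (auto intro!: exI[of _ 0])

lemma lip_rdiff_scale:
  assumes "lip_rdiff e F"
  shows "lip_rdiff e (\<lambda>x. c * F x)"
proof -
  obtain K where "0 \<le> K" and K: "\<And>x t. 0 \<le> t \<Longrightarrow> \<bar>F (x + t *\<^sub>R e) - F x\<bar> \<le> K * t"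
    using lip_rdiff_lip[OF assms] by auto
  have "\<bar>c * F (x + t *\<^sub>R e) - c * F x\<bar> \<le> (\<bar>c\<bar> * K) * t" if "0 \<le> t" for x t
    using K[OF that, of x] by (simp add: abs_mult mult_left_mono mult.assoc flip: right_diff_distrib)
  moreover have "\<exists>l. ((\<lambda>t. (c * F (x + t *\<^sub>R e) - c * F x) / t) \<longlongrightarrow> l) (at_right 0)" for x
  proof -
    obtain l where "((\<lambda>t. (F (x + t *\<^sub>R e) - F x) / t) \<longlongrightarrow> l) (at_right 0)"
      using lip_rdiff_ex[OF assms, of x] ..
    then have "((\<lambda>t. c * ((F (x + t *\<^sub>R e) - F x) / t)) \<longlongrightarrow> c * l) (at_right 0)"
      by (rule tendsto_mult_left)
    then show ?thesis by (intro exI) (simp add: right_diff_distrib)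
  qed
  ultimately show ?thesis by (rule lip_rdiffI)
qed

lemma lip_rdiff_add:
  assumes "lip_rdiff e F" "lip_rdiff e G"
  shows "lip_rdiff e (\<lambda>x. F x + G x)"
proof -
  obtain K where "0 \<le> K" and K: "\<And>x t. 0 \<le> t \<Longrightarrow> \<bar>F (x + t *\<^sub>R e) - F x\<bar> \<le> K * t"
    using lip_rdiff_lip[OF assms(1)] by auto
  obtain M where "0 \<le> M" and M: "\<And>x t. 0 \<le> t \<Longrightarrow> \<bar>G (x + t *\<^sub>R e) - G x\<bar> \<le> M * t"
    using lip_rdiff_lip[OF assms(2)] by auto
  have "\<bar>(F (x + t *\<^sub>R e) + G (x + t *\<^sub>R e)) - (F x + G x)\<bar> \<le> (K + M) * t" if "0 \<le> t" for x t
    using K[OF that, of x] M[OF that, of x] unfolding distrib_right by linarith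
  moreover have "\<exists>l. ((\<lambda>t. ((F (x + t *\<^sub>R e) + G (x + t *\<^sub>R e)) - (F x + G x)) / t) \<longlongrightarrow> l) (at_right 0)" for x
  proof -
    obtain l m where "((\<lambda>t. (F (x + t *\<^sub>R e) - F x) / t) \<longlongrightarrow> l) (at_right 0)"
      "((\<lambda>t. (G (x + t *\<^sub>R e) - G x) / t) \<longlongrightarrow> m) (at_right 0)"
      using lip_rdiff_ex[OF assms(1), of x] lip_rdiff_ex[OF assms(2), of x] by (elim exE)
    then have "((\<lambda>t. (F (x + t *\<^sub>R e) - F x) / t + (G (x + t *\<^sub>R e) - G x) / t) \<longlongrightarrow> l + m) (at_right 0)"
      by (rule tendsto_add)
    moreover have "(a - c) / t + (b - d) / t = ((a + b) - (c + d)) / t" for a b c d t :: real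
      by (simp add: add_divide_distrib diff_divide_distrib)
    ultimately show ?thesis by (intro exI) (simp only:)
  qed
  ultimately show ?thesis by (rule lip_rdiffI)
qed

lemma lip_rdiff_diff:
  "lip_rdiff e F \<Longrightarrow> lip_rdiff e G \<Longrightarrow> lip_rdiff e (\<lambda>x. F x - G x)"
  using lip_rdiff_add[OF _ lip_rdiff_scale[of e G "-1"]] by simp

lemma lip_rdiff_sum:
  "(\<And>a. a \<in> A \<Longrightarrow> lip_rdiff e (F a)) \<Longrightarrow> lip_rdiff e (\<lambda>x. \<Sum>a\<in>A. F a x)"
  by (induction A rule: infinite_finite_induct) (auto intro: lip_rdiff_const lip_rdiff_add)

text \<open>Where \<open>F\<close> and \<open>G\<close> differ, right continuity keeps the same one
  on top for small \<open>t\<close>. Where they agree, the quotient of the maximum is the maximum of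
  the two quotients.\<close>

lemma lip_rdiff_max:
  assumes F: "lip_rdiff e F" and G: "lip_rdiff e G"
  shows "lip_rdiff e (\<lambda>x. max (F x) (G x))"
proof -
  obtain K where K: "0 \<le> K" "\<And>x t. 0 \<le> t \<Longrightarrow> \<bar>F (x + t *\<^sub>R e) - F x\<bar> \<le> K * t"
    using lip_rdiff_lip[OF F] by auto
  obtain M where M: "0 \<le> M" "\<And>x t. 0 \<le> t \<Longrightarrow> \<bar>G (x + t *\<^sub>R e) - G x\<bar> \<le> M * t"
    using lip_rdiff_lip[OF G] by auto
  have "\<bar>max (F (x + t *\<^sub>R e)) (G (x + t *\<^sub>R e)) - max (F x) (G x)\<bar> \<le> (K + M) * t" if "0 \<le> t" for x t
  proof -
    have "0 \<le> K * t" "0 \<le> M * t" using K(1) M(1) that by auto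
    then show ?thesis
      using K(2)[OF that, of x] M(2)[OF that, of x] unfolding distrib_right by linarith
  qed
  moreover have "\<exists>l. ((\<lambda>t. (max (F (x + t *\<^sub>R e)) (G (x + t *\<^sub>R e)) - max (F x) (G x)) / t) \<longlongrightarrow> l) (at_right 0)" for x
  proof -
    obtain l where l: "((\<lambda>t. (F (x + t *\<^sub>R e) - F x) / t) \<longlongrightarrow> l) (at_right 0)"
      using lip_rdiff_ex[OF F, of x] ..
    obtain m where m: "((\<lambda>t. (G (x + t *\<^sub>R e) - G x) / t) \<longlongrightarrow> m) (at_right 0)"
      using lip_rdiff_ex[OF G, of x] ..
    have diff: "((\<lambda>t. F (x + t *\<^sub>R e) - G (x + t *\<^sub>R e)) \<longlongrightarrow> F x - G x) (at_right 0)"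
      by (intro tendsto_diff lip_rdiff_tendsto F G)
    consider "F x > G x" | "F x < G x" | "F x = G x" by linarith
    then show ?thesis
    proof cases
      case 1
      then have "\<forall>\<^sub>F t in at_right 0. F (x + t *\<^sub>R e) - G (x + t *\<^sub>R e) > 0"
        by (intro order_tendstoD(1)[OF diff]) simp
      then have "\<forall>\<^sub>F t in at_right 0. (F (x + t *\<^sub>R e) - F x) / t
          = (max (F (x + t *\<^sub>R e)) (G (x + t *\<^sub>R e)) - max (F x) (G x)) / t"
        by eventually_elim (use 1 in auto)
      with l show ?thesis by (rule tendsto_cong_ex)
    next
      case 2
      then have "\<forall>\<^sub>F t in at_right 0. F (x + t *\<^sub>R e) - G (x + t *\<^sub>R e) < 0"
        by (intro order_tendstoD(2)[OF diff]) simp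
      then have "\<forall>\<^sub>F t in at_right 0. (G (x + t *\<^sub>R e) - G x) / t
          = (max (F (x + t *\<^sub>R e)) (G (x + t *\<^sub>R e)) - max (F x) (G x)) / t"
        by eventually_elim (use 2 in auto)
      with m show ?thesis by (rule tendsto_cong_ex)
    next
      case 3
      have "\<forall>\<^sub>F t in at_right 0. max ((F (x + t *\<^sub>R e) - F x) / t) ((G (x + t *\<^sub>R e) - G x) / t)
          = (max (F (x + t *\<^sub>R e)) (G (x + t *\<^sub>R e)) - max (F x) (G x)) / t"
        using eventually_at_right_less[of "0 :: real"]
        by eventually_elim (simp add: 3 max_def divide_le_cancel)
      with tendsto_max[OF l m] show ?thesis by (rule tendsto_cong_ex)
    qed
  qed
  ultimately show ?thesis by (rule lip_rdiffI)
qed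

lemma lip_rdiff_Max:
  assumes "finite A" "A \<noteq> {}" "\<And>a. a \<in> A \<Longrightarrow> lip_rdiff e (F a)"
  shows "lip_rdiff e (\<lambda>x. Max ((\<lambda>a. F a x) ` A))"
  using assms
proof (induction A rule: finite_ne_induct)
  case (insert a A)
  then show ?case
    using lip_rdiff_max[of e "F a" "\<lambda>x. Max ((\<lambda>a. F a x) ` A)"] by simp
qed simp

lemma lip_rdiff_uminus: "lip_rdiff e F \<Longrightarrow> lip_rdiff e (\<lambda>x. - F x)"
  using lip_rdiff_scale[of e F "-1"] by simp

lemma lip_rdiff_min:
  "lip_rdiff e F \<Longrightarrow> lip_rdiff e G \<Longrightarrow> lip_rdiff e (\<lambda>x. min (F x) (G x))"
  using lip_rdiff_uminus[OF lip_rdiff_max[OF lip_rdiff_uminus[of e F] lip_rdiff_uminus[of e G]]]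
  by (simp add: minus_max_eq_min)

lemma lip_rdiff_Min:
  assumes "finite A" "A \<noteq> {}" "\<And>a. a \<in> A \<Longrightarrow> lip_rdiff e (F a)"
  shows "lip_rdiff e (\<lambda>x. Min ((\<lambda>a. F a x) ` A))"
  using assms
proof (induction A rule: finite_ne_induct)
  case (insert a A)
  then show ?case
    using lip_rdiff_min[of e "F a" "\<lambda>x. Min ((\<lambda>a. F a x) ` A)"] by simp
qed simp

text \<open>Intended for the normal distribution function, whose derivative is bounded by the peak
  of the density; with the identity for \<open>\<Phi>\<close> it yields affine functions.\<close>

lemma lip_rdiff_compose_affine:
  fixes a e :: "'a::real_inner"
  assumes der: "\<And>y. (\<Phi> has_real_derivative \<phi> y) (at y)" and bound: "\<And>y. \<bar>\<phi> y\<bar> \<le> C"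
  shows "lip_rdiff e (\<lambda>x. \<Phi> (a \<bullet> x + b))"
proof -
  have line: "a \<bullet> (x + t *\<^sub>R e) + b = (a \<bullet> x + b) + t * (a \<bullet> e)" for x t
    by (simp add: inner_add_right)
  have lip: "\<bar>\<Phi> u - \<Phi> v\<bar> \<le> C * \<bar>u - v\<bar>" for u v
  proof -
    have "norm (\<Phi> u - \<Phi> v) \<le> C * norm (u - v)"
      by (rule field_differentiable_bound[of UNIV \<Phi> \<phi>]) (use der bound in auto)
    then show ?thesis by simp
  qed
  have "\<bar>\<Phi> (a \<bullet> (x + t *\<^sub>R e) + b) - \<Phi> (a \<bullet> x + b)\<bar> \<le> (C * \<bar>a \<bullet> e\<bar>) * t" if "0 \<le> t" for x t
    using lip[of "a \<bullet> (x + t *\<^sub>R e) + b" "a \<bullet> x + b"] that unfolding line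
    by (simp add: abs_mult mult.commute mult.left_commute)
  moreover have "\<exists>l. ((\<lambda>t. (\<Phi> (a \<bullet> (x + t *\<^sub>R e) + b) - \<Phi> (a \<bullet> x + b)) / t) \<longlongrightarrow> l) (at_right 0)" for x
  proof -
    have "((\<lambda>t. \<Phi> ((a \<bullet> x + b) + t * (a \<bullet> e))) has_real_derivative \<phi> (a \<bullet> x + b + 0 * (a \<bullet> e)) * (a \<bullet> e)) (at 0)"
      by (rule DERIV_chain2[OF der]) (auto intro!: derivative_eq_intros)
    then have "((\<lambda>t. (\<Phi> ((a \<bullet> x + b) + t * (a \<bullet> e)) - \<Phi> (a \<bullet> x + b)) / t) \<longlongrightarrow> \<phi> (a \<bullet> x + b) * (a \<bullet> e)) (at 0)"
      by (simp add: has_field_derivative_iff)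
    then show ?thesis
      unfolding line filterlim_at_split by blast
  qed
  ultimately show ?thesis by (rule lip_rdiffI)
qed

lemma lip_rdiff_affine:
  fixes a e :: "'a::real_inner"
  shows "lip_rdiff e (\<lambda>x. a \<bullet> x + b)"
  by (rule lip_rdiff_compose_affine[where \<Phi> = "\<lambda>y. y" and \<phi> = "\<lambda>_. 1" and C = 1])
    (auto intro!: derivative_eq_intros)

lemma filterlim_inverse_Suc_at_right:
  "filterlim (\<lambda>n. inverse (real (Suc n))) (at_right 0) sequentially"
  using LIMSEQ_inverse_real_of_nat
  by (rule tendsto_imp_filterlim_at_right) (auto intro!: always_eventually)

lemma lip_rdiff_forward_partial:
  fixes F :: "real^'d \<Rightarrow> real"
  assumes F: "lip_rdiff (axis k 1) F" and "lin_growth F"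
  shows "\<exists>F'. forward_partial k F F'"
proof -
  obtain K where K: "0 \<le> K" "\<And>x t. 0 \<le> t \<Longrightarrow> \<bar>F (x + t *\<^sub>R axis k 1) - F x\<bar> \<le> K * t"
    using lip_rdiff_lip[OF F] by auto
  have dq: "diff_quot k F x n = (F (x + inverse (real (Suc n)) *\<^sub>R axis k 1) - F x) / inverse (real (Suc n))" for x n
    by (simp add: diff_quot_def divide_inverse)
  have "\<bar>diff_quot k F x n\<bar> \<le> K" for x n
    using K(2)[of "inverse (real (Suc n))" x] unfolding dq
    by (simp add: abs_divide abs_mult divide_simps del: of_nat_Suc)
  moreover have "\<exists>l. diff_quot k F x \<longlonglongrightarrow> l" for x
  proof -
    obtain l where "((\<lambda>t. (F (x + t *\<^sub>R axis k 1) - F x) / t) \<longlongrightarrow> l) (at_right 0)"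
      using lip_rdiff_ex[OF F, of x] ..
    from filterlim_compose[OF this filterlim_inverse_Suc_at_right]
    show ?thesis unfolding dq[abs_def] by blast
  qed
  then obtain F' where "\<And>x. diff_quot k F x \<longlonglongrightarrow> F' x" by metis
  ultimately show ?thesis
    using assms(2) unfolding forward_partial_def by blast
qed

text \<open>Switching \<open>\<theta>\<close> off outside a polyhedron on whose boundary it vanishes creates no jump.\<close>

lemma lip_rdiff_gate:
  fixes e :: "'a::real_inner"
  assumes \<theta>: "lip_rdiff e \<theta>" and "finite E"
    and vanish: "\<And>x w. (\<And>w'. w' \<in> E \<Longrightarrow> 0 \<le> c w' \<bullet> x + d w') \<Longrightarrow> w \<in> E \<Longrightarrow> c w \<bullet> x + d w = 0 \<Longrightarrow> \<theta> x = 0"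
  shows "lip_rdiff e (\<lambda>x. if \<forall>w\<in>E. 0 < c w \<bullet> x + d w then \<theta> x else 0)"
proof (cases "E = {}")
  case True
  then show ?thesis using \<theta> by simp
next
  case False
  let ?p = "\<lambda>x. \<forall>w\<in>E. 0 < c w \<bullet> x + d w"
  let ?g = "\<lambda>x. if ?p x then \<theta> x else 0"
  \<comment> \<open>The gate is open exactly where this one continuous function is positive. A
    segment along which the gate changes thus contains a zero of \<open>m\<close>, and there
    \<open>vanish\<close> makes \<open>\<theta>\<close> zero.\<close>
  define m where "m x = Min ((\<lambda>w. c w \<bullet> x + d w) ` E)" for x
  have m_pos: "?p x \<longleftrightarrow> 0 < m x" for x
    using \<open>finite E\<close> False by (simp add: m_def)
  have m0: "\<theta> x = 0" if "m x = 0" for x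
  proof -
    have "0 \<le> c w \<bullet> x + d w" if "w \<in> E" for w
      using \<open>finite E\<close> that \<open>m x = 0\<close> Min_le[of "(\<lambda>w. c w \<bullet> x + d w) ` E" "c w \<bullet> x + d w"]
      by (auto simp: m_def)
    moreover obtain w where "w \<in> E" "m x = c w \<bullet> x + d w"
      using Min_in[of "(\<lambda>w. c w \<bullet> x + d w) ` E"] \<open>finite E\<close> False unfolding m_def by blast
    ultimately show ?thesis
      using vanish[of x w] that by auto
  qed
  have m_cont: "continuous_on UNIV (\<lambda>t. m (x + t *\<^sub>R e))" for x
    unfolding m_def using \<open>finite E\<close> False
  proof (induction E rule: finite_ne_induct)
    case (insert w E)
    then show ?case by (auto intro!: continuous_intros)
  qed (auto intro!: continuous_intros)
  obtain K where K: "0 \<le> K" "\<And>x t. 0 \<le> t \<Longrightarrow> \<bar>\<theta> (x + t *\<^sub>R e) - \<theta> x\<bar> \<le> K * t"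
    using lip_rdiff_lip[OF \<theta>] by auto
  have zero_between: "\<exists>s. 0 \<le> s \<and> s \<le> t \<and> \<theta> (x + s *\<^sub>R e) = 0"
    if "0 \<le> t" "?p x \<noteq> ?p (x + t *\<^sub>R e)" for x t
  proof -
    have "\<exists>s. 0 \<le> s \<and> s \<le> t \<and> m (x + s *\<^sub>R e) = 0"
    proof (cases "0 < m x")
      case True
      then have "m (x + t *\<^sub>R e) \<le> 0" using that(2) unfolding m_pos by simp
      then show ?thesis
        using True that(1) IVT2'[of "\<lambda>s. m (x + s *\<^sub>R e)" t 0 0] continuous_on_subset[OF m_cont[of x]]
        by auto
    next
      case False
      then have "0 < m (x + t *\<^sub>R e)" using that(2) unfolding m_pos by simp
      then show ?thesis
        using False that(1) IVT'[of "\<lambda>s. m (x + s *\<^sub>R e)" 0 0 t] continuous_on_subset[OF m_cont[of x]]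
        by auto
    qed
    then show ?thesis using m0 by blast
  qed
  \<comment> \<open>If the gate changes, \<open>\<theta>\<close> vanishes somewhere on the segment,
    so at both ends it is at most \<open>K * t\<close> in absolute value. One of the two gated
    values is zero, and the constant is kept.\<close>
  have lip: "\<bar>?g (x + t *\<^sub>R e) - ?g x\<bar> \<le> K * t" if t: "0 \<le> t" for x t
  proof (cases "?p x = ?p (x + t *\<^sub>R e)")
    case True
    then show ?thesis using K that by auto
  next
    case False
    then obtain s where s: "0 \<le> s" "s \<le> t" "\<theta> (x + s *\<^sub>R e) = 0"
      using zero_between[OF t, of x] by blast
    have "\<bar>\<theta> x\<bar> \<le> K * t"
      using K(2)[OF s(1), of x] s K(1) mult_left_mono[OF s(2) K(1)] by simp
    moreover have "\<bar>\<theta> (x + t *\<^sub>R e)\<bar> \<le> K * t"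
    proof -
      have eq: "x + t *\<^sub>R e = (x + s *\<^sub>R e) + (t - s) *\<^sub>R e"
        by (simp add: scaleR_diff_left)
      have "\<bar>\<theta> (x + t *\<^sub>R e)\<bar> \<le> K * (t - s)"
        using K(2)[of "t - s" "x + s *\<^sub>R e"] s unfolding eq by simp
      also have "\<dots> \<le> K * t"
        using s K(1) by (intro mult_left_mono) auto
      finally show ?thesis .
    qed
    ultimately show ?thesis using False by auto
  qed
  have "\<exists>l. ((\<lambda>t. (?g (x + t *\<^sub>R e) - ?g x) / t) \<longlongrightarrow> l) (at_right 0)" for x
  proof -
    have g_lim: "((\<lambda>t. ?g (x + t *\<^sub>R e)) \<longlongrightarrow> ?g x) (at_right 0)"
      by (rule lip_tendsto_at_right[where F = ?g, OF lip])
    have \<theta>_lim: "((\<lambda>t. \<theta> (x + t *\<^sub>R e)) \<longlongrightarrow> \<theta> x) (at_right 0)"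
      by (rule lip_rdiff_tendsto[OF \<theta>])
    \<comment> \<open>An affine function has constant sign just after the start of a ray. Hence the
      gate is either open or closed for all small \<open>t > 0\<close>.\<close>
    have sign: "(\<forall>\<^sub>F t in at_right 0. 0 < c w \<bullet> (x + t *\<^sub>R e) + d w) \<or>
        (\<forall>\<^sub>F t in at_right 0. \<not> 0 < c w \<bullet> (x + t *\<^sub>R e) + d w)" for w
    proof -
      have eq: "c w \<bullet> (x + t *\<^sub>R e) + d w = (c w \<bullet> x + d w) + t * (c w \<bullet> e)" for t
        by (simp add: inner_add_right)
      have lim: "((\<lambda>t. (c w \<bullet> x + d w) + t * (c w \<bullet> e)) \<longlongrightarrow> c w \<bullet> x + d w) (at_right 0)"
        by (auto intro!: tendsto_eq_intros)
      consider "0 < c w \<bullet> x + d w" | "c w \<bullet> x + d w < 0" | "c w \<bullet> x + d w = 0" by linarith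
      then show ?thesis
      proof cases
        case 1
        then show ?thesis unfolding eq using order_tendstoD(1)[OF lim] by blast
      next
        case 2
        then have "\<forall>\<^sub>F t in at_right 0. (c w \<bullet> x + d w) + t * (c w \<bullet> e) < 0"
          using order_tendstoD(2)[OF lim] by blast
        then have "\<forall>\<^sub>F t in at_right 0. \<not> 0 < (c w \<bullet> x + d w) + t * (c w \<bullet> e)"
          by (rule eventually_mono) simp
        then show ?thesis unfolding eq by blast
      next
        case 3
        have pos: "\<forall>\<^sub>F t in at_right (0::real). 0 < t"
          by (rule eventually_at_right_less)
        show ?thesis
        proof (cases "0 < c w \<bullet> e")
          case True
          have "\<forall>\<^sub>F t in at_right 0. 0 < (c w \<bullet> x + d w) + t * (c w \<bullet> e)"
            using pos by eventually_elim (simp add: 3 True)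
          then show ?thesis unfolding eq by blast
        next
          case False
          have "\<forall>\<^sub>F t in at_right 0. \<not> 0 < (c w \<bullet> x + d w) + t * (c w \<bullet> e)"
            using pos by eventually_elim (use False in \<open>simp add: 3 zero_less_mult_iff\<close>)
          then show ?thesis unfolding eq by blast
        qed
      qed
    qed
    show ?thesis
    proof (cases "\<forall>w\<in>E. \<forall>\<^sub>F t in at_right 0. 0 < c w \<bullet> (x + t *\<^sub>R e) + d w")
      case True
      then have ev: "\<forall>\<^sub>F t in at_right 0. ?p (x + t *\<^sub>R e)"
        using \<open>finite E\<close> by (intro eventually_ball_finite) auto
      then have "\<forall>\<^sub>F t in at_right 0. ?g (x + t *\<^sub>R e) = \<theta> (x + t *\<^sub>R e)"
        by eventually_elim simp
      \<comment> \<open>The gate may be closed at \<open>x\<close> and open immediately afterwards.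
        Right continuity of the gated function then shows that its value at \<open>x\<close> is
        still \<open>\<theta> x\<close>.\<close>
      from tendsto_cong[THEN iffD1, OF this g_lim]
      have "((\<lambda>t. \<theta> (x + t *\<^sub>R e)) \<longlongrightarrow> ?g x) (at_right 0)" .
      then have gx: "?g x = \<theta> x"
        using \<theta>_lim by (intro tendsto_unique[of "at_right (0::real)"]) auto
      have "\<forall>\<^sub>F t in at_right 0. (\<theta> (x + t *\<^sub>R e) - \<theta> x) / t = (?g (x + t *\<^sub>R e) - ?g x) / t"
        using ev by eventually_elim (subst gx, simp)
      moreover obtain l where "((\<lambda>t. (\<theta> (x + t *\<^sub>R e) - \<theta> x) / t) \<longlongrightarrow> l) (at_right 0)"
        using lip_rdiff_ex[OF \<theta>, of x] ..
      ultimately show ?thesis by (intro tendsto_cong_ex)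
    next
      case False
      then obtain w where "w \<in> E" "\<forall>\<^sub>F t in at_right 0. \<not> 0 < c w \<bullet> (x + t *\<^sub>R e) + d w"
        using sign by blast
      then have ev: "\<forall>\<^sub>F t in at_right 0. ?g (x + t *\<^sub>R e) = 0"
        by (auto elim!: eventually_mono)
      from tendsto_cong[THEN iffD1, OF this g_lim]
      have "((\<lambda>t. 0) \<longlongrightarrow> ?g x) (at_right (0::real))" .
      then have gx: "?g x = 0"
        by (intro tendsto_unique[of "at_right (0::real)", OF _ _ tendsto_const]) auto
      have "\<forall>\<^sub>F t in at_right 0. (?g (x + t *\<^sub>R e) - ?g x) / t = 0"
        using ev by eventually_elim (subst gx, simp)
      then show ?thesis by (blast intro: tendsto_eventually)
    qed
  qed
  with lip show ?thesis by (rule lip_rdiffI)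
qed

section \<open>Maxima of affine functions under Gaussian projections\<close>

definition max_affine :: "'v set \<Rightarrow> ('v \<Rightarrow> real^'d) \<Rightarrow> ('v \<Rightarrow> real) \<Rightarrow> real^'d \<Rightarrow> real" where
  "max_affine V A \<beta> \<eta> = Max ((\<lambda>v. A v \<bullet> \<eta> + \<beta> v) ` V)"

definition active :: "'v set \<Rightarrow> ('v \<Rightarrow> real^'d) \<Rightarrow> ('v \<Rightarrow> real) \<Rightarrow> real^'d \<Rightarrow> 'v set" where
  "active V A \<beta> \<eta> = {v \<in> V. \<forall>w\<in>V. A w \<bullet> \<eta> + \<beta> w \<le> A v \<bullet> \<eta> + \<beta> v}"

lemma active_nonempty:
  assumes "finite V" "V \<noteq> {}"
  shows "active V A \<beta> \<eta> \<noteq> {}"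
proof -
  obtain v where "v \<in> V" "Max ((\<lambda>v. A v \<bullet> \<eta> + \<beta> v) ` V) = A v \<bullet> \<eta> + \<beta> v"
    using Max_in[of "(\<lambda>v. A v \<bullet> \<eta> + \<beta> v) ` V"] assms by blast
  moreover have "A w \<bullet> \<eta> + \<beta> w \<le> Max ((\<lambda>v. A v \<bullet> \<eta> + \<beta> v) ` V)" if "w \<in> V" for w
    using assms(1) that by simp
  ultimately show ?thesis
    unfolding active_def by fastforce
qed

lemma active_eq_singleton_iff:
  assumes "v \<in> V"
  shows "active V A \<beta> \<eta> = {v} \<longleftrightarrow> (\<forall>w\<in>V - {v}. A w \<bullet> \<eta> + \<beta> w < A v \<bullet> \<eta> + \<beta> v)" (is "?l = ?r")
proof
  assume l: ?l
  show ?r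
  proof
    fix w assume w: "w \<in> V - {v}"
    have v: "A u \<bullet> \<eta> + \<beta> u \<le> A v \<bullet> \<eta> + \<beta> v" if "u \<in> V" for u
      using l that by (auto simp: active_def)
    have "w \<notin> active V A \<beta> \<eta>"
      using l w by simp
    then obtain u where "u \<in> V" "A w \<bullet> \<eta> + \<beta> w < A u \<bullet> \<eta> + \<beta> u"
      using w by (auto simp: active_def not_le)
    with v[of u] show "A w \<bullet> \<eta> + \<beta> w < A v \<bullet> \<eta> + \<beta> v" by simp
  qed
next
  assume r: ?r
  show ?l
  proof
    show "{v} \<subseteq> active V A \<beta> \<eta>"
    proof -
      have "A w \<bullet> \<eta> + \<beta> w \<le> A v \<bullet> \<eta> + \<beta> v" if "w \<in> V" for w
        using r that by (cases "w = v") (auto intro: less_imp_le)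
      then show ?thesis
        using assms by (simp add: active_def)
    qed
    show "active V A \<beta> \<eta> \<subseteq> {v}"
    proof
      fix w assume "w \<in> active V A \<beta> \<eta>"
      then have "w \<in> V" "A v \<bullet> \<eta> + \<beta> v \<le> A w \<bullet> \<eta> + \<beta> w"
        using assms by (auto simp: active_def)
      then have "\<not> A w \<bullet> \<eta> + \<beta> w < A v \<bullet> \<eta> + \<beta> v" by simp
      then show "w \<in> {v}" using r \<open>w \<in> V\<close> by blast
    qed
  qed
qed

lemma lin_growth_max_affine:
  assumes "finite V" "V \<noteq> {}"
  shows "lin_growth (max_affine V A \<beta>)"
  unfolding lin_growth_def
proof (intro conjI exI allI)
  show "max_affine V A \<beta> \<in> borel_measurable borel"
    unfolding max_affine_def[abs_def] using assms(1)
    by (intro borel_measurable_Max) (auto intro!: borel_measurable_continuous_onI continuous_intros)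
  fix x
  define B where "B = (\<Sum>v\<in>V. norm (A v) + \<bar>\<beta> v\<bar>)"
  obtain v where v: "v \<in> V" "max_affine V A \<beta> x = A v \<bullet> x + \<beta> v"
    using Max_in[of "(\<lambda>v. A v \<bullet> x + \<beta> v) ` V"] assms unfolding max_affine_def by blast
  have "\<bar>A v \<bullet> x + \<beta> v\<bar> \<le> norm (A v) * norm x + \<bar>\<beta> v\<bar>"
    using Cauchy_Schwarz_ineq2[of "A v" x] by linarith
  also have "\<dots> \<le> (norm (A v) + \<bar>\<beta> v\<bar>) * (1 + norm x)"
    by (simp add: algebra_simps)
  also have "\<dots> \<le> B * (1 + norm x)"
    unfolding B_def using v(1) assms(1)
    by (intro mult_right_mono member_le_sum) auto
  finally show "\<bar>max_affine V A \<beta> x\<bar> \<le> (\<Sum>v\<in>V. norm (A v) + \<bar>\<beta> v\<bar>) * (1 + norm x)"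
    unfolding v(2) B_def .
qed

text \<open>Near a point with a unique maximiser the function is affine, which fixes the derivative
  there. Elsewhere its value is left open: under the later hypothesis \<open>kink\<close>, the other
  points of a line in direction \<open>k\<close> are finite in number and are lost in the
  projection.\<close>

lemma max_affine_forward_partial:
  assumes "finite V" "V \<noteq> {}"
  obtains f' where "forward_partial i (max_affine V A \<beta>) f'"
    and "\<And>v \<eta>. v \<in> V \<Longrightarrow> active V A \<beta> \<eta> = {v} \<Longrightarrow> f' \<eta> = A v $ i"
proof -
  have "lip_rdiff (axis i 1) (max_affine V A \<beta>)"
    unfolding max_affine_def[abs_def] using assms by (intro lip_rdiff_Max lip_rdiff_affine)
  then obtain f' where f': "forward_partial i (max_affine V A \<beta>) f'"
    using lip_rdiff_forward_partial lin_growth_max_affine[OF assms] by blast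
  have "f' \<eta> = A v $ i" if v: "v \<in> V" "active V A \<beta> \<eta> = {v}" for v \<eta>
  proof -
    have lt: "A w \<bullet> \<eta> + \<beta> w < A v \<bullet> \<eta> + \<beta> v" if "w \<in> V - {v}" for w
      using active_eq_singleton_iff[OF v(1)] v(2) that by blast
    have "\<forall>\<^sub>F t in at_right 0. \<forall>w\<in>V - {v}.
        A w \<bullet> (\<eta> + t *\<^sub>R axis i 1) + \<beta> w < A v \<bullet> (\<eta> + t *\<^sub>R axis i 1) + \<beta> v"
    proof (intro eventually_ball_finite ballI)
      fix w assume "w \<in> V - {v}"
      have "((\<lambda>t. A v \<bullet> (\<eta> + t *\<^sub>R axis i 1) + \<beta> v - (A w \<bullet> (\<eta> + t *\<^sub>R axis i 1) + \<beta> w))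
          \<longlongrightarrow> A v \<bullet> (\<eta> + 0 *\<^sub>R axis i 1) + \<beta> v - (A w \<bullet> (\<eta> + 0 *\<^sub>R axis i 1) + \<beta> w)) (at_right 0)"
        by (intro tendsto_intros)
      from order_tendstoD(1)[OF this, of 0] lt[OF \<open>w \<in> V - {v}\<close>]
      show "\<forall>\<^sub>F t in at_right 0. A w \<bullet> (\<eta> + t *\<^sub>R axis i 1) + \<beta> w < A v \<bullet> (\<eta> + t *\<^sub>R axis i 1) + \<beta> v"
        by simp
    qed (use assms in auto)
    from filterlim_inverse_Suc_at_right[unfolded filterlim_iff, rule_format, OF this]
    have ev: "\<forall>\<^sub>F n in sequentially. \<forall>w\<in>V - {v}.
        A w \<bullet> (\<eta> + inverse (real (Suc n)) *\<^sub>R axis i 1) + \<beta> w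
        < A v \<bullet> (\<eta> + inverse (real (Suc n)) *\<^sub>R axis i 1) + \<beta> v" .
    have val: "max_affine V A \<beta> y = A v \<bullet> y + \<beta> v"
      if "\<forall>w\<in>V - {v}. A w \<bullet> y + \<beta> w < A v \<bullet> y + \<beta> v" for y
      unfolding max_affine_def
    proof (rule Max_eqI)
      fix z assume "z \<in> (\<lambda>v. A v \<bullet> y + \<beta> v) ` V"
      then obtain w where "w \<in> V" "z = A w \<bullet> y + \<beta> w" by blast
      then show "z \<le> A v \<bullet> y + \<beta> v"
        using that by (cases "w = v") (auto intro: less_imp_le)
    qed (use assms v in auto)
    have val\<eta>: "max_affine V A \<beta> \<eta> = A v \<bullet> \<eta> + \<beta> v"
      by (rule val) (use lt in blast)
    have "\<forall>\<^sub>F n in sequentially. diff_quot i (max_affine V A \<beta>) \<eta> n = A v $ i"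
      using ev
    proof eventually_elim
      case (elim n)
      have "diff_quot i (max_affine V A \<beta>) \<eta> n
          = inverse (real (Suc n)) * (A v \<bullet> axis i 1) * real (Suc n)"
        unfolding diff_quot_def val[OF elim] val\<eta> by (simp add: inner_add_right)
      then show ?case
        by (simp add: inner_axis del: of_nat_Suc)
    qed
    then have "diff_quot i (max_affine V A \<beta>) \<eta> \<longlonglongrightarrow> A v $ i"
      by (rule tendsto_eventually)
    moreover have "diff_quot i (max_affine V A \<beta>) \<eta> \<longlonglongrightarrow> f' \<eta>"
      using f' by (simp add: forward_partial_def)
    ultimately show ?thesis
      by (rule LIMSEQ_unique[symmetric])
  qed
  with f' show thesis by (rule that)
qed

section \<open>Normal probabilities of intervals with moving endpoints\<close>

lemma downset_subset_or:
  fixes S T :: "real set"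
  assumes "\<And>s t. s \<in> S \<Longrightarrow> t \<le> s \<Longrightarrow> t \<in> S" "\<And>s t. s \<in> T \<Longrightarrow> t \<le> s \<Longrightarrow> t \<in> T"
  shows "S \<subseteq> T \<or> T \<subseteq> S"
proof (rule ccontr)
  assume "\<not> (S \<subseteq> T \<or> T \<subseteq> S)"
  then obtain s t where "s \<in> S" "s \<notin> T" "t \<in> T" "t \<notin> S" by blast
  then show False
    using assms(1)[of s t] assms(2)[of t s] linear[of s t] by blast
qed

text \<open>Initial segments of the line are nested, so intersections and unions are attained by one
  of the two sets. This turns probabilities into minima and maxima of distribution functions, which
  \<open>lip_rdiff\<close> can handle.\<close>

lemma measure_downsets:
  fixes S T :: "real set"
  assumes N: "finite_measure N"
    and "S \<in> sets N" "T \<in> sets N"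
    and "\<And>s t. s \<in> S \<Longrightarrow> t \<le> s \<Longrightarrow> t \<in> S" "\<And>s t. s \<in> T \<Longrightarrow> t \<le> s \<Longrightarrow> t \<in> T"
  shows "measure N (S \<inter> T) = min (measure N S) (measure N T)"
    "measure N (S \<union> T) = max (measure N S) (measure N T)"
proof -
  have "S \<subseteq> T \<or> T \<subseteq> S"
    using assms(4,5) by (rule downset_subset_or)
  then consider "S \<subseteq> T" | "T \<subseteq> S" by blast
  then have "measure N (S \<inter> T) = min (measure N S) (measure N T) \<and>
      measure N (S \<union> T) = max (measure N S) (measure N T)"
  proof cases
    case 1
    then have "measure N S \<le> measure N T"
      using finite_measure.finite_measure_mono[OF N] assms(3) by blast
    with 1 show ?thesis by (simp add: Int_absorb2 Un_absorb1)
  next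
    case 2
    then have "measure N T \<le> measure N S"
      using finite_measure.finite_measure_mono[OF N] assms(2) by blast
    with 2 show ?thesis by (simp add: Int_absorb1 Un_absorb2)
  qed
  then show "measure N (S \<inter> T) = min (measure N S) (measure N T)"
    "measure N (S \<union> T) = max (measure N S) (measure N T)" by auto
qed

text \<open>The set is a difference of two initial segments: the points below all upper bounds,
  minus the points not above some lower bound. Nestedness makes its measure the positive part of a
  difference. The inserted 1 and 0 are the measures for empty \<open>U\<close> and empty
  \<open>P\<close>; otherwise they change nothing, since \<open>\<Phi>\<close> takes values between
  0 and 1.\<close>

lemma measure_between_finite:
  fixes N :: "real measure" and lo :: "'v \<Rightarrow> real"
  assumes N: "prob_space N" and sets: "sets N = sets borel"
    and \<Phi>: "\<And>x. measure N {..<x} = \<Phi> x" "\<And>x. measure N {..x} = \<Phi> x"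
    and fin: "finite P" "finite U"
  shows "measure N {s. (\<forall>w\<in>P. lo w < s) \<and> (\<forall>w\<in>U. s < up w)}
    = max 0 (Min (insert 1 ((\<lambda>w. \<Phi> (up w)) ` U)) - Max (insert 0 ((\<lambda>w. \<Phi> (lo w)) ` P)))"
proof -
  interpret N: prob_space N by fact
  have space: "space N = UNIV"
    using sets_eq_imp_space_eq[OF sets] by simp
  define A where "A U = {s. \<forall>w\<in>U. s < up w}" for U
  define B where "B P = {s. \<exists>w\<in>P. s \<le> lo w}" for P
  have A: "A U \<in> sets N \<and> measure N (A U) = Min (insert 1 ((\<lambda>w. \<Phi> (up w)) ` U))" if "finite U" for U
    using that
  proof (induction U rule: finite_induct)
    case empty
    then show ?case
      using N.prob_space space sets by (simp add: A_def)
  next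
    case (insert w U)
    have eq: "A (insert w U) = {..<up w} \<inter> A U"
      by (auto simp: A_def)
    have "measure N ({..<up w} \<inter> A U) = min (measure N {..<up w}) (measure N (A U))"
      by (rule measure_downsets[OF N.finite_measure_axioms]) (use insert sets in \<open>auto simp: A_def intro: order.strict_trans1\<close>)
    moreover have "Min (insert 1 ((\<lambda>w. \<Phi> (up w)) ` insert w U))
        = min (\<Phi> (up w)) (Min (insert 1 ((\<lambda>w. \<Phi> (up w)) ` U)))"
      using insert(1) by (subst Min_insert[symmetric]) (auto simp: insert_commute)
    ultimately show ?case
      using insert sets by (simp add: eq \<Phi> sets.Int)
  qed
  have B: "B P \<in> sets N \<and> measure N (B P) = Max (insert 0 ((\<lambda>w. \<Phi> (lo w)) ` P))" if "finite P" for P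
    using that
  proof (induction P rule: finite_induct)
    case empty
    then show ?case by (simp add: B_def)
  next
    case (insert w P)
    have eq: "B (insert w P) = {..lo w} \<union> B P"
      by (auto simp: B_def)
    have "measure N ({..lo w} \<union> B P) = max (measure N {..lo w}) (measure N (B P))"
      by (rule measure_downsets[OF N.finite_measure_axioms]) (use insert sets in \<open>auto simp: B_def intro: order.trans\<close>)
    moreover have "Max (insert 0 ((\<lambda>w. \<Phi> (lo w)) ` insert w P))
        = max (\<Phi> (lo w)) (Max (insert 0 ((\<lambda>w. \<Phi> (lo w)) ` P)))"
      using insert(1) by (subst Max_insert[symmetric]) (auto simp: insert_commute)
    ultimately show ?case
      using insert sets by (simp add: eq \<Phi> sets.Un)
  qed
  have J: "{s. (\<forall>w\<in>P. lo w < s) \<and> (\<forall>w\<in>U. s < up w)} = A U - B P"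
    by (auto simp: A_def B_def not_le)
  have "B P \<subseteq> A U \<or> A U \<subseteq> B P"
    by (rule downset_subset_or) (auto simp: A_def B_def intro: order.strict_trans1 order.trans)
  then have "measure N (A U - B P) = max 0 (measure N (A U) - measure N (B P))"
  proof
    assume BA: "B P \<subseteq> A U"
    then have "measure N (B P) \<le> measure N (A U)"
      using A[OF fin(2)] N.finite_measure_mono by blast
    then show ?thesis
      using BA A[OF fin(2)] B[OF fin(1)] by (simp add: N.finite_measure_Diff)
  next
    assume AB: "A U \<subseteq> B P"
    then have "measure N (A U) \<le> measure N (B P)" and empty: "A U - B P = {}"
      using B[OF fin(1)] N.finite_measure_mono by blast+
    then show ?thesis
      unfolding empty by simp
  qed
  then show ?thesis
    using A[OF fin(2)] B[OF fin(1)] J by simp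
qed

lemma normal_cdf:
  fixes \<mu> \<sigma> :: real
  assumes "0 < \<sigma>"
  defines "N \<equiv> density lborel (\<lambda>x. ennreal (normal_density \<mu> \<sigma> x))"
  shows "measure N {..x} = measure N {..<x}"
    and "((\<lambda>x. measure N {..<x}) has_real_derivative normal_density \<mu> \<sigma> x) (at x)"
proof -
  interpret N: prob_space N
    unfolding N_def using assms(1) by (rule prob_space_normal_density)
  have sets: "sets N = sets borel"
    by (simp add: N_def)
  have meas: "measure N S = (\<integral>s. indicator S s * normal_density \<mu> \<sigma> s \<partial>lborel)" if "S \<in> sets borel" for S
  proof -
    have "measure N S = (\<integral>s. indicator S s \<partial>N)"
      using that sets by (simp add: sets_eq_imp_space_eq[OF sets])
    also have "\<dots> = (\<integral>s. normal_density \<mu> \<sigma> s *\<^sub>R indicator S s \<partial>lborel)"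
      unfolding N_def using that by (intro integral_density) auto
    finally show ?thesis by (simp add: mult.commute)
  qed
  have point: "measure N {y} = 0" for y
  proof -
    have "(\<integral>s. indicator {y} s * normal_density \<mu> \<sigma> s \<partial>lborel) = 0"
      using AE_lborel_singleton[of y] by (intro integral_eq_zero_AE) (auto elim: eventually_mono)
    then show ?thesis by (simp add: meas)
  qed
  have atMost: "measure N {..y} = measure N {..<y}" for y
  proof -
    have "{..y} = {..<y} \<union> {y}" by auto
    moreover have "measure N ({..<y} \<union> {y}) = measure N {..<y} + measure N {y}"
      by (rule N.finite_measure_Union) (auto simp: sets)
    ultimately show ?thesis using point by simp
  qed
  then show "measure N {..x} = measure N {..<x}" .
  \<comment> \<open>Any point to the left of \<open>x\<close> would do: the mass below
    \<open>a\<close> is constant, and the rest is an integral over a bounded interval, to which the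
    fundamental theorem of calculus applies.\<close>
  define a where "a = x - 1"
  have cont: "continuous_on S (normal_density \<mu> \<sigma>)" for S
    unfolding normal_density_def using assms(1) by (intro continuous_intros) auto
  have step: "measure N {..<y} = measure N {..<a} + integral {a..y} (normal_density \<mu> \<sigma>)" if "a \<le> y" for y
  proof -
    have "{..y} = {..<a} \<union> {a..y}" using that by auto
    moreover have "measure N ({..<a} \<union> {a..y}) = measure N {..<a} + measure N {a..y}"
      by (rule N.finite_measure_Union) (auto simp: sets)
    moreover have "measure N {a..y} = integral {a..y} (normal_density \<mu> \<sigma>)"
    proof -
      have "set_integrable lborel {a..y} (normal_density \<mu> \<sigma>)"
        unfolding set_integrable_def
        using integrable_mult_indicator[OF _ integrable_normal_density[OF assms(1)], of "{a..y}"] by simp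
      from set_borel_integral_eq_integral(2)[OF this]
      show ?thesis by (simp add: meas set_lebesgue_integral_def)
    qed
    ultimately show ?thesis
      using atMost[of y] by simp
  qed
  have "((\<lambda>y. integral {a..y} (normal_density \<mu> \<sigma>)) has_real_derivative normal_density \<mu> \<sigma> x) (at x within {a..x+1})"
    using cont by (intro integral_has_real_derivative) (auto simp: a_def)
  then have "((\<lambda>y. integral {a..y} (normal_density \<mu> \<sigma>)) has_real_derivative normal_density \<mu> \<sigma> x) (at x)"
    by (subst (asm) at_within_interior) (auto simp: a_def)
  then have "((\<lambda>y. measure N {..<a} + integral {a..y} (normal_density \<mu> \<sigma>)) has_real_derivative normal_density \<mu> \<sigma> x) (at x)"
    by (auto intro!: derivative_eq_intros)
  moreover have "\<forall>\<^sub>F y in nhds x. measure N {..<a} + integral {a..y} (normal_density \<mu> \<sigma>) = measure N {..<y}"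
  proof -
    have "\<forall>\<^sub>F y in nhds x. y \<in> {a<..}"
      by (rule eventually_nhds_in_open) (auto simp: a_def)
    then show ?thesis
      by eventually_elim (rule step[symmetric], simp)
  qed
  ultimately show "((\<lambda>x. measure N {..<x}) has_real_derivative normal_density \<mu> \<sigma> x) (at x)"
    by (subst (asm) DERIV_cong_ev[OF refl _ refl]) auto
qed

lemma normal_density_bounded: "\<bar>normal_density \<mu> \<sigma> x\<bar> \<le> 1 / sqrt (2 * pi * \<sigma>\<^sup>2)"
proof -
  have "exp (- (x - \<mu>)\<^sup>2 / (2 * \<sigma>\<^sup>2)) \<le> 1" by simp
  then have "1 / sqrt (2 * pi * \<sigma>\<^sup>2) * exp (- (x - \<mu>)\<^sup>2 / (2 * \<sigma>\<^sup>2)) \<le> 1 / sqrt (2 * pi * \<sigma>\<^sup>2) * 1"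
    by (intro mult_left_mono) auto
  then show ?thesis
    by (simp add: normal_density_def abs_mult)
qed

lemma finite_first_moment_normal:
  assumes "0 < \<sigma>"
  shows "finite_first_moment (normal_density \<mu> \<sigma>)"
proof -
  have "integrable lborel (\<lambda>s. (normal_density \<mu> \<sigma> s * s))"
    using assms by (rule integrable_normal_moment_nz_1)
  then have "integrable lborel (\<lambda>s. \<bar>normal_density \<mu> \<sigma> s * s\<bar>)"
    by (rule integrable_abs)
  then show ?thesis
    using assms by (simp add: finite_first_moment_def abs_mult mult.commute)
qed

text \<open>Where a piece \<open>v\<close> meets a piece with the same slope in direction \<open>k\<close>, it is not maximal on any
  interval of the line in direction \<open>k\<close>; the hypothesis \<open>kink\<close> forbids the alternative.\<close>

lemma lip_rdiff_argmax_measure: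
  fixes A :: "'v \<Rightarrow> real^'d" and e :: "real^'d" and \<mu> \<sigma> :: real
  assumes fin: "finite V" and v: "v \<in> V" and \<sigma>: "0 < \<sigma>"
    and kink: "\<And>\<eta> v w. v \<in> active V A \<beta> \<eta> \<Longrightarrow> w \<in> active V A \<beta> \<eta> \<Longrightarrow> v \<noteq> w \<Longrightarrow>
      \<exists>v'\<in>active V A \<beta> \<eta>. \<exists>w'\<in>active V A \<beta> \<eta>. A v' $ k \<noteq> A w' $ k"
  defines "N \<equiv> density lborel (\<lambda>x. ennreal (normal_density \<mu> \<sigma> x))"
  shows "lip_rdiff e (\<lambda>\<eta>. measure N {s. active V A \<beta> (upd k s \<eta>) = {v}})"
    and "{s. active V A \<beta> (upd k s \<eta>) = {v}} \<in> sets borel"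
proof -
  \<comment> \<open>Removing component \<open>k\<close> of the slope splits each piece into a part
    \<open>\<gamma>\<close> that depends only on the other coordinates and a linear function of the
    integrated variable \<open>s\<close>.\<close>
  define a where "a w = A w - (A w $ k) *\<^sub>R axis k 1" for w
  define \<gamma> where "\<gamma> w \<eta> = a w \<bullet> \<eta> + \<beta> w" for w \<eta>
  have slice: "A w \<bullet> upd k s \<eta> + \<beta> w = \<gamma> w \<eta> + A w $ k * s" for w s \<eta>
    by (simp add: upd_eq \<gamma>_def a_def inner_add_right inner_diff_left inner_axis' inner_axis algebra_simps)
  \<comment> \<open>The competitors of \<open>v\<close>, sorted by slope in direction
    \<open>k\<close>: smaller slopes bound \<open>s\<close> from below, larger ones bound it from
    above, and equal ones restrict \<open>\<eta>\<close> alone.\<close>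
  define E where "E = {w \<in> V - {v}. A w $ k = A v $ k}"
  define P where "P = {w \<in> V. A w $ k < A v $ k}"
  define U where "U = {w \<in> V. A v $ k < A w $ k}"
  have finE: "finite E" "finite P" "finite U"
    using fin by (auto simp: E_def P_def U_def)
  \<comment> \<open>\<open>ca w \<bullet> \<eta> + cb w\<close> is the value of \<open>s\<close> at
    which the pieces \<open>w\<close> and \<open>v\<close> cross. It is affine in
    \<open>\<eta>\<close>, so the distribution function composed with it falls under
    \<open>lip_rdiff_compose_affine\<close>.\<close>
  define ca where "ca w = (1 / (A v $ k - A w $ k)) *\<^sub>R (a w - a v)" for w
  define cb where "cb w = (\<beta> w - \<beta> v) / (A v $ k - A w $ k)" for w
  have c_eq: "ca w \<bullet> \<eta> + cb w = (\<gamma> w \<eta> - \<gamma> v \<eta>) / (A v $ k - A w $ k)" for w \<eta>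
    by (simp add: ca_def cb_def \<gamma>_def inner_diff_left diff_divide_distrib add_divide_distrib)
  have char: "active V A \<beta> (upd k s \<eta>) = {v} \<longleftrightarrow>
      (\<forall>w\<in>E. 0 < (a v - a w) \<bullet> \<eta> + (\<beta> v - \<beta> w)) \<and>
      (\<forall>w\<in>P. ca w \<bullet> \<eta> + cb w < s) \<and> (\<forall>w\<in>U. s < ca w \<bullet> \<eta> + cb w)" for s \<eta>
  proof -
    have E': "\<gamma> w \<eta> + A w $ k * s < \<gamma> v \<eta> + A v $ k * s \<longleftrightarrow> 0 < (a v - a w) \<bullet> \<eta> + (\<beta> v - \<beta> w)"
      if "w \<in> E" for w
      using that by (auto simp: E_def \<gamma>_def inner_diff_left)
    have P': "\<gamma> w \<eta> + A w $ k * s < \<gamma> v \<eta> + A v $ k * s \<longleftrightarrow> ca w \<bullet> \<eta> + cb w < s"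
      if "w \<in> P" for w
      using that unfolding c_eq by (auto simp: P_def pos_divide_less_eq algebra_simps)
    have U': "\<gamma> w \<eta> + A w $ k * s < \<gamma> v \<eta> + A v $ k * s \<longleftrightarrow> s < ca w \<bullet> \<eta> + cb w"
      if "w \<in> U" for w
      using that unfolding c_eq by (auto simp: U_def neg_less_divide_eq algebra_simps)
    have "V - {v} = E \<union> P \<union> U"
      by (auto simp: E_def P_def U_def)
    then have "active V A \<beta> (upd k s \<eta>) = {v} \<longleftrightarrow>
        (\<forall>w\<in>E \<union> P \<union> U. \<gamma> w \<eta> + A w $ k * s < \<gamma> v \<eta> + A v $ k * s)"
      unfolding active_eq_singleton_iff[OF v] slice by simp
    also have "\<dots> \<longleftrightarrow> (\<forall>w\<in>E. 0 < (a v - a w) \<bullet> \<eta> + (\<beta> v - \<beta> w)) \<and>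
      (\<forall>w\<in>P. ca w \<bullet> \<eta> + cb w < s) \<and> (\<forall>w\<in>U. s < ca w \<bullet> \<eta> + cb w)"
      unfolding ball_Un using E' P' U' by auto
    finally show ?thesis .
  qed
  define J where "J \<eta> = {s. (\<forall>w\<in>P. ca w \<bullet> \<eta> + cb w < s) \<and> (\<forall>w\<in>U. s < ca w \<bullet> \<eta> + cb w)}" for \<eta>
  define p where "p \<eta> \<longleftrightarrow> (\<forall>w\<in>E. 0 < (a v - a w) \<bullet> \<eta> + (\<beta> v - \<beta> w))" for \<eta>
  have set_eq: "{s. active V A \<beta> (upd k s \<eta>) = {v}} = (if p \<eta> then J \<eta> else {})" for \<eta>
    unfolding char J_def p_def by auto
  have J_sets: "J \<eta> \<in> sets borel" for \<eta>
  proof -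
    have "J \<eta> = (\<Inter>w\<in>P. {ca w \<bullet> \<eta> + cb w<..}) \<inter> (\<Inter>w\<in>U. {..<ca w \<bullet> \<eta> + cb w})"
      by (auto simp: J_def)
    also have "open \<dots>"
      using finE by (intro open_Int open_INT) auto
    finally show ?thesis by simp
  qed
  then show "{s. active V A \<beta> (upd k s \<eta>) = {v}} \<in> sets borel"
    by (simp add: set_eq)
  define \<Phi> where "\<Phi> x = measure N {..<x}" for x
  \<comment> \<open>The probability of the interval \<open>J\<close> alone. The condition from
    \<open>E\<close> does not involve \<open>s\<close> and enters afterwards as the gate.\<close>
  define \<theta> where "\<theta> \<eta> = max 0 (Min (insert 1 ((\<lambda>w. \<Phi> (ca w \<bullet> \<eta> + cb w)) ` U))
      - Max (insert 0 ((\<lambda>w. \<Phi> (ca w \<bullet> \<eta> + cb w)) ` P)))" for \<eta>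
  have \<theta>_J: "measure N (J \<eta>) = \<theta> \<eta>" for \<eta>
    unfolding J_def \<theta>_def
  proof (rule measure_between_finite)
    show "prob_space N"
      unfolding N_def using \<sigma> by (rule prob_space_normal_density)
    show "measure N {..x} = \<Phi> x" for x
      unfolding \<Phi>_def N_def using \<sigma> by (rule normal_cdf)
  qed (use finE in \<open>auto simp: N_def \<Phi>_def\<close>)
  have lip_\<Phi>: "lip_rdiff e (\<lambda>\<eta>. \<Phi> (ca w \<bullet> \<eta> + cb w))" for w
    unfolding \<Phi>_def N_def using normal_cdf(2)[OF \<sigma>] normal_density_bounded
    by (rule lip_rdiff_compose_affine)
  have lip_min: "lip_rdiff e (\<lambda>\<eta>. Min (insert 1 ((\<lambda>w. \<Phi> (ca w \<bullet> \<eta> + cb w)) ` U)))"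
  proof (cases "U = {}")
    case False
    then have "Min (insert 1 ((\<lambda>w. \<Phi> (ca w \<bullet> \<eta> + cb w)) ` U)) = min 1 (Min ((\<lambda>w. \<Phi> (ca w \<bullet> \<eta> + cb w)) ` U))" for \<eta>
      using finE by simp
    then show ?thesis
      using finE False by (simp only:) (intro lip_rdiff_min lip_rdiff_const lip_rdiff_Min lip_\<Phi>)
  qed (simp add: lip_rdiff_const)
  have lip_max: "lip_rdiff e (\<lambda>\<eta>. Max (insert 0 ((\<lambda>w. \<Phi> (ca w \<bullet> \<eta> + cb w)) ` P)))"
  proof (cases "P = {}")
    case False
    then have "Max (insert 0 ((\<lambda>w. \<Phi> (ca w \<bullet> \<eta> + cb w)) ` P)) = max 0 (Max ((\<lambda>w. \<Phi> (ca w \<bullet> \<eta> + cb w)) ` P))" for \<eta>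
      using finE by simp
    then show ?thesis
      using finE False by (simp only:) (intro lip_rdiff_max lip_rdiff_const lip_rdiff_Max lip_\<Phi>)
  qed (simp add: lip_rdiff_const)
  have lip_\<theta>: "lip_rdiff e \<theta>"
    unfolding \<theta>_def[abs_def] by (intro lip_rdiff_max lip_rdiff_const lip_rdiff_diff lip_min lip_max)
  have "lip_rdiff e (\<lambda>\<eta>. if \<forall>w\<in>E. 0 < (a v - a w) \<bullet> \<eta> + (\<beta> v - \<beta> w) then \<theta> \<eta> else 0)"
  proof (rule lip_rdiff_gate[OF lip_\<theta> finE(1)])
    fix \<eta> w
    assume ge: "\<And>w'. w' \<in> E \<Longrightarrow> 0 \<le> (a v - a w') \<bullet> \<eta> + (\<beta> v - \<beta> w')"
      and w: "w \<in> E" and eq: "(a v - a w) \<bullet> \<eta> + (\<beta> v - \<beta> w) = 0"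
    \<comment> \<open>At a point \<open>s\<close> of \<open>J\<close>, the pieces in
      \<open>P\<close> and \<open>U\<close> lie strictly below \<open>v\<close>, while
      \<open>w\<close> ties with it. All maximisers then share the slope of \<open>v\<close> in
      direction \<open>k\<close>, against \<open>kink\<close>. So at the boundary of the gate the
      interval is empty and its probability zero.\<close>
    have "J \<eta> = {}"
    proof (rule ccontr)
      assume "J \<eta> \<noteq> {}"
      then obtain s where s: "s \<in> J \<eta>" by blast
      let ?act = "active V A \<beta> (upd k s \<eta>)"
      have lt: "\<gamma> u \<eta> + A u $ k * s < \<gamma> v \<eta> + A v $ k * s" if "u \<in> P \<union> U" for u
        using that
      proof
        assume "u \<in> P"
        then have "(\<gamma> u \<eta> - \<gamma> v \<eta>) / (A v $ k - A u $ k) < s" "A u $ k < A v $ k"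
          using s by (auto simp: J_def P_def c_eq[symmetric])
        then show ?thesis by (simp add: pos_divide_less_eq algebra_simps)
      next
        assume "u \<in> U"
        then have "s < (\<gamma> u \<eta> - \<gamma> v \<eta>) / (A v $ k - A u $ k)" "A v $ k < A u $ k"
          using s by (auto simp: J_def U_def c_eq[symmetric])
        then show ?thesis by (simp add: neg_less_divide_eq algebra_simps)
      qed
      have le: "\<gamma> u \<eta> + A u $ k * s \<le> \<gamma> v \<eta> + A v $ k * s" if "u \<in> V" for u
      proof -
        consider "u = v" | "u \<in> E" | "u \<in> P \<union> U"
          using \<open>u \<in> V\<close> unfolding E_def P_def U_def by fastforce
        then show ?thesis
        proof cases
          case 2
          then show ?thesis
            using ge[OF 2] by (auto simp: E_def \<gamma>_def inner_diff_left)
        next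
          case 3
          then show ?thesis using lt[OF 3] by simp
        qed simp
      qed
      have v_act: "v \<in> ?act"
        using v le by (simp add: active_def slice)
      have "w \<noteq> v" "w \<in> V" "A w $ k = A v $ k"
        using w by (auto simp: E_def)
      moreover have "\<gamma> w \<eta> = \<gamma> v \<eta>"
        using eq by (simp add: \<gamma>_def inner_diff_left)
      ultimately have w_act: "w \<in> ?act"
        using le by (simp add: active_def slice)
      have same: "A u $ k = A v $ k" if "u \<in> ?act" for u
      proof (rule ccontr)
        assume "A u $ k \<noteq> A v $ k"
        then have "u \<in> P \<union> U"
          using that by (auto simp: P_def U_def active_def)
        then have "\<gamma> u \<eta> + A u $ k * s < \<gamma> v \<eta> + A v $ k * s"
          by (rule lt)
        moreover have "\<gamma> v \<eta> + A v $ k * s \<le> \<gamma> u \<eta> + A u $ k * s"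
          using that v by (auto simp: active_def slice)
        ultimately show False by simp
      qed
      obtain v' w' where "v' \<in> ?act" "w' \<in> ?act" "A v' $ k \<noteq> A w' $ k"
        using kink[OF v_act w_act] \<open>w \<noteq> v\<close> by blast
      then show False
        using same by simp
    qed
    then show "\<theta> \<eta> = 0"
      using \<theta>_J[of \<eta>] by simp
  qed
  moreover have "measure N {s. active V A \<beta> (upd k s \<eta>) = {v}}
      = (if \<forall>w\<in>E. 0 < (a v - a w) \<bullet> \<eta> + (\<beta> v - \<beta> w) then \<theta> \<eta> else 0)" for \<eta>
    unfolding set_eq using \<theta>_J[of \<eta>] by (simp add: p_def)
  ultimately show "lip_rdiff e (\<lambda>\<eta>. measure N {s. active V A \<beta> (upd k s \<eta>) = {v}})"
    by simp
qed

lemma max_affine_mixed_forward_partial: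
  fixes A :: "'v \<Rightarrow> real^'d"
  assumes V: "finite V" "V \<noteq> {}" and \<sigma>: "0 < \<sigma>" and \<rho>: "\<rho> k = normal_density \<mu> \<sigma>" and "i \<noteq> k"
    and kink: "\<And>\<eta> v w. v \<in> active V A \<beta> \<eta> \<Longrightarrow> w \<in> active V A \<beta> \<eta> \<Longrightarrow> v \<noteq> w \<Longrightarrow>
      \<exists>v'\<in>active V A \<beta> \<eta>. \<exists>w'\<in>active V A \<beta> \<eta>. A v' $ k \<noteq> A w' $ k"
  shows "\<exists>g' g''. forward_partial i (anova_proj \<rho> k (max_affine V A \<beta>)) g' \<and> forward_partial j g' g''"
proof -
  obtain f' where f': "forward_partial i (max_affine V A \<beta>) f'"
    and f'_active: "\<And>v \<eta>. v \<in> V \<Longrightarrow> active V A \<beta> \<eta> = {v} \<Longrightarrow> f' \<eta> = A v $ i"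
    using max_affine_forward_partial[OF V] by blast
  have "finite_first_moment (\<rho> k)"
    unfolding \<rho> using \<sigma> by (rule finite_first_moment_normal)
  then have g': "forward_partial i (anova_proj \<rho> k (max_affine V A \<beta>)) (anova_proj \<rho> k f')"
    using f' \<open>i \<noteq> k\<close> by (intro forward_partial_anova_proj)
  define N where "N = density lborel (\<lambda>x. ennreal (normal_density \<mu> \<sigma> x))"
  interpret N: prob_space N
    unfolding N_def using \<sigma> by (rule prob_space_normal_density)
  define S where "S v \<eta> = {s. active V A \<beta> (upd k s \<eta>) = {v}}" for v \<eta>
  have S_sets: "S v \<eta> \<in> sets borel" if "v \<in> V" for v \<eta>
    unfolding S_def using V(1) that \<sigma> kink by (rule lip_rdiff_argmax_measure(2))
  have sets_N: "sets N = sets borel"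
    by (simp add: N_def)
  have [measurable]: "f' \<in> borel_measurable borel"
    using forward_partialD(2)[OF f'] .
  have proj_eq: "anova_proj \<rho> k f' \<eta> = (\<Sum>v\<in>V. A v $ i * measure N (S v \<eta>))" for \<eta>
  proof -
    \<comment> \<open>The crossing points of all pairs of pieces along the line. Pairs of equal
      slope contribute the default 0 of a division by zero, which adds at most one point.\<close>
    define X where "X = (\<lambda>(w, w'). (A w' \<bullet> upd k 0 \<eta> + \<beta> w' - (A w \<bullet> upd k 0 \<eta> + \<beta> w)) / (A w $ k - A w' $ k)) ` (V \<times> V)"
    have slice: "A w \<bullet> upd k s \<eta> + \<beta> w = (A w \<bullet> upd k 0 \<eta> + \<beta> w) + A w $ k * s" for w s
      by (simp add: upd_eq inner_add_right inner_axis algebra_simps)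
    have "finite X"
      using V(1) by (simp add: X_def)
    \<comment> \<open>At a tie, \<open>kink\<close> provides two maximisers of different slope;
      \<open>s\<close> is then the crossing point of this pair and belongs to
      \<open>X\<close>.\<close>
    have single: "\<exists>v\<in>V. active V A \<beta> (upd k s \<eta>) = {v}" if "s \<notin> X" for s
    proof (rule ccontr)
      assume no: "\<not> ?thesis"
      let ?act = "active V A \<beta> (upd k s \<eta>)"
      obtain v where v: "v \<in> ?act"
        using active_nonempty[OF V] by blast
      then have "?act \<noteq> {v}"
        using no by (auto simp: active_def)
      then obtain w where "w \<in> ?act" "v \<noteq> w"
        using v by blast
      then obtain v' w' where vw: "v' \<in> ?act" "w' \<in> ?act" "A v' $ k \<noteq> A w' $ k"
        using kink[OF v] by blast
      then have "A v' \<bullet> upd k s \<eta> + \<beta> v' = A w' \<bullet> upd k s \<eta> + \<beta> w'"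
        by (auto simp: active_def intro: antisym)
      then have "(A v' \<bullet> upd k 0 \<eta> + \<beta> v') + A v' $ k * s = (A w' \<bullet> upd k 0 \<eta> + \<beta> w') + A w' $ k * s"
        unfolding slice[of v' s] slice[of w' s] .
      then have "s * (A v' $ k - A w' $ k) = (A w' \<bullet> upd k 0 \<eta> + \<beta> w') - (A v' \<bullet> upd k 0 \<eta> + \<beta> v')"
        by (simp add: algebra_simps)
      then have "s = ((A w' \<bullet> upd k 0 \<eta> + \<beta> w') - (A v' \<bullet> upd k 0 \<eta> + \<beta> v')) / (A v' $ k - A w' $ k)"
        using vw(3) by (simp add: eq_divide_eq)
      moreover have "v' \<in> V" "w' \<in> V"
        using vw by (auto simp: active_def)
      ultimately have "s \<in> X"
        unfolding X_def by (intro image_eqI[of _ _ "(v', w')"]) auto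
      then show False using that by simp
    qed
    have step: "f' (upd k s \<eta>) = (\<Sum>v\<in>V. A v $ i * indicator (S v \<eta>) s)" if s: "s \<notin> X" for s
    proof -
      obtain v where v: "v \<in> V" "active V A \<beta> (upd k s \<eta>) = {v}"
        using single[OF s] by blast
      have "(\<Sum>u\<in>V. A u $ i * indicator (S u \<eta>) s) = (\<Sum>u\<in>V. if u = v then A v $ i else 0)"
        using v by (intro sum.cong) (auto simp: S_def)
      also have "\<dots> = A v $ i"
        using v(1) V(1) by simp
      finally show ?thesis
        using f'_active[OF v] by simp
    qed
    have AE: "AE s in N. f' (upd k s \<eta>) = (\<Sum>v\<in>V. A v $ i * indicator (S v \<eta>) s)"
    proof -
      have "AE s in lborel. s \<notin> X"
        using finite_imp_null_set_lborel[OF \<open>finite X\<close>] by (rule AE_not_in)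
      then show ?thesis
        unfolding N_def by (subst AE_density) (auto elim!: eventually_mono intro: step)
    qed
    have "anova_proj \<rho> k f' \<eta> = (\<integral>s. normal_density \<mu> \<sigma> s *\<^sub>R f' (upd k s \<eta>) \<partial>lborel)"
      by (simp add: anova_proj_upd \<rho> mult.commute)
    also have "\<dots> = (\<integral>s. f' (upd k s \<eta>) \<partial>N)"
      unfolding N_def by (rule integral_density[symmetric]) auto
    also have "\<dots> = (\<integral>s. (\<Sum>v\<in>V. A v $ i * indicator (S v \<eta>) s) \<partial>N)"
    proof (rule integral_cong_AE)
      show "(\<lambda>s. f' (upd k s \<eta>)) \<in> borel_measurable N"
        unfolding N_def by simp
      show "(\<lambda>s. \<Sum>v\<in>V. A v $ i * indicator (S v \<eta>) s) \<in> borel_measurable N"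
        using S_sets by (intro borel_measurable_sum borel_measurable_times borel_measurable_indicator) (auto simp: sets_N)
    qed (rule AE)
    also have "\<dots> = (\<Sum>v\<in>V. \<integral>s. A v $ i * indicator (S v \<eta>) s \<partial>N)"
    proof (intro Bochner_Integration.integral_sum integrable_mult_right N.integrable_const_bound[where B = 1])
      show "(indicator (S v \<eta>) :: real \<Rightarrow> real) \<in> borel_measurable N" if "v \<in> V" for v
        by (rule borel_measurable_indicator) (simp add: sets_N S_sets that)
    qed auto
    also have "\<dots> = (\<Sum>v\<in>V. A v $ i * measure N (S v \<eta>))"
      using S_sets sets_eq_imp_space_eq[OF sets_N] by (intro sum.cong) (auto simp: sets_N)
    finally show ?thesis .
  qed
  have "lip_rdiff (axis j 1) (\<lambda>\<eta>. \<Sum>v\<in>V. A v $ i * measure N (S v \<eta>))"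
    unfolding S_def N_def using V(1) \<sigma> kink
    by (intro lip_rdiff_sum lip_rdiff_scale lip_rdiff_argmax_measure(1))
  then have "lip_rdiff (axis j 1) (anova_proj \<rho> k f')"
    by (simp only: proj_eq[abs_def])
  then show ?thesis
    using lip_rdiff_forward_partial forward_partialD(4)[OF g'] g' by blast
qed

section \<open>The two-stage integrand\<close>

lemma polyhedron_dual_feasible: "polyhedron (dual_feasible W q)"
proof -
  have "dual_feasible W q = (\<Inter>j. {z. column j W \<bullet> z \<le> q $ j})"
    by (auto simp: dual_feasible_def matrix_vector_mult_def transpose_def column_def inner_vec_def)
  then show ?thesis
    by (auto intro!: polyhedron_Inter polyhedron_halfspace_le)
qed

lemma transformed_integrand_eq_max_affine:
  fixes \<iota> :: "'d::finite \<Rightarrow> 'r::finite"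
  assumes "inj \<iota>"
  shows "transformed_integrand \<iota> hbar W q T x Q = max_affine (vertices (dual_feasible W q))
    (\<lambda>v. \<chi> k. (hat \<iota> Q *v v) $ \<iota> k)
    (\<lambda>v. (\<Sum>i\<in>- range \<iota>. (hat \<iota> Q *v v) $ i * hbar $ i) - (hat \<iota> Q *v v) \<bullet> (hat \<iota> Q *v (T *v x)))"
proof -
  have "z \<bullet> pad \<iota> hbar \<eta> = (\<chi> k. z $ \<iota> k) \<bullet> \<eta> + (\<Sum>i\<in>- range \<iota>. z $ i * hbar $ i)" for z \<eta>
    using inner_pad[OF assms, of z "\<chi> k. z $ \<iota> k" hbar \<eta>] by (simp add: pad_self assms)
  then show ?thesis
    by (simp add: transformed_integrand_def max_affine_def fun_eq_iff inner_diff_right algebra_simps)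
qed

text \<open>The maximal face at \<open>\<eta>\<close> has an edge as soon as it has two vertices.\<close>

lemma active_vertices_kink:
  fixes \<iota> :: "'d::finite \<Rightarrow> 'r::finite"
  assumes \<iota>: "inj \<iota>" and Q: "orthogonal_matrix Q"
    and D_repr: "dual_feasible W q =
          {a + b | a b. a \<in> convex hull (vertices (dual_feasible W q)) \<and>
                        (\<forall>j. (transpose W *v b) $ j \<le> 0)}"
    and A1: "\<And>z. \<exists>y. (\<forall>j. 0 \<le> y $ j) \<and> W *v y = pad \<iota> hbar z - T *v x"
    and distinct: "adjacent_components_distinct ((*v) (hat \<iota> Q) ` dual_feasible W q)"
  defines "V \<equiv> vertices (dual_feasible W q)"
  defines "A \<equiv> \<lambda>v. (\<chi> k. (hat \<iota> Q *v v) $ \<iota> k) :: real^'d"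
  defines "\<beta> \<equiv> \<lambda>v. (\<Sum>i\<in>- range \<iota>. (hat \<iota> Q *v v) $ i * hbar $ i) - (hat \<iota> Q *v v) \<bullet> (hat \<iota> Q *v (T *v x))"
  assumes v: "v \<in> active V A \<beta> \<eta>" "w \<in> active V A \<beta> \<eta>" "v \<noteq> w"
  shows "\<exists>v'\<in>active V A \<beta> \<eta>. \<exists>w'\<in>active V A \<beta> \<eta>. A v' $ k \<noteq> A w' $ k"
proof -
  define D where "D = dual_feasible W q"
  define C where "C = {b. \<forall>j. (transpose W *v b) $ j \<le> 0}"
  \<comment> \<open>The scenario \<open>\<eta>\<close> is rotated back. By orthogonality the pieces
    at \<open>\<eta>\<close> are the values of \<open>p\<close> at the vertices, so the maximal face
    can be studied on the original polyhedron.\<close>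
  define p where "p = pad \<iota> hbar (transpose Q *v \<eta>) - T *v x"
  have val: "A u \<bullet> \<eta> + \<beta> u = p \<bullet> u" for u
  proof -
    have "Q *v (transpose Q *v \<eta>) = \<eta>"
    proof -
      have "Q ** transpose Q = mat 1"
        using Q by (simp add: orthogonal_matrix_def)
      then show ?thesis
        by (simp only: matrix_vector_mul_assoc matrix_vector_mul_lid)
    qed
    then have "hat \<iota> Q *v p = pad \<iota> hbar \<eta> - hat \<iota> Q *v (T *v x)"
      using pad_orthogonal_transform[OF \<iota>, of hbar Q "transpose Q *v \<eta>"]
      by (simp add: p_def matrix_vector_mult_diff_distrib)
    then have "u \<bullet> p = (hat \<iota> Q *v u) \<bullet> (pad \<iota> hbar \<eta> - hat \<iota> Q *v (T *v x))"
      using hat_inner[OF \<iota> Q, of u p] by simp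
    also have "\<dots> = A u \<bullet> \<eta> + \<beta> u"
      using inner_pad[OF \<iota>, of "hat \<iota> Q *v u" "A u" hbar \<eta>] pad_self[OF \<iota>, of "hat \<iota> Q *v u"]
      by (simp add: A_def \<beta>_def inner_diff_right)
    finally show ?thesis by (simp add: inner_commute)
  qed
  have "\<exists>a b. adjacent_vertices D a b \<and> p \<bullet> a = p \<bullet> v \<and> p \<bullet> b = p \<bullet> v"
  proof (rule adjacent_maximisers_exist)
    show "polyhedron D"
      by (simp add: D_def polyhedron_dual_feasible)
    show "\<exists>a\<in>convex hull vertices D. \<exists>b\<in>C. z = a + b" if "z \<in> D" for z
    proof -
      have "z \<in> {a + b | a b. a \<in> convex hull (vertices (dual_feasible W q)) \<and>
                        (\<forall>j. (transpose W *v b) $ j \<le> 0)}"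
        using that D_repr unfolding D_def by blast
      then show ?thesis
        by (auto simp: D_def C_def)
    qed
    show "z + b \<in> D" if "z \<in> D" "b \<in> C" for z b
    proof -
      have "(transpose W *v (z + b)) $ j \<le> q $ j" for j
      proof -
        have "(transpose W *v z) $ j \<le> q $ j" "(transpose W *v b) $ j \<le> 0"
          using that unfolding D_def C_def dual_feasible_def by blast+
        then show ?thesis
          unfolding matrix_vector_right_distrib vector_add_component by linarith
      qed
      then show ?thesis
        unfolding D_def dual_feasible_def by blast
    qed
    \<comment> \<open>Relatively complete recourse writes \<open>p\<close> as \<open>W *v y\<close>
      with nonnegative \<open>y\<close>, and moving \<open>W\<close> to the other side of the inner
      product pairs \<open>y\<close> with a nonpositive vector.\<close>
    show "p \<bullet> b \<le> 0" if "b \<in> C" for b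
    proof -
      obtain y where y: "\<And>j. 0 \<le> y $ j" "W *v y = p"
        using A1[of "transpose Q *v \<eta>"] by (auto simp: p_def)
      have "p \<bullet> b = y \<bullet> (transpose W *v b)"
        unfolding y(2)[symmetric] by (metis dot_lmul_matrix inner_commute transpose_matrix_vector)
      also have "\<dots> = (\<Sum>j\<in>UNIV. y $ j * (transpose W *v b) $ j)"
        by (simp add: inner_vec_def)
      also have "\<dots> \<le> 0"
        using y(1) that by (intro sum_nonpos mult_nonneg_nonpos) (auto simp: C_def)
      finally show ?thesis .
    qed
    show "v \<in> vertices D" "w \<in> vertices D"
      using v by (auto simp: active_def V_def D_def)
    show "p \<bullet> u \<le> p \<bullet> v" if "u \<in> vertices D" for u
      using v(1) that by (simp add: active_def V_def D_def val)
    show "p \<bullet> w = p \<bullet> v"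
      using v by (auto simp: active_def val intro: antisym)
  qed (fact v(3))
  then obtain a b where ab: "adjacent_vertices D a b" "p \<bullet> a = p \<bullet> v" "p \<bullet> b = p \<bullet> v"
    by blast
  then have "a \<in> active V A \<beta> \<eta>" "b \<in> active V A \<beta> \<eta>"
    using v(1) by (auto simp: active_def val adjacent_vertices_def V_def D_def)
  \<comment> \<open>Adjacency is preserved by the injective map \<open>hat \<iota> Q\<close>, so the
    geometric condition on the rotated polyhedron applies to the images of \<open>a\<close> and
    \<open>b\<close>.\<close>
  moreover have "A a $ k \<noteq> A b $ k"
    using distinct ab(1) adjacent_vertices_hat_image[OF \<iota> Q, of D a b]
    by (simp add: adjacent_components_distinct_def A_def D_def)
  ultimately show ?thesis by blast
qed

text \<open>Diagonalisation determines only the squares of the entries of \<open>\<sigma>\<close>,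
  so their signs are open. Passing to absolute values gives the positive standard deviations that
  the moment and distribution lemmas ask for.\<close>

lemma normal_density_abs: "normal_density \<mu> \<bar>\<sigma>\<bar> = normal_density \<mu> \<sigma>"
  by (simp add: normal_density_def fun_eq_iff)

text \<open>Conjugation by an orthogonal matrix keeps the determinant nonzero, and a vanishing
  variance would be a zero factor of it.\<close>

lemma diag_mat_similar_nonzero:
  fixes \<Sigma> Q :: "real^'d^'d"
  assumes "invertible \<Sigma>" "orthogonal_matrix Q" "Q ** \<Sigma> ** transpose Q = diag_mat (\<chi> i. (\<sigma> $ i)\<^sup>2)"
  shows "\<sigma> $ i \<noteq> 0"
proof -
  have "det Q \<noteq> 0"
    using det_orthogonal_matrix[OF assms(2)] by auto
  then have "det (Q ** \<Sigma> ** transpose Q) \<noteq> 0"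
    using assms(1) by (simp add: det_mul det_transpose invertible_det_nz)
  moreover have "det (diag_mat (\<chi> i. (\<sigma> $ i)\<^sup>2)) = (\<Prod>i\<in>UNIV. (\<sigma> $ i)\<^sup>2)"
    by (subst det_diagonal) (auto simp: diag_mat_def)
  ultimately show ?thesis
    using assms(3) by auto
qed

theorem corollary6p1:
  fixes X :: "(real^'m) set" and x :: "real^'m"
    and T :: "real^'m^'r" and W :: "real^'n^'r" and q :: "real^'n"
    and \<iota> :: "'d::{finite,linorder} \<Rightarrow> 'r" and hbar :: "real^'r"
    and M :: "'\<omega> measure" and \<xi> :: "'\<omega> \<Rightarrow> real^'d::_"
  assumes "inj \<iota>"
    and "polyhedron X" and "x \<in> X"
    and "prob_space M" and "\<xi> \<in> borel_measurable M"
    and D_repr: "dual_feasible W q =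
          {a + b | a b. a \<in> convex hull (vertices (dual_feasible W q)) \<and>
                        (\<forall>j. (transpose W *v b) $ j \<le> 0)}"
    and A1: "\<And>z x'. x' \<in> X \<Longrightarrow> \<exists>y. (\<forall>j. 0 \<le> y $ j) \<and> W *v y = pad \<iota> hbar z - T *v x'"
    and A2: "dual_feasible W q \<noteq> {}"
    and A3: "integrable (distr M borel \<xi>) norm"
  shows
    "((\<forall>a b. adjacent_vertices (dual_feasible W q) a b \<longrightarrow>
          (\<exists>k. a $ \<iota> k \<noteq> b $ \<iota> k) \<and> (\<forall>i. i \<notin> range \<iota> \<longrightarrow> a $ i \<noteq> b $ i))
      \<longrightarrow> residual_in {Q :: real^'d::_^'d::_. orthogonal_matrix Q}
            {Q. orthogonal_matrix Q \<and>
                adjacent_components_distinct ((*v) (hat \<iota> Q) ` dual_feasible W q)})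
     \<and>
     (\<forall>\<mu> \<Sigma> Q \<sigma>.
        CARD('d) \<noteq> 2 \<and>
        transpose \<Sigma> = \<Sigma> \<and> (\<forall>z. 0 \<le> z \<bullet> (\<Sigma> *v z)) \<and> invertible \<Sigma> \<and>
        distributed M lborel \<xi> (\<lambda>y. ennreal (mv_normal_density \<mu> \<Sigma> y)) \<and>
        orthogonal_matrix Q \<and>
        Q ** \<Sigma> ** transpose Q = diag_mat (\<chi> i. (\<sigma> $ i)\<^sup>2) \<and>
        adjacent_components_distinct ((*v) (hat \<iota> Q) ` dual_feasible W q)
      \<longrightarrow> second_order_anova (\<lambda>k. normal_density (\<mu> $ k) (\<sigma> $ k))
            (transformed_integrand \<iota> hbar W q T x Q)
          \<in> W2_mix (mv_normal_density \<mu> (diag_mat (\<chi> i. (\<sigma> $ i)\<^sup>2))))"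
proof -
  let ?V = "vertices (dual_feasible W q)"
  have finV: "finite ?V"
    using finite_polyhedron_extreme_points[OF polyhedron_dual_feasible] by (simp add: vertices_def)
  \<comment> \<open>Without vertices the convex hull would be empty, and by \<open>D_repr\<close> so
    would the dual feasible set, against dual feasibility.\<close>
  have neV: "?V \<noteq> {}"
  proof
    assume "?V = {}"
    then have "{a + b | a b. a \<in> convex hull ?V \<and> (\<forall>j. (transpose W *v b) $ j \<le> 0)} = {}"
      by simp
    then show False
      using D_repr A2 by blast
  qed
  show ?thesis
  proof (intro conjI impI allI)
    assume "\<forall>a b. adjacent_vertices (dual_feasible W q) a b \<longrightarrow>
          (\<exists>k. a $ \<iota> k \<noteq> b $ \<iota> k) \<and> (\<forall>i. i \<notin> range \<iota> \<longrightarrow> a $ i \<noteq> b $ i)"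
    then show "residual_in {Q :: real^'d::_^'d::_. orthogonal_matrix Q}
            {Q. orthogonal_matrix Q \<and>
                adjacent_components_distinct ((*v) (hat \<iota> Q) ` dual_feasible W q)}"
      by (intro residual_adjacent_components_distinct \<open>inj \<iota>\<close> finV) blast
  next
    fix \<mu> \<sigma> :: "real^'d::_" and \<Sigma> Q :: "real^'d::_^'d::_"
    assume asm: "CARD('d) \<noteq> 2 \<and>
        transpose \<Sigma> = \<Sigma> \<and> (\<forall>z. 0 \<le> z \<bullet> (\<Sigma> *v z)) \<and> invertible \<Sigma> \<and>
        distributed M lborel \<xi> (\<lambda>y. ennreal (mv_normal_density \<mu> \<Sigma> y)) \<and>
        orthogonal_matrix Q \<and>
        Q ** \<Sigma> ** transpose Q = diag_mat (\<chi> i. (\<sigma> $ i)\<^sup>2) \<and>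
        adjacent_components_distinct ((*v) (hat \<iota> Q) ` dual_feasible W q)"
    then have card: "CARD('d) \<noteq> 2" and Q: "orthogonal_matrix Q"
      and distinct: "adjacent_components_distinct ((*v) (hat \<iota> Q) ` dual_feasible W q)"
      by auto
    have \<sigma>: "\<sigma> $ i \<noteq> 0" for i
      using asm diag_mat_similar_nonzero by blast
    define \<rho> where "\<rho> k = normal_density (\<mu> $ k) \<bar>\<sigma> $ k\<bar>" for k
    have \<rho>: "finite_first_moment (\<rho> k)" for k
      unfolding \<rho>_def using \<sigma>[of k] by (intro finite_first_moment_normal) simp
    define A where "A = (\<lambda>v. (\<chi> k. (hat \<iota> Q *v v) $ \<iota> k) :: real^'d::_)"
    define \<beta> where "\<beta> = (\<lambda>v. (\<Sum>i\<in>- range \<iota>. (hat \<iota> Q *v v) $ i * hbar $ i) - (hat \<iota> Q *v v) \<bullet> (hat \<iota> Q *v (T *v x)))"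
    have f: "transformed_integrand \<iota> hbar W q T x Q = max_affine ?V A \<beta>"
      unfolding A_def \<beta>_def by (rule transformed_integrand_eq_max_affine[OF \<open>inj \<iota>\<close>])
    have kink: "\<exists>v'\<in>active ?V A \<beta> \<eta>. \<exists>w'\<in>active ?V A \<beta> \<eta>. A v' $ k \<noteq> A w' $ k"
      if "v \<in> active ?V A \<beta> \<eta>" "w \<in> active ?V A \<beta> \<eta>" "v \<noteq> w" for \<eta> v w k
      using active_vertices_kink[OF \<open>inj \<iota>\<close> Q D_repr A1[OF \<open>x \<in> X\<close>] distinct] that
      unfolding A_def \<beta>_def by blast
    have "second_order_anova \<rho> (max_affine ?V A \<beta>)
        \<in> W2_mix (\<lambda>y. \<Prod>i\<in>UNIV. normal_density (\<mu> $ i) \<bar>\<sigma> $ i\<bar> (y $ i))"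
    proof (rule second_order_anova_W2_mix[OF _ \<rho> _ _ card])
      show "0 < \<bar>\<sigma> $ i\<bar>" for i
        using \<sigma>[of i] by simp
      show "\<exists>f'. forward_partial i (max_affine ?V A \<beta>) f'" for i
        using max_affine_forward_partial[OF finV neV] by blast
      show "\<exists>g' g''. forward_partial i (anova_proj \<rho> k (max_affine ?V A \<beta>)) g' \<and> forward_partial j g' g''"
        if "i \<noteq> j" "i \<noteq> k" "j \<noteq> k" for i j k
      proof (rule max_affine_mixed_forward_partial[OF finV neV])
        show "0 < \<bar>\<sigma> $ k\<bar>"
          using \<sigma>[of k] by simp
      qed (use that kink in \<open>auto simp: \<rho>_def\<close>)
    qed
    moreover have "\<rho> = (\<lambda>k. normal_density (\<mu> $ k) (\<sigma> $ k))"
      by (simp add: \<rho>_def normal_density_abs fun_eq_iff)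
    moreover have "mv_normal_density \<mu> (diag_mat (\<chi> i. (\<sigma> $ i)\<^sup>2))
        = (\<lambda>y. \<Prod>i\<in>UNIV. normal_density (\<mu> $ i) \<bar>\<sigma> $ i\<bar> (y $ i))"
      using mv_normal_density_diag[of \<sigma> \<mu>, OF \<sigma>] by (simp add: normal_density_abs fun_eq_iff)
    ultimately show "second_order_anova (\<lambda>k. normal_density (\<mu> $ k) (\<sigma> $ k))
            (transformed_integrand \<iota> hbar W q T x Q)
          \<in> W2_mix (mv_normal_density \<mu> (diag_mat (\<chi> i. (\<sigma> $ i)\<^sup>2)))"
      by (simp add: f)
  qed
qed

end
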